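(* Let $\Omega$, $\Gamma^D,\Gamma^N$, the mesh $\mathcal M=(\mathcal T,\mathcal E,\mathcal P)$, the parameters $D,p,\eta,\vec m,\gamma,\tau,\lambda_D,\triangle t$, and the data $C,n_0^0,\vec n^0,n^D,V^D$ be as described in the context, and consider the finite-volume scheme (S) defined there. Set $$\alpha:=\frac{D(1+p)\|C\|_\infty}{\lambda_D^2},$$ and assume $$0<\triangle t<\frac1\alpha=\frac{\lambda_D^2}{D(1+p)\|C\|_\infty},\qquad 0<\tau\le\frac{\eta\lambda_D^2}{D\|C\|_\infty}$$ (if $\|C\|_\infty=0$, the upper bounds are $+\infty$, i.e. only $\triangle t>0$ and $\tau>0$ are required). Define $$M^0=\max\left(\frac12\sup_{\partial\Omega}n^D,\ \sup_\Omega\Big(\frac12 n_0^0+|\vec n^0\cdot\vec m|\Big),\ \sup_\Omega|\vec n_\perp^0|,\ \sup_\Omega C\right),\qquad \vec n^0_\perp=\vec n^0-(\vec n^0\cdot\vec m)\vec m,$$ and $M^k=M^0(1-\alpha\triangle t)^{-k}$ for $k\ge 1$. Then, starting from the initial values $(n^0_{0,K},\vec n^0_K)_{K\in\mathcal T}$, for every $k\ge1$ there exists a solution $(n_{0,\mathcal T}^k,\vec n_{\mathcal T}^k,V_{\mathcal T}^k)=(n_{0,K}^k,\vec n_K^k,V_K^k)_{K\in\mathcal T}$ to scheme (S) satisfying, for all $K\in\mathcal T$, $$0\le n_{0,K}^k\le 2M^0,\qquad 0\le n_{\pm,K}^k\le M^0,\qquad |\vec n_K^k|\le 2M^k,$$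 where $n_{\pm,K}^k=\frac12 n_{0,K}^k\pm\vec n_K^k\cdot\vec m$.
   Context: **Domain and data.** $\Omega\subset\mathbb R^2$ is a bounded polygonal domain, $\partial\Omega=\Gamma^D\cup\Gamma^N$, $\Gamma^D\cap\Gamma^N=\emptyset$, $\mathrm m(\Gamma^D)>0$ (one-dimensional measure), $\Gamma^N$ open in $\partial\Omega$. The quantities $D>0$, $p\in[0,1)$, $\vec m\in\mathbb R^3$ are constant with $|\vec m|=1$; $\eta=\sqrt{1-p^2}$; $\gamma>0$, $\tau>0$, $\lambda_D>0$ are constants; $\triangle t>0$ is the time step. The doping profile satisfies $C\in L^\infty(\Omega)$. The data satisfy $n_0^0,n^D\in L^\infty(\Omega)$, $\vec n^0\in L^\infty(\Omega)^3$, $\frac12n_0^0\pm\vec n^0\cdot\vec m\ge0$ and $n^D\ge0$ in $\Omega$, $n^D,V^D\in H^1(\Omega)$. Suprema are essential suprema; values of $n^D,V^D$ on $\partial\Omega$ are traces. **Mesh.** $\mathcal T$ is a finite family of disjoint open convex polygonal cells $K\subset\Omega$ with $\overline\Omega=\bigcup_K\overline K$; $\mathcal E$ is a finite family of pairwise disjoint edges (segments of positive length) and $\mathcal P=(x_K)_{K\in\mathcal T}$ a family of points with $x_K\in\overline K$. The mesh is admissible (in the sense of Eymard–Gallouët–Herbin): $\partial K=\bigcup_{\sigma\in\mathcal E_K}\overline\sigma$ for a subset $\mathcal E_K\subset\mathcal E$, $\mathcal E=\bigcup_K\mathcal E_K$; for $K\ne L$ either $\overline K\cap\overline L$ has zero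 length or equals $\overline\sigma$ for some $\sigma\in\mathcal E$, written $\sigma=K|L$; for $\sigma=K|L$ one has $x_K\neq x_L$ and the line through $x_K,x_L$ is orthogonal to $\sigma$; for $\sigma\subset\partial\Omega$, $\sigma\in\mathcal E_K$, the line through $x_K$ orthogonal to $\sigma$ meets $\sigma$. Edges are interior ($\sigma=K|L$) or exterior ($\sigma\subset\partial\Omega$); every exterior edge lies either in $\Gamma^D$ (set $\mathcal E^D_{\rm ext}$) or in $\Gamma^N$ (set $\mathcal E^N_{\rm ext}$); $\mathcal E_{K,\rm ext}^{D}=\mathcal E_K\cap\mathcal E_{\rm ext}^{D}$ and $\mathcal E_{K,\rm ext}^{N}=\mathcal E_K\cap\mathcal E_{\rm ext}^{N}$. There exists $\xi>0$ such that $\mathrm d(x_K,\sigma)\ge\xi\,\mathrm{diam}(K)$ for all $K\in\mathcal T$, $\sigma\in\mathcal E_K$. Let $\mathrm m(\cdot)$ denote the length of an edge or the area of a cell, $\mathrm d_\sigma=|x_K-x_L|$ if $\sigma=K|L$, $\mathrm d_\sigma=\mathrm d(x_K,\sigma)$ if $\sigma\in\mathcal E_K$ is exterior, and $\tau_\sigma=\mathrm m(\sigma)/\mathrm d_\sigma$ (not to be confused with the relaxation time $\tau$). **Discrete notation.** For cell values $(u_K)_{K\in\mathcal T}$ and Dirichlet edge values $(u_\sigma)_{\sigma\in\mathcal E^D_{\rm ext}}$, put for $\sigma\in\mathcal E_K$: $u_{K,\sigma}=u_L$ if $\sigma=K|L$; $u_{K,\sigma}=u_\sigma$ if $\sigma\in\mathcal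 E^D_{K,\rm ext}$; $u_{K,\sigma}=u_K$ if $\sigma\in\mathcal E^N_{K,\rm ext}$; and $\mathrm Du_{K,\sigma}=u_{K,\sigma}-u_K$. The Bernoulli function is $B(x)=x/(e^x-1)$ for $x\ne0$, $B(0)=1$. **Scheme (S).** Initial values: $(n_{0,K}^0,\vec n_K^0)=\frac1{\mathrm m(K)}\int_K(n_0^0,\vec n^0)\,dx$. Also $C_K=\frac1{\mathrm m(K)}\int_KC\,dx$. Boundary values for $\sigma\in\mathcal E^D_{\rm ext}$: $n_{0,\sigma}^k=\frac1{\mathrm m(\sigma)}\int_\sigma n^D\,ds$, $\vec n_\sigma^k=0$, $V_\sigma^k=\frac1{\mathrm m(\sigma)}\int_\sigma V^D\,ds$; on Neumann edges $\mathrm Dn_{\ell,K,\sigma}^k=\mathrm DV_{K,\sigma}^k=0$, and the fluxes $J_{\ell,K,\sigma}^k$ below vanish there. Writing $\vec n=(n_1,n_2,n_3)$, for all $K\in\mathcal T$ and $k\ge1$: $$\mathrm m(K)\frac{n_{0,K}^k-n_{0,K}^{k-1}}{\triangle t}+\sum_{\sigma\in\mathcal E_K}j_{0,K,\sigma}^k=0,$$ $$\mathrm m(K)\frac{\vec n_K^k-\vec n_K^{k-1}}{\triangle t}+\sum_{\sigma\in\mathcal E_K}\vec j_{K,\sigma}^k-2\gamma\,\mathrm m(K)(\vec n_K^k\times\vec m)=-\frac{\mathrm m(K)}{\tau}\vec n_K^k,$$ $$-\lambda_D^2\sum_{\sigma\in\mathcal E_K}\tau_\sigma\mathrm DV_{K,\sigma}^k=\mathrm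 m(K)(n_{0,K}^k-C_K),$$ where $$j_{0,K,\sigma}^k=\frac D{\eta^2}\big(J_{0,K,\sigma}^k-2p\,\vec J_{K,\sigma}^k\cdot\vec m\big),$$ $$\vec j_{K,\sigma}^k=\frac D{\eta^2}\Big(\eta\vec J_{K,\sigma}^k+(1-\eta)(\vec J_{K,\sigma}^k\cdot\vec m)\vec m-\frac p2J_{0,K,\sigma}^k\vec m\Big),$$ with the Scharfetter–Gummel fluxes $$J_{\ell,K,\sigma}^k=\tau_\sigma\big(B(\mathrm DV_{K,\sigma}^k)n_{\ell,K}^k-B(-\mathrm DV_{K,\sigma}^k)n_{\ell,K,\sigma}^k\big),\quad \ell=0,1,2,3,\qquad \vec J_{K,\sigma}^k=(J_{1,K,\sigma}^k,J_{2,K,\sigma}^k,J_{3,K,\sigma}^k).$$ *)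

theory Defs
  imports
    "HOL-Analysis.Analysis"
    "HOL-Analysis.Cross3"
    "HOL-Probability.Essential_Supremum"
begin

type_synonym point = "real^2"

section \<open>Segments, length, polygonal domains\<close>

text \<open>An edge may or may not contain its end points.\<close>

definition segment_ends :: "point set \<Rightarrow> point \<Rightarrow> point \<Rightarrow> bool" where
  "segment_ends \<sigma> a b \<longleftrightarrow> a \<noteq> b \<and> open_segment a b \<subseteq> \<sigma> \<and> \<sigma> \<subseteq> closed_segment a b"

text \<open>Arc length on a segment: the image of Lebesgue measure under a unit-speed parametrization.
  The end points are determined up to their order, and the order does not matter.\<close>

definition segment_measure :: "point set \<Rightarrow> point measure" where
  "segment_measure \<sigma> =
     (let (a, b) = (SOME (a, b). segment_ends \<sigma> a b)
      in distr (restrict_space lborel {0..dist a b}) borel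
               (\<lambda>t. a + (t / dist a b) *\<^sub>R (b - a)))"

text \<open>One-dimensional measure carried by the union of a finite family of pairwise disjoint
  segments.\<close>

definition length_measure :: "point set set \<Rightarrow> point measure" where
  "length_measure S = measure_of UNIV (sets borel) (\<lambda>A. \<Sum>\<sigma>\<in>S. emeasure (segment_measure \<sigma>) A)"

definition edge_length :: "point set \<Rightarrow> real" where
  "edge_length \<sigma> = measure (segment_measure \<sigma>) \<sigma>"

definition edge_avg :: "point set \<Rightarrow> (point \<Rightarrow> real) \<Rightarrow> real" where
  "edge_avg \<sigma> g = (LINT x|segment_measure \<sigma>. g x) / edge_length \<sigma>"

text \<open>The condition \<open>interior (closure \<Omega>) = \<Omega>\<close> excludes slits, along which traces would be
  two-valued.\<close>

definition polygonal_domain :: "point set \<Rightarrow> bool" where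
  "polygonal_domain \<Omega> \<longleftrightarrow>
     open \<Omega> \<and> connected \<Omega> \<and> \<Omega> \<noteq> {} \<and> bounded \<Omega> \<and> interior (closure \<Omega>) = \<Omega> \<and>
     (\<exists>S. finite S \<and> (\<forall>s\<in>S. \<exists>a b. s = closed_segment a b) \<and> frontier \<Omega> = \<Union>S)"

section \<open>Function spaces and traces\<close>

definition Linf :: "point set \<Rightarrow> (point \<Rightarrow> 'a::real_normed_vector) \<Rightarrow> bool" where
  "Linf \<Omega> f \<longleftrightarrow> f \<in> borel_measurable (lebesgue_on \<Omega>) \<and> (\<exists>c. AE x in lebesgue_on \<Omega>. norm (f x) \<le> c)"

definition ess_sup :: "point measure \<Rightarrow> (point \<Rightarrow> real) \<Rightarrow> real" where
  "ess_sup \<mu> f = real_of_ereal (esssup \<mu> (\<lambda>x. ereal (f x)))"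

definition Linf_norm :: "point set \<Rightarrow> (point \<Rightarrow> real) \<Rightarrow> real" where
  "Linf_norm \<Omega> f = ess_sup (lebesgue_on \<Omega>) (\<lambda>x. \<bar>f x\<bar>)"

definition L2 :: "point measure \<Rightarrow> (point \<Rightarrow> 'a::real_normed_vector) \<Rightarrow> bool" where
  "L2 \<mu> f \<longleftrightarrow> f \<in> borel_measurable \<mu> \<and> integrable \<mu> (\<lambda>x. (norm (f x))\<^sup>2)"

definition L2_tendsto ::
  "point measure \<Rightarrow> (nat \<Rightarrow> point \<Rightarrow> 'a::real_normed_vector) \<Rightarrow> (point \<Rightarrow> 'a) \<Rightarrow> bool" where
  "L2_tendsto \<mu> f g \<longleftrightarrow>
     (\<lambda>j. \<integral>\<^sup>+x. ennreal ((norm (f j x - g x))\<^sup>2) \<partial>\<mu>) \<longlonglongrightarrow> 0"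

definition partial_deriv :: "2 \<Rightarrow> (point \<Rightarrow> real) \<Rightarrow> point \<Rightarrow> real" where
  "partial_deriv i f x = frechet_derivative f (at x) (axis i 1)"

text \<open>All iterated partial derivatives are differentiable (hence continuous), i.e.\ \<open>f\<close> is
  infinitely differentiable on the whole plane.\<close>

definition smooth_fun :: "(point \<Rightarrow> real) \<Rightarrow> bool" where
  "smooth_fun f \<longleftrightarrow> (\<forall>is. foldr partial_deriv is f differentiable_on UNIV)"

definition grad :: "(point \<Rightarrow> real) \<Rightarrow> point \<Rightarrow> point" where
  "grad f x = (\<chi> i. partial_deriv i f x)"

definition test_fun :: "point set \<Rightarrow> (point \<Rightarrow> real) \<Rightarrow> bool" where
  "test_fun \<Omega> \<phi> \<longleftrightarrow>
     smooth_fun \<phi> \<and> compact (closure {x. \<phi> x \<noteq> 0}) \<and> closure {x. \<phi> x \<noteq> 0} \<subseteq> \<Omega>"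

definition weak_grad :: "point set \<Rightarrow> (point \<Rightarrow> real) \<Rightarrow> (point \<Rightarrow> point) \<Rightarrow> bool" where
  "weak_grad \<Omega> u G \<longleftrightarrow>
     (\<forall>\<phi>. test_fun \<Omega> \<phi> \<longrightarrow>
        (LINT x|lebesgue_on \<Omega>. u x *\<^sub>R grad \<phi> x) = - (LINT x|lebesgue_on \<Omega>. \<phi> x *\<^sub>R G x))"

definition H1 :: "point set \<Rightarrow> (point \<Rightarrow> real) \<Rightarrow> bool" where
  "H1 \<Omega> u \<longleftrightarrow>
     L2 (lebesgue_on \<Omega>) u \<and> (\<exists>G. L2 (lebesgue_on \<Omega>) G \<and> weak_grad \<Omega> u G)"

text \<open>\<open>g\<close> is (a Borel representative of) the trace of \<open>u\<close>, where \<open>\<mu>\<close> is the one-dimensional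
  measure on the boundary: the trace operator is the continuous extension to \<open>H1\<close>, with values
  in \<open>L2 \<mu>\<close>, of the restriction to the boundary of functions smooth up to the boundary.\<close>

definition is_trace ::
  "point set \<Rightarrow> point measure \<Rightarrow> (point \<Rightarrow> real) \<Rightarrow> (point \<Rightarrow> real) \<Rightarrow> bool" where
  "is_trace \<Omega> \<mu> u g \<longleftrightarrow>
     L2 \<mu> g \<and>
     (\<exists>G \<phi>. L2 (lebesgue_on \<Omega>) G \<and> weak_grad \<Omega> u G \<and>
        (\<forall>j. smooth_fun (\<phi> j)) \<and>
        L2_tendsto (lebesgue_on \<Omega>) \<phi> u \<and>
        L2_tendsto (lebesgue_on \<Omega>) (\<lambda>j. grad (\<phi> j)) G \<and>
        L2_tendsto \<mu> \<phi> g)"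

section \<open>Admissible meshes\<close>

record mesh =
  cells :: "point set set"
  edges :: "point set set"
  cell_edges :: "point set \<Rightarrow> point set set"
  center :: "point set \<Rightarrow> point"

text \<open>\<open>\<sigma> = K|L\<close>\<close>

definition common_edge :: "point set \<Rightarrow> point set \<Rightarrow> point set \<Rightarrow> bool" where
  "common_edge K L \<sigma> \<longleftrightarrow> K \<noteq> L \<and> closure K \<inter> closure L = closure \<sigma>"

definition ext_edges :: "point set \<Rightarrow> mesh \<Rightarrow> point set set" where
  "ext_edges \<Omega> M = {\<sigma>\<in>edges M. \<sigma> \<subseteq> frontier \<Omega>}"

definition boundary_measure :: "point set \<Rightarrow> mesh \<Rightarrow> point measure" where
  "boundary_measure \<Omega> M = length_measure (ext_edges \<Omega> M)"

definition dirichlet_edges :: "point set \<Rightarrow> point set \<Rightarrow> mesh \<Rightarrow> point set set" where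
  "dirichlet_edges \<Omega> \<Gamma>D M = {\<sigma>\<in>ext_edges \<Omega> M. \<sigma> \<subseteq> \<Gamma>D}"

definition convex_polygon :: "point set \<Rightarrow> bool" where
  "convex_polygon K \<longleftrightarrow> open K \<and> convex K \<and> K \<noteq> {} \<and> polytope (closure K)"

definition admissible_mesh :: "point set \<Rightarrow> mesh \<Rightarrow> bool" where
  "admissible_mesh \<Omega> M \<longleftrightarrow>
     finite (cells M) \<and> pairwise disjnt (cells M) \<and>
     (\<forall>K\<in>cells M. convex_polygon K \<and> K \<subseteq> \<Omega>) \<and>
     closure \<Omega> = (\<Union>K\<in>cells M. closure K) \<and>
     finite (edges M) \<and> pairwise disjnt (edges M) \<and>
     (\<forall>\<sigma>\<in>edges M. \<exists>a b. segment_ends \<sigma> a b) \<and>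
     (\<forall>K\<in>cells M. cell_edges M K \<subseteq> edges M \<and>
        frontier K = (\<Union>\<sigma>\<in>cell_edges M K. closure \<sigma>)) \<and>
     edges M = (\<Union>K\<in>cells M. cell_edges M K) \<and>
     (\<forall>K\<in>cells M. center M K \<in> closure K) \<and>
     (\<forall>K\<in>cells M. \<forall>L\<in>cells M. K \<noteq> L \<longrightarrow>
        emeasure (length_measure (edges M)) (closure K \<inter> closure L) = 0 \<or>
        (\<exists>\<sigma>\<in>edges M. closure K \<inter> closure L = closure \<sigma>)) \<and>
     (\<forall>\<sigma>\<in>edges M. (\<exists>K\<in>cells M. \<exists>L\<in>cells M. common_edge K L \<sigma>) \<or> \<sigma> \<subseteq> frontier \<Omega>) \<and>
     (\<forall>K\<in>cells M. \<forall>L\<in>cells M. \<forall>\<sigma>\<in>edges M. common_edge K L \<sigma> \<longrightarrow>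
        center M K \<noteq> center M L \<and>
        (\<forall>a\<in>\<sigma>. \<forall>b\<in>\<sigma>. (center M L - center M K) \<bullet> (b - a) = 0)) \<and>
     (\<forall>K\<in>cells M. \<forall>\<sigma>\<in>cell_edges M K. \<sigma> \<subseteq> frontier \<Omega> \<longrightarrow>
        (\<exists>y\<in>\<sigma>. \<forall>a\<in>\<sigma>. \<forall>b\<in>\<sigma>. (y - center M K) \<bullet> (b - a) = 0)) \<and>
     (\<exists>\<xi>>0. \<forall>K\<in>cells M. \<forall>\<sigma>\<in>cell_edges M K. \<xi> * diameter K \<le> infdist (center M K) \<sigma>)"

definition has_neighbour :: "mesh \<Rightarrow> point set \<Rightarrow> point set \<Rightarrow> bool" where
  "has_neighbour M K \<sigma> \<longleftrightarrow> (\<exists>L\<in>cells M. common_edge K L \<sigma>)"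

definition neighbour :: "mesh \<Rightarrow> point set \<Rightarrow> point set \<Rightarrow> point set" where
  "neighbour M K \<sigma> = (THE L. L \<in> cells M \<and> common_edge K L \<sigma>)"

definition edge_dist :: "mesh \<Rightarrow> point set \<Rightarrow> point set \<Rightarrow> real" where
  "edge_dist M K \<sigma> =
     (if has_neighbour M K \<sigma> then dist (center M K) (center M (neighbour M K \<sigma>))
      else infdist (center M K) \<sigma>)"

definition transmissibility :: "mesh \<Rightarrow> point set \<Rightarrow> point set \<Rightarrow> real" where
  "transmissibility M K \<sigma> = edge_length \<sigma> / edge_dist M K \<sigma>"

section \<open>The finite-volume scheme\<close>

definition cell_avg :: "point set \<Rightarrow> (point \<Rightarrow> 'a::{banach,second_countable_topology}) \<Rightarrow> 'a" where
  "cell_avg K f = (1 / measure lebesgue K) *\<^sub>R (LINT x|lebesgue_on K. f x)"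

text \<open>Throughout, \<open>ED\<close> is the set of Dirichlet edges, \<open>u\<close> the cell values and \<open>b\<close> the Dirichlet
  edge values; \<open>outer_val\<close> is \<open>u\<^bsub>K,\<sigma>\<^esub>\<close> and \<open>jump\<close> is \<open>D u\<^bsub>K,\<sigma>\<^esub>\<close>.\<close>

definition outer_val ::
  "mesh \<Rightarrow> point set set \<Rightarrow> (point set \<Rightarrow> 'a) \<Rightarrow> (point set \<Rightarrow> 'a) \<Rightarrow> point set \<Rightarrow> point set \<Rightarrow> 'a" where
  "outer_val M ED b u K \<sigma> =
     (if has_neighbour M K \<sigma> then u (neighbour M K \<sigma>)
      else if \<sigma> \<in> ED then b \<sigma> else u K)"

definition jump ::
  "mesh \<Rightarrow> point set set \<Rightarrow> (point set \<Rightarrow> 'a::minus) \<Rightarrow> (point set \<Rightarrow> 'a) \<Rightarrow> point set \<Rightarrow> point set \<Rightarrow> 'a" where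
  "jump M ED b u K \<sigma> = outer_val M ED b u K \<sigma> - u K"

definition Bernoulli :: "real \<Rightarrow> real" where
  "Bernoulli x = (if x = 0 then 1 else x / (exp x - 1))"

text \<open>Used for the scalar density \<open>n\<^sub>0\<close> and for the vector density. On Neumann edges the
  conventions of \<open>outer_val\<close> make the flux vanish.\<close>

definition SG_flux ::
  "mesh \<Rightarrow> point set set \<Rightarrow> (point set \<Rightarrow> real) \<Rightarrow> (point set \<Rightarrow> real) \<Rightarrow>
   (point set \<Rightarrow> 'a::real_vector) \<Rightarrow> (point set \<Rightarrow> 'a) \<Rightarrow> point set \<Rightarrow> point set \<Rightarrow> 'a" where
  "SG_flux M ED VD V b u K \<sigma> =
     transmissibility M K \<sigma> *\<^sub>R
       (Bernoulli (jump M ED VD V K \<sigma>) *\<^sub>R u K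
        - Bernoulli (- jump M ED VD V K \<sigma>) *\<^sub>R outer_val M ED b u K \<sigma>)"

definition charge_flux :: "real \<Rightarrow> real \<Rightarrow> real^3 \<Rightarrow> real \<Rightarrow> real^3 \<Rightarrow> real" where
  "charge_flux D p m J0 J =
     (let \<eta> = sqrt (1 - p\<^sup>2) in D / \<eta>\<^sup>2 * (J0 - 2 * p * (J \<bullet> m)))"

definition spin_flux :: "real \<Rightarrow> real \<Rightarrow> real^3 \<Rightarrow> real \<Rightarrow> real^3 \<Rightarrow> real^3" where
  "spin_flux D p m J0 J =
     (let \<eta> = sqrt (1 - p\<^sup>2) in
      (D / \<eta>\<^sup>2) *\<^sub>R (\<eta> *\<^sub>R J + ((1 - \<eta>) * (J \<bullet> m)) *\<^sub>R m - (p / 2 * J0) *\<^sub>R m))"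

text \<open>One time step, from the old densities \<open>n0'\<close>, \<open>n'\<close> to the new \<open>n0\<close>, \<open>n\<close>, \<open>V\<close>; \<open>gD\<close> and
  \<open>VD\<close> are the traces of the boundary data.\<close>

definition scheme_step ::
  "mesh \<Rightarrow> point set set \<Rightarrow> real \<Rightarrow> real \<Rightarrow> real^3 \<Rightarrow> real \<Rightarrow> real \<Rightarrow> real \<Rightarrow> real \<Rightarrow>
   (point \<Rightarrow> real) \<Rightarrow> (point \<Rightarrow> real) \<Rightarrow> (point \<Rightarrow> real) \<Rightarrow>
   (point set \<Rightarrow> real) \<Rightarrow> (point set \<Rightarrow> real^3) \<Rightarrow>
   (point set \<Rightarrow> real) \<Rightarrow> (point set \<Rightarrow> real^3) \<Rightarrow> (point set \<Rightarrow> real) \<Rightarrow> bool" where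
  "scheme_step M ED D p m \<gamma> \<tau> lD dt C gD VD n0' n' n0 n V \<longleftrightarrow>
     (let b0 = (\<lambda>\<sigma>. edge_avg \<sigma> gD);
          bV = (\<lambda>\<sigma>. edge_avg \<sigma> VD);
          J0 = SG_flux M ED bV V b0 n0;
          J = SG_flux M ED bV V (\<lambda>_. 0) n
      in \<forall>K\<in>cells M.
        measure lebesgue K * ((n0 K - n0' K) / dt)
          + (\<Sum>\<sigma>\<in>cell_edges M K. charge_flux D p m (J0 K \<sigma>) (J K \<sigma>)) = 0 \<and>
        (measure lebesgue K / dt) *\<^sub>R (n K - n' K)
          + (\<Sum>\<sigma>\<in>cell_edges M K. spin_flux D p m (J0 K \<sigma>) (J K \<sigma>))
          - (2 * \<gamma> * measure lebesgue K) *\<^sub>R cross3 (n K) m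
          = - ((measure lebesgue K / \<tau>) *\<^sub>R n K) \<and>
        - lD\<^sup>2 * (\<Sum>\<sigma>\<in>cell_edges M K. transmissibility M K \<sigma> * jump M ED bV V K \<sigma>)
          = measure lebesgue K * (n0 K - cell_avg K C))"

end

theory Submission
  imports Defs
begin

text \<open>Along the magnetization the scheme splits into two scalar drift-diffusion equations. With
  \<open>n\<^sub>\<plusminus> = n\<^sub>0/2 \<plusminus> n \<bullet> m\<close> the two components carry the fluxes \<open>D/(1 \<plusminus> p) J\<^sub>\<plusminus>\<close> and are coupled
  only through spin-flip relaxation and the Poisson equation, while the component of the spin
  orthogonal to \<open>m\<close> does not act back on \<open>n\<^sub>+\<close>, \<open>n\<^sub>-\<close> and \<open>V\<close> and, once these are known, solves a
  linear problem (\<open>charge_flux_split\<close>, \<open>spin_flux_split\<close>).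

  The bounds come from one identity (\<open>sum_SG_flux\<close>). Since \<open>B(-x) = B(x) + x\<close>, a
  Scharfetter-Gummel flux is an upwind difference minus \<open>\<tau>\<^sub>\<sigma> DV n\<^sub>K\<close>, and by the Poisson equation the
  sum of these last terms over the edges of \<open>K\<close> is the zero-order term \<open>m(K)(n\<^sub>0 - C) n\<^sub>K / \<lambda>\<^sub>D\<^sup>2\<close>. Its
  sign is favourable wherever \<open>n\<^sub>+\<close> or \<open>n\<^sub>-\<close> reaches the bound \<open>M\<^sup>0\<close>, because there
  \<open>n\<^sub>0 \<ge> M\<^sup>0 \<ge> C\<close>; where a component vanishes, the upwind term alone has the right sign. For the
  orthogonal part the term may be negative, but the restriction on \<open>\<tau>\<close> lets the relaxation absorb
  it, so that the discrete maximum principle bounds the orthogonal part by \<open>M\<^sup>0\<close> at all times.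
  Thus \<open>|n| \<le> 3/2 M\<^sup>0\<close>, and the factors \<open>(1 - \<alpha> \<triangle>t)\<^sup>-\<^sup>k \<ge> 1\<close> only enlarge the bound.

  These sign conditions on the faces of a box are the hypotheses of the theorem of Poincare and
  Miranda (\<open>poincare_miranda\<close>), which therefore yields existence and the bounds at once. The
  equations are taken in the form in which the Poisson equation has already been inserted; a zero
  of the modified system satisfies the Poisson equation, hence also the original one. The box for
  \<open>V\<close> is scaled by a strict supersolution of the discrete Laplacian
  (\<open>strict_supersolution_exists\<close>), built from the distance of a cell to the Dirichlet boundary in
  the graph of cells. The dimension of the system is a number, not a type, so the theorem is
  derived for functions on a finite index set from Kuhn's combinatorial lemma.

  Two inputs come from the continuous setting. The first is geometric: an edge separates exactly
  two cells or lies on the boundary, and every cell is joined to the Dirichlet boundary by a chain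
  of neighbours (\<open>cells_connected_to_dirichlet\<close>), as \<open>\<Omega>\<close> stays connected when countably many
  points are removed. The second is analytic: the supremum of \<open>n\<^sup>D\<close> over the boundary controls the
  edge averages only if the trace of a bounded nonnegative function is bounded and nonnegative
  (\<open>trace_le\<close>).\<close>

section \<open>The Poincare-Miranda theorem\<close>

lemma pointwise_convergent_subsequence:
  fixes f :: "nat \<Rightarrow> 'i \<Rightarrow> real"
  assumes "finite I" "\<And>i. i \<in> I \<Longrightarrow> bounded (range (\<lambda>k. f k i))"
  shows "\<exists>r. strict_mono r \<and> (\<forall>i\<in>I. convergent (\<lambda>k. f (r k) i))"
  using assms
proof (induction I rule: finite_induct)
  case empty
  show ?case using strict_mono_id by auto
next
  case (insert i I)
  then obtain r where r: "strict_mono r" "\<forall>j\<in>I. convergent (\<lambda>k. f (r k) j)" by auto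
  have "bounded (range (\<lambda>k. f (r k) i))"
    by (rule bounded_subset[OF insert.prems[of i]]) auto
  then obtain l s where s: "strict_mono s" "((\<lambda>k. f (r k) i) \<circ> s) \<longlonglongrightarrow> l"
    using bounded_imp_convergent_subsequence[of "\<lambda>k. f (r k) i"] by auto
  have "convergent (\<lambda>k. f ((r \<circ> s) k) j)" if "j \<in> insert i I" for j
  proof (cases "j = i")
    case True
    then show ?thesis using s by (auto simp: convergent_def o_def)
  next
    case False
    then have "convergent (\<lambda>k. f (r k) j)" using r that by auto
    then show ?thesis using convergent_subseq_convergent[OF _ s(1)] by (auto simp: o_def)
  qed
  moreover have "strict_mono (r \<circ> s)" using r s by (simp add: strict_mono_o)
  ultimately show ?case by blast
qed

lemma tendsto_fun_coordinatewise:
  fixes x :: "nat \<Rightarrow> 'i \<Rightarrow> real"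
  assumes "\<And>i. (\<lambda>k. x k i) \<longlonglongrightarrow> l i"
  shows "x \<longlonglongrightarrow> l"
proof -
  have "limitin (product_topology (\<lambda>i. euclidean) UNIV) x l sequentially"
    using assms by (auto simp: limitin_componentwise)
  then show ?thesis by (simp add: euclidean_product_topology)
qed

text \<open>Kuhn's combinatorial lemma is applied on finer and finer grids, with the sign of \<open>F i\<close> as the
  label \<open>i\<close> of a grid point; the sign conditions on opposite faces are the boundary conditions that
  the lemma asks of a labelling. It yields grid cells in which every component takes both signs, and
  an accumulation point of these cells is a zero.\<close>

theorem poincare_miranda:
  fixes I :: "'i set" and a b :: "'i \<Rightarrow> real" and F :: "'i \<Rightarrow> ('i \<Rightarrow> real) \<Rightarrow> real"
  defines "B \<equiv> {x. \<forall>i\<in>I. a i \<le> x i \<and> x i \<le> b i}"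
  assumes fin: "finite I" and ab: "\<And>i. i \<in> I \<Longrightarrow> a i \<le> b i"
    and cont: "\<And>i. i \<in> I \<Longrightarrow> continuous_on B (F i)"
    and lower: "\<And>i x. i \<in> I \<Longrightarrow> x \<in> B \<Longrightarrow> x i = a i \<Longrightarrow> F i x \<le> 0"
    and upper: "\<And>i x. i \<in> I \<Longrightarrow> x \<in> B \<Longrightarrow> x i = b i \<Longrightarrow> 0 \<le> F i x"
  shows "\<exists>x\<in>B. \<forall>i\<in>I. F i x = 0"
proof -
  define n where "n = card I"
  obtain h where h: "bij_betw h {..<n} I"
    using fin ex_bij_betw_nat_finite unfolding n_def atLeast0LessThan by blast
  define g where "g = inv_into {..<n} h"
  have g: "g i < n" "h (g i) = i" if "i \<in> I" for i
    using h that bij_betw_inv_into_right[OF h that] bij_betw_apply[OF bij_betw_inv_into[OF h] that]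
    by (auto simp: g_def)
  define X where "X p x = (\<lambda>i. if i \<in> I then a i + (b i - a i) * (real (x (g i)) / real p) else 0)"
    for p :: nat and x :: "nat \<Rightarrow> nat"
  have XB: "X p x \<in> B" if p: "p > 0" and x: "\<forall>j<n. x j \<le> p" for p x
  proof -
    have "a i \<le> X p x i \<and> X p x i \<le> b i" if i: "i \<in> I" for i
    proof -
      have "0 \<le> (b i - a i) * (real (x (g i)) / real p)" using ab[OF i] by simp
      moreover have "(b i - a i) * (real (x (g i)) / real p) \<le> (b i - a i) * 1"
        using ab[OF i] x g[OF i] p by (intro mult_left_mono) auto
      ultimately show ?thesis using i by (simp add: X_def)
    qed
    then show ?thesis by (auto simp: B_def)
  qed
  define Q where "Q p y i r s \<longleftrightarrow> r \<in> B \<and> s \<in> B \<and> (\<forall>j. j \<notin> I \<longrightarrow> r j = 0 \<and> s j = 0) \<and> F i r \<le> 0 \<and> 0 \<le> F i s \<and>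
      (\<forall>j\<in>I. \<bar>r j - y j\<bar> \<le> (b j - a j) / p \<and> \<bar>s j - y j\<bar> \<le> (b j - a j) / p)"
    for p :: nat and y i r s
  have step: "\<exists>y\<in>B. (\<forall>i. i \<notin> I \<longrightarrow> y i = 0) \<and> (\<forall>i\<in>I. \<exists>r s. Q p y i r s)" if p: "p > 0" for p :: nat
  proof -
    define label where "label x i = (if x i = 0 then 0 else if x i = p then 1
       else if 0 < F (h i) (X p x) then 1 else (0::nat))" for x i
    have hI: "h i \<in> I" "g (h i) = i" if "i < n" for i
      using h that bij_betw_inv_into_left[OF h] by (auto simp: g_def bij_betw_def)
    have lab0: "F (h i) (X p x) \<le> 0" if "i < n" "\<forall>j<n. x j \<le> p" "label x i = 0" for x i
    proof (cases "x i = 0")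
      case True
      then have "X p x (h i) = a (h i)" using hI that by (simp add: X_def)
      then show ?thesis using lower hI XB p that by blast
    next
      case False
      then show ?thesis using that p by (auto simp: label_def split: if_splits)
    qed
    have lab1: "0 \<le> F (h i) (X p x)" if "i < n" "\<forall>j<n. x j \<le> p" "label x i \<noteq> 0" for x i
    proof (cases "x i = p")
      case True
      then have "X p x (h i) = b (h i)" using hI that p by (simp add: X_def)
      then show ?thesis using upper hI XB p that by blast
    next
      case False
      then show ?thesis using that p by (auto simp: label_def split: if_splits)
    qed
    obtain q where q: "\<forall>i<n. q i < p"
      and rs: "\<forall>i<n. \<exists>r s. (\<forall>j<n. q j \<le> r j \<and> r j \<le> q j + 1) \<and>
         (\<forall>j<n. q j \<le> s j \<and> s j \<le> q j + 1) \<and> label r i \<noteq> label s i"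
      by (rule kuhn_lemma[of p n label]) (use p in \<open>auto simp: label_def\<close>)
    have near: "\<bar>X p r j - X p q j\<bar> \<le> (b j - a j) / p"
      if "j \<in> I" "\<forall>j<n. q j \<le> r j \<and> r j \<le> q j + 1" for r j
    proof -
      have "real (r (g j)) - real (q (g j)) \<le> 1" "0 \<le> real (r (g j)) - real (q (g j))"
        using that g[of j] by (force simp: of_nat_diff)+
      have "X p r j - X p q j = (b j - a j) / p * (real (r (g j)) - real (q (g j)))"
        using that by (simp add: X_def field_simps diff_divide_distrib)
      also have "\<bar>\<dots>\<bar> \<le> (b j - a j) / p * 1"
        unfolding abs_mult
        by (intro mult_mono) (use ab[OF that(1)] \<open>real (r (g j)) - real (q (g j)) \<le> 1\<close>
           \<open>0 \<le> real (r (g j)) - real (q (g j))\<close> in auto)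
      finally show ?thesis by simp
    qed
    have le: "\<forall>j<n. r j \<le> p" if "\<forall>j<n. q j \<le> r j \<and> r j \<le> q j + 1" for r
      using that q by (metis Suc_eq_plus1 Suc_leI le_trans)
    have "\<exists>r s. Q p (X p q) i r s" if i: "i \<in> I" for i
    proof -
      obtain r s where r: "\<forall>j<n. q j \<le> r j \<and> r j \<le> q j + 1"
        and s: "\<forall>j<n. q j \<le> s j \<and> s j \<le> q j + 1" and ne: "label r (g i) \<noteq> label s (g i)"
        using rs g[OF i] by blast
      have "label r (g i) \<in> {0,1}" "label s (g i) \<in> {0,1}" by (auto simp: label_def)
      then consider "label r (g i) = 0" "label s (g i) \<noteq> 0" | "label s (g i) = 0" "label r (g i) \<noteq> 0"
        using ne by auto
      then show ?thesis
      proof cases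
        case 1
        then show ?thesis
          using lab0[of "g i" r] lab1[of "g i" s] g[OF i] le[OF r] le[OF s] near[OF _ r] near[OF _ s]
            XB[OF p le[OF r]] XB[OF p le[OF s]]
          by - (rule exI[of _ "X p r"], rule exI[of _ "X p s"], auto simp: Q_def X_def)
      next
        case 2
        then show ?thesis
          using lab0[of "g i" s] lab1[of "g i" r] g[OF i] le[OF r] le[OF s] near[OF _ r] near[OF _ s]
            XB[OF p le[OF r]] XB[OF p le[OF s]]
          by - (rule exI[of _ "X p s"], rule exI[of _ "X p r"], auto simp: Q_def X_def)
      qed
    qed
    moreover have "X p q \<in> B" using XB p q by (simp add: less_imp_le)
    ultimately show ?thesis by (intro bexI[of _ "X p q"]) (auto simp: X_def)
  qed
  have "\<forall>p. \<exists>y. p > 0 \<longrightarrow> y \<in> B \<and> (\<forall>i. i \<notin> I \<longrightarrow> y i = 0) \<and> (\<forall>i\<in>I. \<exists>r s. Q p y i r s)"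
  proof
    fix p :: nat
    show "\<exists>y. p > 0 \<longrightarrow> y \<in> B \<and> (\<forall>i. i \<notin> I \<longrightarrow> y i = 0) \<and> (\<forall>i\<in>I. \<exists>r s. Q p y i r s)"
    proof (cases "p > 0")
      case True
      from step[OF this] show ?thesis by blast
    qed simp
  qed
  then obtain y where y': "\<And>p. p > 0 \<Longrightarrow> y p \<in> B \<and> (\<forall>i. i \<notin> I \<longrightarrow> y p i = 0) \<and> (\<forall>i\<in>I. \<exists>r s. Q p (y p) i r s)"
    by (metis (lifting))
  then have y: "\<And>p. p > 0 \<Longrightarrow> y p \<in> B" "\<And>p i. p > 0 \<Longrightarrow> i \<notin> I \<Longrightarrow> y p i = 0" by blast+
  have "\<forall>p i. \<exists>r s. p > 0 \<longrightarrow> i \<in> I \<longrightarrow> Q p (y p) i r s" using y' by blast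
  then obtain r s where Q: "\<And>p i. p > 0 \<Longrightarrow> i \<in> I \<Longrightarrow> Q p (y p) i (r p i) (s p i)"
    by metis
  have rs: "r p i \<in> B \<and> s p i \<in> B \<and> F i (r p i) \<le> 0 \<and> 0 \<le> F i (s p i)" if "p > 0" "i \<in> I" for p i
    using Q[OF that] by (auto simp: Q_def)
  have off: "r p i j = 0 \<and> s p i j = 0" if "p > 0" "i \<in> I" "j \<notin> I" for p i j
    using Q[OF that(1,2)] that by (auto simp: Q_def)
  have near: "\<bar>r p i j - y p j\<bar> \<le> (b j - a j) / p \<and> \<bar>s p i j - y p j\<bar> \<le> (b j - a j) / p"
    if "p > 0" "i \<in> I" "j \<in> I" for p i j
    using Q[OF that(1,2)] that by (auto simp: Q_def)
  have "bounded (range (\<lambda>k. y (Suc k) i))" if "i \<in> I" for i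
    using y(1)[of "Suc _"] that
    by (intro bounded_subset[OF bounded_closed_interval[of "a i" "b i"]]) (auto simp: B_def)
  then obtain u where u: "strict_mono u" "\<forall>i\<in>I. convergent (\<lambda>k. y (Suc (u k)) i)"
    using pointwise_convergent_subsequence[OF fin, of "\<lambda>k. y (Suc k)"] by blast
  define l where "l i = (if i \<in> I then lim (\<lambda>k. y (Suc (u k)) i) else 0)" for i
  have l: "(\<lambda>k. y (Suc (u k)) i) \<longlonglongrightarrow> l i" for i
    using u(2) y(2) by (auto simp: l_def convergent_LIMSEQ_iff)
  have lB: "l \<in> B"
    unfolding B_def using y(1)[of "Suc _"]
    by (auto simp: B_def intro!: LIMSEQ_le_const[OF l] LIMSEQ_le_const2[OF l] exI[of _ 0])
  have mesh0: "(\<lambda>k. c / real (Suc (u k))) \<longlonglongrightarrow> 0" for c :: real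
    using LIMSEQ_subseq_LIMSEQ[OF _ u(1), of "\<lambda>k. c / real (Suc k)" 0]
      lim_const_over_n[THEN LIMSEQ_Suc, of c] by (simp add: o_def)
  have conv: "(\<lambda>k. F i (z (Suc (u k)))) \<longlonglongrightarrow> F i l"
    if i: "i \<in> I" and zB: "\<And>p. p > 0 \<Longrightarrow> z p \<in> B" and z0: "\<And>p j. p > 0 \<Longrightarrow> j \<notin> I \<Longrightarrow> z p j = 0"
      and zy: "\<And>p j. p > 0 \<Longrightarrow> j \<in> I \<Longrightarrow> \<bar>z p j - y p j\<bar> \<le> (b j - a j) / p" for i z
  proof (rule continuous_on_tendsto_compose[OF cont[OF i] _ lB])
    show "(\<lambda>k. z (Suc (u k))) \<longlonglongrightarrow> l"
    proof (rule tendsto_fun_coordinatewise)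
      fix j
      show "(\<lambda>k. z (Suc (u k)) j) \<longlonglongrightarrow> l j"
      proof (cases "j \<in> I")
        case True
        have "(\<lambda>k. z (Suc (u k)) j - y (Suc (u k)) j) \<longlonglongrightarrow> 0"
          by (rule tendsto_rabs_zero_cancel,
              rule tendsto_sandwich[OF _ _ tendsto_const mesh0[of "b j - a j"]])
             (use zy[OF zero_less_Suc True] in \<open>auto intro!: always_eventually simp del: of_nat_Suc\<close>)
        from tendsto_add[OF this l[of j]] show ?thesis by simp
      qed (simp add: z0 l_def)
    qed
  qed (use zB in auto)
  have "F i l = 0" if i: "i \<in> I" for i
  proof (rule antisym)
    show "F i l \<le> 0"
      by (rule LIMSEQ_le_const2[OF conv[OF i, of "\<lambda>p. r p i"]]) (use rs off near i in auto)
    show "0 \<le> F i l"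
      by (rule LIMSEQ_le_const[OF conv[OF i, of "\<lambda>p. s p i"]]) (use rs off near i in auto)
  qed
  with lB show ?thesis by blast
qed

text \<open>In each ball the map is composed with the projection onto it, so that on each face of the cube
  with side \<open>2R\<close> the corresponding coordinate of \<open>x - G x\<close> has the sign of that face; a zero has all
  its components in the balls, where the projection is the identity.\<close>

corollary fixed_point_in_product_of_balls:
  fixes I :: "'i set" and R :: real and G :: "'i \<Rightarrow> ('i \<Rightarrow> 'a) \<Rightarrow> 'a::euclidean_space"
  assumes "finite I" "0 \<le> R"
    and cont: "\<And>i. i \<in> I \<Longrightarrow> continuous_on UNIV (G i)"
    and bound: "\<And>i x. i \<in> I \<Longrightarrow> (\<And>j. norm (x j) \<le> R) \<Longrightarrow> norm (G i x) \<le> R"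
  shows "\<exists>x. \<forall>i\<in>I. norm (x i) \<le> R \<and> G i x = x i"
proof -
  define P where "P z = closest_point (cball (0::'a) R) z" for z
  have P: "norm (P z) \<le> R" "norm z \<le> R \<Longrightarrow> P z = z" for z
    using closest_point_in_set[of "cball 0 R" z] closest_point_self[of z "cball 0 R"] assms(2)
    by (auto simp: P_def)
  have contP: "continuous_on UNIV P"
    unfolding P_def by (rule continuous_on_closest_point) (use assms in auto)
  define Y where "Y y i = (\<Sum>b\<in>Basis. y (i, b) *\<^sub>R b)" for y :: "'i \<times> 'a \<Rightarrow> real" and i
  define F where "F j y = y j - G (fst j) (\<lambda>i. P (Y y i)) \<bullet> snd j" for j y
  have comp: "\<bar>G i (\<lambda>i. P (Y y i)) \<bullet> b\<bar> \<le> R" if "i \<in> I" "b \<in> Basis" for i b y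
    using Basis_le_norm[OF that(2)] bound[OF that(1)] P(1) order_trans by meson
  have contY: "continuous_on S (\<lambda>y. P (Y y i))" for i S
    by (rule continuous_on_compose2[OF contP])
       (auto simp: Y_def intro!: continuous_intros continuous_on_subset[OF continuous_on_product_coordinates])
  have contF: "continuous_on S (F j)" if "j \<in> I \<times> Basis" for j S
  proof -
    have "continuous_on S (\<lambda>y. G (fst j) (\<lambda>i. P (Y y i)))"
      using that by (intro continuous_on_compose2[OF cont[of "fst j"]]
          continuous_on_coordinatewise_then_product contY) auto
    then show ?thesis
      unfolding F_def by (intro continuous_intros continuous_on_subset[OF continuous_on_product_coordinates]) auto
  qed
  have "\<exists>y\<in>{y. \<forall>j\<in>I \<times> Basis. - R \<le> y j \<and> y j \<le> R}. \<forall>j\<in>I \<times> Basis. F j y = 0"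
  proof (rule poincare_miranda)
    fix j :: "'i \<times> 'a" and y :: "'i \<times> 'a \<Rightarrow> real" assume "j \<in> I \<times> Basis"
    then show "y j = - R \<Longrightarrow> F j y \<le> 0" "y j = R \<Longrightarrow> 0 \<le> F j y"
      using comp[of "fst j" "snd j" y] by (auto simp: F_def abs_le_iff)
  qed (use assms contF in auto)
  then obtain y where y: "\<And>i b. i \<in> I \<Longrightarrow> b \<in> Basis \<Longrightarrow> y (i, b) = G i (\<lambda>i. P (Y y i)) \<bullet> b"
    by (force simp: F_def)
  define x where "x i = P (Y y i)" for i
  have "Y y i = G i x" if "i \<in> I" for i
    using y[OF that] by (simp add: x_def[abs_def] Y_def euclidean_representation)
  moreover have "norm (G i x) \<le> R" if "i \<in> I" for i
    using bound[OF that] P(1) by (simp add: x_def)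
  ultimately have "\<forall>i\<in>I. norm (x i) \<le> R \<and> G i x = x i"
    using P by (metis x_def)
  then show ?thesis by blast
qed

section \<open>Scharfetter-Gummel fluxes\<close>

lemma Bernoulli_pos: "0 < Bernoulli x"
proof -
  consider "x < 0" | "x = 0" | "x > 0" by linarith
  then show ?thesis
    by cases (simp_all add: Bernoulli_def divide_pos_pos divide_neg_neg)
qed

lemma Bernoulli_minus: "Bernoulli (- x) = Bernoulli x + x"
  by (auto simp: Bernoulli_def exp_minus field_simps)

lemma isCont_Bernoulli: "isCont Bernoulli x"
proof (cases "x = 0")
  case True
  have "((\<lambda>h. (exp h - 1) / h) \<longlongrightarrow> (1::real)) (at 0)"
    using DERIV_exp[of 0] by (simp add: DERIV_def)
  then have "((\<lambda>h. inverse ((exp h - 1) / h)) \<longlongrightarrow> inverse (1::real)) (at 0)"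
    by (rule tendsto_inverse) simp
  then have "(Bernoulli \<longlongrightarrow> 1) (at 0)"
    unfolding inverse_1
    by (rule Lim_transform_eventually) (auto simp: Bernoulli_def eventually_at intro: exI[of _ 1])
  then show ?thesis using True by (simp add: isCont_def Bernoulli_def)
next
  case False
  then have "eventually (\<lambda>y. y \<noteq> 0) (nhds x)" by (rule t1_space_nhds)
  then have "eventually (\<lambda>y. Bernoulli y = y / (exp y - 1)) (nhds x)"
    by eventually_elim (simp add: Bernoulli_def)
  moreover have "isCont (\<lambda>y. y / (exp y - 1)) x" using False by (intro continuous_intros) auto
  ultimately show ?thesis
    using isCont_cong[of Bernoulli "\<lambda>y. y / (exp y - 1)" x] by simp
qed

lemma continuous_on_Bernoulli [continuous_intros]:
  "continuous_on S f \<Longrightarrow> continuous_on S (\<lambda>x. Bernoulli (f x))"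
  using continuous_on_compose2[OF continuous_at_imp_continuous_on[of UNIV Bernoulli]]
    isCont_Bernoulli by blast

lemma continuous_on_outer_val:
  fixes u :: "'x::topological_space \<Rightarrow> point set \<Rightarrow> 'a::topological_space"
  assumes "\<And>L. continuous_on S (\<lambda>x. u x L)"
  shows "continuous_on S (\<lambda>x. outer_val M ED b (u x) K \<sigma>)"
  using assms unfolding outer_val_def
  by (cases "has_neighbour M K \<sigma>"; cases "\<sigma> \<in> ED") (simp_all add: continuous_on_const)

lemma continuous_on_jump:
  assumes "\<And>L. continuous_on S (\<lambda>x. u x L)"
  shows "continuous_on S (\<lambda>x. jump M ED b (u x) K \<sigma> :: real)"
  unfolding jump_def by (intro continuous_intros continuous_on_outer_val assms)

text \<open>The upwind coefficient is positive whatever the sign of the jump of the potential. This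
  isolates the drift in a term that involves only the value in \<open>K\<close>.\<close>

lemma SG_flux_eq_upwind:
  "SG_flux M ED bV V b u K \<sigma> =
     (transmissibility M K \<sigma> * Bernoulli (- jump M ED bV V K \<sigma>)) *\<^sub>R (u K - outer_val M ED b u K \<sigma>)
     - (transmissibility M K \<sigma> * jump M ED bV V K \<sigma>) *\<^sub>R u K"
  by (simp add: SG_flux_def Bernoulli_minus algebra_simps)

lemma SG_flux_add:
  "SG_flux M ED bV V (\<lambda>\<sigma>. b \<sigma> + b' \<sigma>) (\<lambda>K. u K + u' K) K \<sigma> =
     SG_flux M ED bV V b u K \<sigma> + SG_flux M ED bV V b' u' K \<sigma>"
  by (simp add: SG_flux_def outer_val_def algebra_simps)

section \<open>The nonlinear system of one time step\<close>

text \<open>The discrete arguments need only these properties of the mesh. The last one says that every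
  cell is joined to a Dirichlet edge by a chain of neighbours: along some edge one either leaves the
  mesh through the Dirichlet boundary or reaches a cell of smaller rank.\<close>

locale grounded_mesh =
  fixes M :: mesh and ED :: "point set set"
  assumes finite_cells: "finite (cells M)"
    and finite_cell_edges: "K \<in> cells M \<Longrightarrow> finite (cell_edges M K)"
    and area_pos: "K \<in> cells M \<Longrightarrow> 0 < measure lebesgue K"
    and neighbour_in_cells:
      "K \<in> cells M \<Longrightarrow> \<sigma> \<in> cell_edges M K \<Longrightarrow> has_neighbour M K \<sigma> \<Longrightarrow> neighbour M K \<sigma> \<in> cells M"
    and transmissibility_pos:
      "K \<in> cells M \<Longrightarrow> \<sigma> \<in> cell_edges M K \<Longrightarrow> has_neighbour M K \<sigma> \<or> \<sigma> \<in> ED \<Longrightarrow> 0 < transmissibility M K \<sigma>"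
    and rank_exists:
      "\<exists>rank :: point set \<Rightarrow> nat. \<forall>K\<in>cells M. \<exists>\<sigma>\<in>cell_edges M K.
         (has_neighbour M K \<sigma> \<and> rank (neighbour M K \<sigma>) < rank K) \<or> (\<not> has_neighbour M K \<sigma> \<and> \<sigma> \<in> ED)"
begin

lemma jump_cases:
  fixes u :: "point set \<Rightarrow> 'a::ab_group_add"
  assumes "K \<in> cells M" "\<sigma> \<in> cell_edges M K"
  obtains (cell) L where "has_neighbour M K \<sigma>" "L = neighbour M K \<sigma>" "L \<in> cells M"
      "outer_val M ED b u K \<sigma> = u L" "0 < transmissibility M K \<sigma>"
  | (dirichlet) "\<not> has_neighbour M K \<sigma>" "\<sigma> \<in> ED" "outer_val M ED b u K \<sigma> = b \<sigma>" "0 < transmissibility M K \<sigma>"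
  | (neumann) "\<not> has_neighbour M K \<sigma>" "\<sigma> \<notin> ED" "outer_val M ED b u K \<sigma> = u K"
  using assms neighbour_in_cells transmissibility_pos by (auto simp: outer_val_def)

abbreviation laplacian :: "(point set \<Rightarrow> real) \<Rightarrow> (point set \<Rightarrow> real) \<Rightarrow> point set \<Rightarrow> real"
  where "laplacian b u K \<equiv> (\<Sum>\<sigma>\<in>cell_edges M K. transmissibility M K \<sigma> * jump M ED b u K \<sigma>)"

lemma transmissibility_jump_mono:
  fixes u u' :: "point set \<Rightarrow> real"
  assumes K: "K \<in> cells M" "\<sigma> \<in> cell_edges M K"
    and cell: "\<And>L. L \<in> cells M \<Longrightarrow> u L - u K \<le> u' L - u' K"
    and dir: "\<sigma> \<in> ED \<Longrightarrow> b \<sigma> - u K \<le> b' \<sigma> - u' K"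
  shows "transmissibility M K \<sigma> * jump M ED b u K \<sigma> \<le> transmissibility M K \<sigma> * jump M ED b' u' K \<sigma>"
  using assms neighbour_in_cells[OF K] transmissibility_pos[OF K]
  by (auto simp: jump_def outer_val_def intro!: mult_left_mono)

text \<open>The supersolution \<open>2 - \<delta>\<^sup>r\<^sup>+\<^sup>1\<close> increases with the rank \<open>r\<close>, and so steeply concavely that for small
  \<open>\<delta>\<close> the drop of order \<open>\<delta>\<^sup>r\<close> across the edge towards smaller rank outweighs the gains, of order
  \<open>\<delta>\<^sup>r\<^sup>+\<^sup>1\<close> at most, across all other edges. On Dirichlet edges the value is 1.\<close>

lemma strict_supersolution_exists:
  "\<exists>\<psi> \<beta>. 0 < \<beta> \<and> (\<forall>K\<in>cells M. 1 \<le> \<psi> K \<and>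
     laplacian (\<lambda>_. 1) \<psi> K \<le> - \<beta>)"
proof -
  obtain rank :: "point set \<Rightarrow> nat" where rank: "\<And>K. K \<in> cells M \<Longrightarrow> \<exists>\<sigma>\<in>cell_edges M K.
      (has_neighbour M K \<sigma> \<and> rank (neighbour M K \<sigma>) < rank K) \<or> (\<not> has_neighbour M K \<sigma> \<and> \<sigma> \<in> ED)"
    using rank_exists by auto
  define down where "down K = (SOME \<sigma>. \<sigma> \<in> cell_edges M K \<and>
      ((has_neighbour M K \<sigma> \<and> rank (neighbour M K \<sigma>) < rank K) \<or> (\<not> has_neighbour M K \<sigma> \<and> \<sigma> \<in> ED)))" for K
  have down: "down K \<in> cell_edges M K" "(has_neighbour M K (down K) \<and> rank (neighbour M K (down K)) < rank K) \<or>
      (\<not> has_neighbour M K (down K) \<and> down K \<in> ED)" if "K \<in> cells M" for K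
    using someI_ex[of "\<lambda>\<sigma>. \<sigma> \<in> cell_edges M K \<and>
      ((has_neighbour M K \<sigma> \<and> rank (neighbour M K \<sigma>) < rank K) \<or> (\<not> has_neighbour M K \<sigma> \<and> \<sigma> \<in> ED))"]
      rank[OF that] by (auto simp: down_def)
  define tr where "tr K \<sigma> = transmissibility M K \<sigma>" for K \<sigma>
  define S where "S K = (\<Sum>\<sigma>\<in>cell_edges M K. \<bar>tr K \<sigma>\<bar>)" for K
  have tr_down: "0 < tr K (down K)" if "K \<in> cells M" for K
    using transmissibility_pos[OF that down(1)[OF that]] down(2)[OF that] by (auto simp: tr_def)
  have "eventually (\<lambda>\<delta>. \<forall>K\<in>cells M. \<delta> * (tr K (down K) + S K) < tr K (down K)) (at_right 0)"
  proof (rule eventually_ball_finite[OF finite_cells], rule ballI)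
    fix K assume K: "K \<in> cells M"
    have "((\<lambda>\<delta>. \<delta> * (tr K (down K) + S K)) \<longlongrightarrow> 0 * (tr K (down K) + S K)) (at_right 0)"
      by (intro tendsto_intros)
    then show "eventually (\<lambda>\<delta>. \<delta> * (tr K (down K) + S K) < tr K (down K)) (at_right 0)"
      using tr_down[OF K] by (intro order_tendstoD) auto
  qed
  moreover have "eventually (\<lambda>\<delta>::real. 0 < \<delta> \<and> \<delta> < 1) (at_right 0)"
    using eventually_at_right_real[of 0 1] by (auto elim: eventually_mono)
  ultimately have "eventually (\<lambda>\<delta>. (0 < \<delta> \<and> \<delta> < 1) \<and> (\<forall>K\<in>cells M. \<delta> * (tr K (down K) + S K) < tr K (down K)))
      (at_right (0::real))"
    by (rule eventually_conj[rotated])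
  then obtain \<delta> :: real where \<delta>: "0 < \<delta>" "\<delta> < 1"
    and small: "\<And>K. K \<in> cells M \<Longrightarrow> \<delta> * (tr K (down K) + S K) < tr K (down K)"
    using eventually_happens'[OF trivial_limit_at_right_real] by blast
  define \<psi> where "\<psi> K = 2 - \<delta> ^ Suc (rank K)" for K
  define G where "G K = \<delta> ^ rank K * (tr K (down K) - \<delta> * (tr K (down K) + S K))" for K
  have pow: "0 < \<delta> ^ k" "\<delta> ^ k \<le> 1" for k
    using \<delta> by (auto simp: power_le_one)
  have G_pos: "0 < G K" if "K \<in> cells M" for K
    using small[OF that] pow by (simp add: G_def)
  have sum_le: "(\<Sum>\<sigma>\<in>cell_edges M K. tr K \<sigma> * jump M ED (\<lambda>_. 1) \<psi> K \<sigma>) \<le> - G K"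
    if K: "K \<in> cells M" for K
  proof -
    have down_le: "tr K (down K) * jump M ED (\<lambda>_. 1) \<psi> K (down K) \<le>
        tr K (down K) * (\<delta> ^ Suc (rank K) - \<delta> ^ rank K)"
    proof (rule mult_left_mono)
      have "\<delta> ^ rank K \<le> \<delta> ^ Suc (rank L)" if "rank L < rank K" for L
        using \<delta> that by (intro power_decreasing) auto
      then show "jump M ED (\<lambda>_. 1) \<psi> K (down K) \<le> \<delta> ^ Suc (rank K) - \<delta> ^ rank K"
        using down(2)[OF K] pow(2)[of "rank K"] by (auto simp: jump_def outer_val_def \<psi>_def simp del: power_Suc)
    qed (use tr_down[OF K] in simp)
    have other_le: "tr K \<sigma> * jump M ED (\<lambda>_. 1) \<psi> K \<sigma> \<le> \<bar>tr K \<sigma>\<bar> * \<delta> ^ Suc (rank K)" if "\<sigma> \<in> cell_edges M K" for \<sigma>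
    proof -
      have le: "jump M ED (\<lambda>_. 1) \<psi> K \<sigma> \<le> \<delta> ^ Suc (rank K)"
        using pow(1)[of "Suc (rank K)"] pow(1)[of "Suc (rank _)"] pow(2)[of "Suc (rank K)"]
        by (auto simp: jump_def outer_val_def \<psi>_def less_imp_le simp del: power_Suc)
      show ?thesis
      proof (cases "has_neighbour M K \<sigma> \<or> \<sigma> \<in> ED")
        case True
        then show ?thesis using le transmissibility_pos[OF K that]
          by (auto simp: tr_def intro!: mult_left_mono simp del: power_Suc)
      next
        case False
        then show ?thesis using pow(1)[of "Suc (rank K)"]
          by (auto simp: jump_def outer_val_def simp del: power_Suc)
      qed
    qed
    have "(\<Sum>\<sigma>\<in>cell_edges M K. tr K \<sigma> * jump M ED (\<lambda>_. 1) \<psi> K \<sigma>) =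
        tr K (down K) * jump M ED (\<lambda>_. 1) \<psi> K (down K) +
        (\<Sum>\<sigma>\<in>cell_edges M K - {down K}. tr K \<sigma> * jump M ED (\<lambda>_. 1) \<psi> K \<sigma>)"
      by (rule sum.remove[OF finite_cell_edges[OF K] down(1)[OF K]])
    also have "\<dots> \<le> tr K (down K) * (\<delta> ^ Suc (rank K) - \<delta> ^ rank K) +
        (\<Sum>\<sigma>\<in>cell_edges M K - {down K}. \<bar>tr K \<sigma>\<bar> * \<delta> ^ Suc (rank K))"
      by (intro add_mono down_le sum_mono other_le) auto
    also have "\<dots> \<le> tr K (down K) * (\<delta> ^ Suc (rank K) - \<delta> ^ rank K) + S K * \<delta> ^ Suc (rank K)"
      unfolding S_def sum_distrib_right
      by (intro add_left_mono sum_mono2) (use finite_cell_edges[OF K] \<delta> in auto)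
    also have "\<dots> = - G K" by (simp add: G_def algebra_simps)
    finally show ?thesis .
  qed
  define \<beta> where "\<beta> = Min (insert 1 (G ` cells M))"
  have "0 < \<beta>" using G_pos finite_cells by (simp add: \<beta>_def)
  moreover have "\<beta> \<le> G K" if "K \<in> cells M" for K
    using that finite_cells by (auto simp: \<beta>_def)
  moreover have "1 \<le> \<psi> K" for K using pow(2)[of "Suc (rank K)"] by (simp add: \<psi>_def del: power_Suc)
  ultimately show ?thesis
    using sum_le unfolding tr_def by (intro exI[of _ \<psi>] exI[of _ \<beta>]) force
qed

definition density_balance :: "real \<Rightarrow> real \<Rightarrow> real \<Rightarrow> (point set \<Rightarrow> real) \<Rightarrow> (point set \<Rightarrow> real) \<Rightarrow>
    (point set \<Rightarrow> real) \<Rightarrow> (point set \<Rightarrow> real) \<Rightarrow> (point set \<Rightarrow> real) \<Rightarrow> (point set \<Rightarrow> real) \<Rightarrow> point set \<Rightarrow> bool"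
  where "density_balance dt d \<kappa> bV V b old u v K \<longleftrightarrow>
     measure lebesgue K * ((u K - old K) / dt) + d * (\<Sum>\<sigma>\<in>cell_edges M K. SG_flux M ED bV V b u K \<sigma>)
       + \<kappa> * measure lebesgue K * (u K - v K) = 0"

definition poisson_balance ::
  "real \<Rightarrow> (point set \<Rightarrow> real) \<Rightarrow> (point set \<Rightarrow> real) \<Rightarrow> point set \<Rightarrow> real \<Rightarrow> bool"
  where "poisson_balance lD bV V K \<rho> \<longleftrightarrow>
     - lD\<^sup>2 * laplacian bV V K = measure lebesgue K * \<rho>"

text \<open>The part of the flux balance that is monotone in the sense of the discrete maximum principle;
  the remainder is a multiple of the cell value.\<close>

definition upwind ::
  "(point set \<Rightarrow> real) \<Rightarrow> (point set \<Rightarrow> real) \<Rightarrow> (point set \<Rightarrow> 'a::real_vector) \<Rightarrow> (point set \<Rightarrow> 'a) \<Rightarrow> point set \<Rightarrow> 'a"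
  where
  "upwind bV V b u K = (\<Sum>\<sigma>\<in>cell_edges M K.
     (transmissibility M K \<sigma> * Bernoulli (- jump M ED bV V K \<sigma>)) *\<^sub>R (u K - outer_val M ED b u K \<sigma>))"

text \<open>The drift terms of the edges of one cell add up to the discrete Laplacian of the potential,
  which the Poisson equation turns into a charge density.\<close>

lemma sum_SG_flux:
  assumes "K \<in> cells M" and "poisson_balance lD bV V K \<rho>" "lD > 0"
  shows "(\<Sum>\<sigma>\<in>cell_edges M K. SG_flux M ED bV V b u K \<sigma>) =
    upwind bV V b u K + (measure lebesgue K * \<rho> / lD\<^sup>2) *\<^sub>R u K"
proof -
  have "laplacian bV V K = - (measure lebesgue K * \<rho>) / lD\<^sup>2"
    using assms by (simp add: poisson_balance_def field_simps)
  then show ?thesis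
    by (simp add: SG_flux_eq_upwind sum_subtractf upwind_def flip: scaleR_sum_left)
qed

lemma upwind_at_max:
  fixes u :: "point set \<Rightarrow> real"
  assumes K: "K \<in> cells M" and "\<And>L. L \<in> cells M \<Longrightarrow> u L \<le> u K" "\<And>\<sigma>. \<sigma> \<in> ED \<Longrightarrow> b \<sigma> \<le> u K"
  shows "0 \<le> upwind bV V b u K"
  unfolding upwind_def
proof (rule sum_nonneg)
  fix \<sigma> assume \<sigma>: "\<sigma> \<in> cell_edges M K"
  show "0 \<le> (transmissibility M K \<sigma> * Bernoulli (- jump M ED bV V K \<sigma>)) *\<^sub>R (u K - outer_val M ED b u K \<sigma>)"
    using jump_cases[OF K \<sigma>, of b u] assms Bernoulli_pos[of "- jump M ED bV V K \<sigma>"]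
    by cases auto
qed

lemma upwind_uminus: "upwind bV V (\<lambda>\<sigma>. - b \<sigma>) (\<lambda>K. - u K) K = - upwind bV V b u K"
proof -
  have "outer_val M ED (\<lambda>\<sigma>. - b \<sigma>) (\<lambda>K. - u K) K \<sigma> = - outer_val M ED b u K \<sigma>" for \<sigma>
    by (simp add: outer_val_def)
  then have "w *\<^sub>R (- u K - outer_val M ED (\<lambda>\<sigma>. - b \<sigma>) (\<lambda>K. - u K) K \<sigma>) = - (w *\<^sub>R (u K - outer_val M ED b u K \<sigma>))"
    for w \<sigma> by (simp add: algebra_simps)
  then show ?thesis by (simp add: upwind_def sum_negf)
qed

lemma upwind_at_min:
  fixes u :: "point set \<Rightarrow> real"
  assumes K: "K \<in> cells M" and "\<And>L. L \<in> cells M \<Longrightarrow> u K \<le> u L" "\<And>\<sigma>. \<sigma> \<in> ED \<Longrightarrow> u K \<le> b \<sigma>"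
  shows "upwind bV V b u K \<le> 0"
  using upwind_at_max[OF K, of "\<lambda>K. - u K" "\<lambda>\<sigma>. - b \<sigma>" bV V] assms by (simp add: upwind_uminus)

lemma continuous_on_upwind:
  fixes u :: "'x::topological_space \<Rightarrow> point set \<Rightarrow> 'a::real_normed_vector"
  assumes "\<And>L. continuous_on S (\<lambda>x. V x L)" "\<And>L. continuous_on S (\<lambda>x. u x L)"
  shows "continuous_on S (\<lambda>x. upwind bV (V x) b (u x) K)"
  unfolding upwind_def
  by (intro continuous_intros continuous_on_jump continuous_on_outer_val assms)

text \<open>The unknowns are indexed by pairs of a number, 0 and 1 for the two densities and 2 for the
  potential, and a cell. The box is \<open>[0, B]\<close> for the densities and \<open>[-R \<psi>, R \<psi>]\<close> for the potential,
  where \<open>\<psi>\<close> is the strict supersolution. For the Poisson residual the discrete comparison with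
  \<open>R \<psi>\<close> gives the sign on the faces, as the charge in a cell is bounded on the box. For the density
  residuals it is essential that the zero-order term is written with the charge \<open>u\<^sub>1 + u\<^sub>2 - C\<close>: on the
  upper face this is nonnegative by the box constraints alone, whereas nothing is known there about
  the Laplacian of \<open>V\<close>.\<close>

lemma densities_and_potential_exist:
  fixes b bV :: "point set \<Rightarrow> real" and C old\<^sub>1 old\<^sub>2 :: "point set \<Rightarrow> real"
  assumes pos: "0 < d\<^sub>1" "0 < d\<^sub>2" "0 \<le> \<kappa>" "0 < dt" "0 < lD" "0 \<le> B"
    and old1: "\<And>K. K \<in> cells M \<Longrightarrow> 0 \<le> old\<^sub>1 K \<and> old\<^sub>1 K \<le> B"
    and old2: "\<And>K. K \<in> cells M \<Longrightarrow> 0 \<le> old\<^sub>2 K \<and> old\<^sub>2 K \<le> B"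
    and bd: "\<And>\<sigma>. \<sigma> \<in> ED \<Longrightarrow> 0 \<le> b \<sigma> \<and> b \<sigma> \<le> B"
    and C: "\<And>K. K \<in> cells M \<Longrightarrow> C K \<le> B"
  shows "\<exists>u\<^sub>1 u\<^sub>2 V. \<forall>K\<in>cells M.
     0 \<le> u\<^sub>1 K \<and> u\<^sub>1 K \<le> B \<and> 0 \<le> u\<^sub>2 K \<and> u\<^sub>2 K \<le> B \<and>
     density_balance dt d\<^sub>1 \<kappa> bV V b old\<^sub>1 u\<^sub>1 u\<^sub>2 K \<and>
     density_balance dt d\<^sub>2 \<kappa> bV V b old\<^sub>2 u\<^sub>2 u\<^sub>1 K \<and>
     poisson_balance lD bV V K (u\<^sub>1 K + u\<^sub>2 K - C K)"
proof -
  obtain \<psi> \<beta> where \<beta>: "0 < \<beta>" and \<psi>: "\<And>K. K \<in> cells M \<Longrightarrow> 1 \<le> \<psi> K"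
    and super: "\<And>K. K \<in> cells M \<Longrightarrow>
      laplacian (\<lambda>_. 1) \<psi> K \<le> - \<beta>"
    using strict_supersolution_exists by blast
  \<comment> \<open>Large enough for \<open>R \<psi>\<close> to dominate the boundary values and for \<open>R \<beta>\<close> to dominate the charge.\<close>
  define R where "R = (\<Sum>K\<in>cells M. \<Sum>\<sigma>\<in>cell_edges M K. \<bar>bV \<sigma>\<bar>)
      + (\<Sum>K\<in>cells M. measure lebesgue K * (2 * B + \<bar>C K\<bar>)) / (\<beta> * lD\<^sup>2)"
  have charge_nonneg: "0 \<le> measure lebesgue K * (2 * B + \<bar>C K\<bar>)" for K
    using pos by simp
  have R_bV: "\<bar>bV \<sigma>\<bar> \<le> R" if K: "K \<in> cells M" "\<sigma> \<in> cell_edges M K" for K \<sigma>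
  proof -
    have "\<bar>bV \<sigma>\<bar> \<le> (\<Sum>\<sigma>\<in>cell_edges M K. \<bar>bV \<sigma>\<bar>)"
      by (rule member_le_sum) (use K finite_cell_edges in auto)
    also have "\<dots> \<le> (\<Sum>K\<in>cells M. \<Sum>\<sigma>\<in>cell_edges M K. \<bar>bV \<sigma>\<bar>)"
      by (rule member_le_sum[of K "cells M" "\<lambda>K. \<Sum>\<sigma>\<in>cell_edges M K. \<bar>bV \<sigma>\<bar>"])
         (use K finite_cells in \<open>auto intro: sum_nonneg\<close>)
    also have "\<dots> \<le> R"
      unfolding R_def using pos \<beta> by (auto intro!: divide_nonneg_pos sum_nonneg charge_nonneg)
    finally show ?thesis .
  qed
  have R_charge: "measure lebesgue K * (2 * B + \<bar>C K\<bar>) \<le> lD\<^sup>2 * (R * \<beta>)" if K: "K \<in> cells M" for K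
  proof -
    have "measure lebesgue K * (2 * B + \<bar>C K\<bar>) \<le> (\<Sum>K\<in>cells M. measure lebesgue K * (2 * B + \<bar>C K\<bar>))"
      by (rule member_le_sum[of K "cells M" "\<lambda>K. measure lebesgue K * (2 * B + \<bar>C K\<bar>)"])
         (use K finite_cells charge_nonneg in auto)
    also have "\<dots> = (\<Sum>K\<in>cells M. measure lebesgue K * (2 * B + \<bar>C K\<bar>)) / (\<beta> * lD\<^sup>2) * (\<beta> * lD\<^sup>2)"
      using pos \<beta> by simp
    also have "\<dots> \<le> R * (\<beta> * lD\<^sup>2)"
      using pos \<beta> by (intro mult_right_mono) (auto simp: R_def intro!: sum_nonneg)
    finally show ?thesis by (simp add: algebra_simps)
  qed
  have R_nonneg: "0 \<le> R"
    unfolding R_def using pos \<beta>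
    by (intro add_nonneg_nonneg divide_nonneg_pos sum_nonneg charge_nonneg) auto
  define X where "X x s = (\<lambda>L. x (s, L))" for x :: "nat \<times> point set \<Rightarrow> real" and s
  \<comment> \<open>The density residual with the Poisson equation inserted, and the Poisson residual.\<close>
  define Q where "Q d old u v V K = measure lebesgue K * ((u K - old K) / dt)
      + d * (upwind bV V b u K + (measure lebesgue K * (u K + v K - C K) / lD\<^sup>2) * u K)
      + \<kappa> * measure lebesgue K * (u K - v K)" for d :: real and old u v V K
  define P where "P u v V K = - lD\<^sup>2 * laplacian bV V K
      - measure lebesgue K * (u K + v K - C K)" for u v V K
  have Q_le: "Q d old u v V K \<le> 0"
    if "K \<in> cells M" "u K = 0" "0 \<le> old K" "0 < d"
      "\<And>L. L \<in> cells M \<Longrightarrow> 0 \<le> u L" "\<And>L. L \<in> cells M \<Longrightarrow> 0 \<le> v L" for d old u v V K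
  proof -
    have "upwind bV V b u K \<le> 0" by (rule upwind_at_min) (use that bd in auto)
    moreover have "0 \<le> measure lebesgue K * old K / dt" "0 \<le> \<kappa> * measure lebesgue K * v K"
      using that pos by auto
    ultimately show ?thesis
      using that mult_nonneg_nonpos[of d "upwind bV V b u K"] by (simp add: Q_def)
  qed
  have Q_ge: "0 \<le> Q d old u v V K"
    if "K \<in> cells M" "u K = B" "old K \<le> B" "0 < d"
      "\<And>L. L \<in> cells M \<Longrightarrow> u L \<le> B" "\<And>L. L \<in> cells M \<Longrightarrow> 0 \<le> v L \<and> v L \<le> B" for d old u v V K
  proof -
    have "0 \<le> upwind bV V b u K" by (rule upwind_at_max) (use that bd in auto)
    moreover have "0 \<le> u K + v K - C K" "0 \<le> u K"
      using that(2) that(6)[OF that(1)] C[OF that(1)] pos(6) by linarith+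
    ultimately show ?thesis
      unfolding Q_def using that(1,3,4) that(6)[OF that(1)] pos that(2)[symmetric]
      by (intro add_nonneg_nonneg mult_nonneg_nonneg divide_nonneg_pos) auto
  qed
  have scaled: "jump M ED (\<lambda>_. R) (\<lambda>L. R * \<psi> L) K \<sigma> = R * jump M ED (\<lambda>_. 1) \<psi> K \<sigma>" for K \<sigma>
    by (simp add: jump_def outer_val_def algebra_simps)
  have laplace: "lD\<^sup>2 * laplacian g V K
      \<le> - measure lebesgue K * (2 * B + \<bar>C K\<bar>)"
    if K: "K \<in> cells M" "V K = R * \<psi> K" "\<And>L. L \<in> cells M \<Longrightarrow> V L \<le> R * \<psi> L"
      and g: "\<And>\<sigma>. \<bar>g \<sigma>\<bar> = \<bar>bV \<sigma>\<bar>" for K V g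
  proof -
    have "laplacian g V K \<le>
       laplacian (\<lambda>_. R) (\<lambda>L. R * \<psi> L) K"
    proof (intro sum_mono transmissibility_jump_mono[OF K(1)])
      fix \<sigma> assume "\<sigma> \<in> cell_edges M K"
      then show "g \<sigma> - V K \<le> R - R * \<psi> K" using R_bV[OF K(1)] g K(2) by (smt (verit))
    qed (use K in auto)
    also have "\<dots> = R * laplacian (\<lambda>_. 1) \<psi> K"
      by (simp add: scaled sum_distrib_left algebra_simps)
    also have "\<dots> \<le> R * - \<beta>" by (intro mult_left_mono super K R_nonneg)
    finally have "lD\<^sup>2 * laplacian g V K \<le> lD\<^sup>2 * (R * - \<beta>)"
      by (rule mult_left_mono) simp
    then show ?thesis using R_charge[OF K(1)] by simp
  qed
  have charge: "\<bar>measure lebesgue K * (u K + v K - C K)\<bar> \<le> measure lebesgue K * (2 * B + \<bar>C K\<bar>)"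
    if "0 \<le> u K \<and> u K \<le> B" "0 \<le> v K \<and> v K \<le> B" for u v K
    using that by (auto simp: abs_mult intro!: mult_left_mono)
  have P_ge: "0 \<le> P u v V K"
    if "K \<in> cells M" "V K = R * \<psi> K" "\<And>L. L \<in> cells M \<Longrightarrow> V L \<le> R * \<psi> L"
      "0 \<le> u K \<and> u K \<le> B" "0 \<le> v K \<and> v K \<le> B" for u v V K
    using laplace[OF that(1-3), of bV] charge[of u K v, OF that(4,5)] by (simp add: P_def)
  have P_le: "P u v V K \<le> 0"
    if K: "K \<in> cells M" "V K = - (R * \<psi> K)" "\<And>L. L \<in> cells M \<Longrightarrow> - (R * \<psi> L) \<le> V L"
      "0 \<le> u K \<and> u K \<le> B" "0 \<le> v K \<and> v K \<le> B" for u v V K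
  proof -
    have "jump M ED (\<lambda>\<sigma>. - bV \<sigma>) (\<lambda>L. - V L) K \<sigma> = - jump M ED bV V K \<sigma>" for \<sigma>
      by (simp add: jump_def outer_val_def)
    moreover have "- V L \<le> R * \<psi> L" if "L \<in> cells M" for L using K(3)[OF that] by linarith
    ultimately show ?thesis
      using laplace[OF K(1), of "\<lambda>L. - V L" "\<lambda>\<sigma>. - bV \<sigma>"] K(2) charge[of u K v, OF K(4,5)]
      by (simp add: P_def sum_negf)
  qed
  define F where "F j x = (let K = snd j in
      if fst j = 0 then Q d\<^sub>1 old\<^sub>1 (X x 0) (X x 1) (X x 2) K
      else if fst j = 1 then Q d\<^sub>2 old\<^sub>2 (X x 1) (X x 0) (X x 2) K
      else P (X x 0) (X x 1) (X x 2) K)" for j :: "nat \<times> point set" and x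
  define lo where "lo j = (if fst j = 2 then - (R * \<psi> (snd j)) else 0)" for j :: "nat \<times> point set"
  define hi where "hi j = (if fst j = 2 then R * \<psi> (snd j) else B)" for j :: "nat \<times> point set"
  define I where "I = {0, 1, 2::nat} \<times> cells M"
  have contX: "continuous_on S (\<lambda>x. X x s L)" for S s L
    unfolding X_def by (rule continuous_on_subset[OF continuous_on_product_coordinates]) auto
  have "\<exists>x\<in>{x. \<forall>j\<in>I. lo j \<le> x j \<and> x j \<le> hi j}. \<forall>j\<in>I. F j x = 0"
  proof (rule poincare_miranda)
    show "finite I" using finite_cells by (simp add: I_def)
  next
    fix j assume "j \<in> I"
    then have "0 \<le> R * \<psi> (snd j)" using R_nonneg \<psi> by (force simp: I_def intro!: mult_nonneg_nonneg)
    then show "lo j \<le> hi j" using pos by (simp add: lo_def hi_def)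
  next
    fix j
    show "continuous_on {x. \<forall>j\<in>I. lo j \<le> x j \<and> x j \<le> hi j} (F j)"
      unfolding F_def Let_def Q_def P_def
      using pos
      by (cases "fst j = 0"; cases "fst j = 1"; simp)
         (intro continuous_intros continuous_on_upwind continuous_on_jump contX; simp)+
  next
    fix j x assume j: "j \<in> I" and x: "x \<in> {x. \<forall>j\<in>I. lo j \<le> x j \<and> x j \<le> hi j}"
    obtain s K where sK: "j = (s, K)" by (cases j)
    have K: "K \<in> cells M" using j sK by (simp add: I_def)
    have s: "s = 0 \<or> s = 1 \<or> s = 2" using j sK by (auto simp: I_def)
    have box: "0 \<le> X x 0 L \<and> X x 0 L \<le> B" "0 \<le> X x 1 L \<and> X x 1 L \<le> B"
        "- (R * \<psi> L) \<le> X x 2 L" "X x 2 L \<le> R * \<psi> L" if "L \<in> cells M" for L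
      using x that by (auto simp: X_def I_def lo_def hi_def)
    show "F j x \<le> 0" if "x j = lo j"
      using s
    proof (elim disjE)
      assume "s = 2"
      then show ?thesis using that sK box K
        by (auto simp: F_def X_def lo_def intro!: P_le)
    qed (use that sK box K old1[OF K] old2[OF K] pos in \<open>auto simp: F_def lo_def X_def intro!: Q_le\<close>)
    show "0 \<le> F j x" if "x j = hi j"
      using s
    proof (elim disjE)
      assume "s = 2"
      then show ?thesis using that sK box K
        by (auto simp: F_def X_def hi_def intro!: P_ge)
    qed (use that sK box K old1[OF K] old2[OF K] pos in \<open>auto simp: F_def hi_def X_def intro!: Q_ge\<close>)
  qed
  then obtain x where x: "\<And>j. j \<in> I \<Longrightarrow> lo j \<le> x j \<and> x j \<le> hi j" and zero: "\<And>j. j \<in> I \<Longrightarrow> F j x = 0"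
    by auto
  show ?thesis
  proof (rule exI[of _ "X x 0"], rule exI[of _ "X x 1"], rule exI[of _ "X x 2"], rule ballI)
    fix K assume K: "K \<in> cells M"
    have "0 \<le> X x 0 K \<and> X x 0 K \<le> B" "0 \<le> X x 1 K \<and> X x 1 K \<le> B"
      using x[of "(0, K)"] x[of "(1, K)"] K by (auto simp: X_def I_def lo_def hi_def)
    moreover have poisson: "poisson_balance lD bV (X x 2) K (X x 0 K + X x 1 K - C K)"
      using zero[of "(2, K)"] K by (simp add: I_def F_def P_def poisson_balance_def)
    moreover have "Q d\<^sub>1 old\<^sub>1 (X x 0) (X x 1) (X x 2) K = 0" "Q d\<^sub>2 old\<^sub>2 (X x 1) (X x 0) (X x 2) K = 0"
      using zero[of "(0, K)"] zero[of "(1, K)"] K by (auto simp: I_def F_def)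
    ultimately show "0 \<le> X x 0 K \<and> X x 0 K \<le> B \<and> 0 \<le> X x 1 K \<and> X x 1 K \<le> B \<and>
        density_balance dt d\<^sub>1 \<kappa> bV (X x 2) b old\<^sub>1 (X x 0) (X x 1) K \<and>
        density_balance dt d\<^sub>2 \<kappa> bV (X x 2) b old\<^sub>2 (X x 1) (X x 0) K \<and>
        poisson_balance lD bV (X x 2) K (X x 0 K + X x 1 K - C K)"
      unfolding density_balance_def sum_SG_flux[OF K poisson \<open>0 < lD\<close>]
      using poisson by (simp add: Q_def add.commute)
  qed
qed

text \<open>The precession couples the components of the spin in a cell, so the equation of the cell is
  first solved for the value in that cell; coercivity bounds this inverse by \<open>1 / c K\<close>. What remains
  is a fixed-point problem for combinations of the old and the neighbouring values with total weight
  at most \<open>c K\<close>, which preserves the balls of radius \<open>B\<close>. Orthogonality to \<open>m\<close> is built into the map by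
  projecting its argument, and is inherited by the fixed point.\<close>

lemma transverse_spin_exists:
  fixes old :: "point set \<Rightarrow> real^3" and q :: "point set \<Rightarrow> real"
  assumes pos: "0 < d" "0 < dt" "0 \<le> B"
    and old: "\<And>K. K \<in> cells M \<Longrightarrow> norm (old K) \<le> B" "\<And>K. K \<in> cells M \<Longrightarrow> old K \<bullet> m = 0"
    and m: "norm m = 1" and q: "\<And>K. K \<in> cells M \<Longrightarrow> 0 \<le> q K"
  shows "\<exists>n. \<forall>K\<in>cells M. norm (n K) \<le> B \<and> n K \<bullet> m = 0 \<and>
     (measure lebesgue K / dt) *\<^sub>R (n K - old K) + d *\<^sub>R upwind bV V (\<lambda>_. 0) n K
       - (2 * \<gamma> * measure lebesgue K) *\<^sub>R cross3 (n K) m + q K *\<^sub>R n K = 0"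
proof -
  \<comment> \<open>On all other edges the upwind difference vanishes; only on these are the weights known to be
    positive.\<close>
  define active where "active K = {\<sigma>\<in>cell_edges M K. has_neighbour M K \<sigma> \<or> \<sigma> \<in> ED}" for K
  define w where "w K \<sigma> = d * (transmissibility M K \<sigma> * Bernoulli (- jump M ED bV V K \<sigma>))" for K \<sigma>
  define c where "c K = measure lebesgue K / dt + (\<Sum>\<sigma>\<in>active K. w K \<sigma>) + q K" for K
  define rhs where "rhs n K = (measure lebesgue K / dt) *\<^sub>R old K
      + (\<Sum>\<sigma>\<in>active K. w K \<sigma> *\<^sub>R outer_val M ED (\<lambda>_. 0) n K \<sigma>)" for n K
  have w_pos: "0 < w K \<sigma>" if "K \<in> cells M" "\<sigma> \<in> active K" for K \<sigma>
    using that pos transmissibility_pos[of K \<sigma>] Bernoulli_pos[of "- jump M ED bV V K \<sigma>"]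
    by (auto simp: w_def active_def)
  have c_pos: "0 < c K" if "K \<in> cells M" for K
    unfolding c_def using pos area_pos[OF that] q[OF that] w_pos[OF that]
    by (intro add_pos_nonneg sum_nonneg) (auto intro: less_imp_le)
  have upwind_eq: "d *\<^sub>R upwind bV V (\<lambda>_. 0) n K
      = (\<Sum>\<sigma>\<in>active K. w K \<sigma>) *\<^sub>R n K - (\<Sum>\<sigma>\<in>active K. w K \<sigma> *\<^sub>R outer_val M ED (\<lambda>_. 0) n K \<sigma>)"
    if K: "K \<in> cells M" for n :: "point set \<Rightarrow> real^3" and K
  proof -
    have "d *\<^sub>R upwind bV V (\<lambda>_. 0) n K = (\<Sum>\<sigma>\<in>cell_edges M K. w K \<sigma> *\<^sub>R (n K - outer_val M ED (\<lambda>_. 0) n K \<sigma>))"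
      by (simp add: upwind_def w_def scaleR_sum_right)
    also have "\<dots> = (\<Sum>\<sigma>\<in>active K. w K \<sigma> *\<^sub>R (n K - outer_val M ED (\<lambda>_. 0) n K \<sigma>))"
      by (rule sum.mono_neutral_right)
         (use finite_cell_edges[OF K] in \<open>auto simp: active_def outer_val_def\<close>)
    finally show ?thesis by (simp add: scaleR_diff_right sum_subtractf scaleR_sum_left)
  qed
  \<comment> \<open>The precession term is skew, so the operator of one cell is coercive with constant \<open>c K\<close>.\<close>
  have "\<exists>S. linear S \<and> (\<forall>r. c K *\<^sub>R S r - (2 * \<gamma> * measure lebesgue K) *\<^sub>R cross3 (S r) m = r)"
    if K: "K \<in> cells M" for K
  proof -
    define A where "A x = c K *\<^sub>R x - (2 * \<gamma> * measure lebesgue K) *\<^sub>R cross3 x m" for x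
    have lin: "linear A"
      unfolding A_def
      by (intro linearI) (simp_all add: cross_add_left cross_mult_left algebra_simps)
    have "A x \<bullet> x = c K * (x \<bullet> x)" for x
      by (simp add: A_def inner_diff_left dot_cross_self)
    then have "inj A"
      using c_pos[OF K] lin by (auto simp: linear_injective_0)
        (metis inner_eq_zero_iff inner_zero_left mult_eq_0_iff less_irrefl)
    then obtain S where "linear S" "\<And>x. A (S x) = x"
      using linear_injective_isomorphism[OF lin] by blast
    then show ?thesis by (auto simp: A_def)
  qed
  then have "\<forall>K. \<exists>S. K \<in> cells M \<longrightarrow>
      linear S \<and> (\<forall>r. c K *\<^sub>R S r - (2 * \<gamma> * measure lebesgue K) *\<^sub>R cross3 (S r) m = r)" by blast
  then obtain S where S: "\<And>K. K \<in> cells M \<Longrightarrow> linear (S K)"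
    and S_eq: "\<And>K r. K \<in> cells M \<Longrightarrow> c K *\<^sub>R S K r - (2 * \<gamma> * measure lebesgue K) *\<^sub>R cross3 (S K r) m = r"
    by metis
  have S_norm: "c K * norm (S K r) \<le> norm r" if K: "K \<in> cells M" for K r
  proof (cases "S K r = 0")
    case False
    have "r \<bullet> S K r = (c K *\<^sub>R S K r - (2 * \<gamma> * measure lebesgue K) *\<^sub>R cross3 (S K r) m) \<bullet> S K r"
      using S_eq[OF K, of r] by simp
    also have "\<dots> = c K * norm (S K r) * norm (S K r)"
      by (simp add: inner_diff_left dot_cross_self dot_square_norm power2_eq_square)
    finally have "c K * norm (S K r) * norm (S K r) \<le> norm r * norm (S K r)"
      using norm_cauchy_schwarz[of r "S K r"] by simp
    then show ?thesis using False by simp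
  qed simp
  have S_orth: "S K r \<bullet> m = 0" if K: "K \<in> cells M" and "r \<bullet> m = 0" for K r
  proof -
    have "(c K *\<^sub>R S K r - (2 * \<gamma> * measure lebesgue K) *\<^sub>R cross3 (S K r) m) \<bullet> m = 0"
      using S_eq[OF K, of r] that by simp
    then show ?thesis using c_pos[OF K]
      by (simp add: inner_diff_left dot_cross_self)
  qed
  define proj where "proj n = (\<lambda>L. n L - (n L \<bullet> m) *\<^sub>R m)" for n :: "point set \<Rightarrow> real^3"
  have mm: "m \<bullet> m = 1" using m by (simp add: dot_square_norm)
  have proj_orth: "proj n L \<bullet> m = 0" for n L
    by (simp add: proj_def inner_diff_left mm)
  have proj_norm: "norm (proj n L) \<le> norm (n L)" for n L
  proof -
    have "(norm (proj n L))\<^sup>2 = (norm (n L))\<^sup>2 - (n L \<bullet> m)\<^sup>2"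
      unfolding power2_norm_eq_inner
      by (simp add: proj_def inner_diff_left inner_diff_right mm power2_eq_square inner_commute)
    then have "(norm (proj n L))\<^sup>2 \<le> (norm (n L))\<^sup>2" by simp
    then show ?thesis by (rule power2_le_imp_le) simp
  qed
  have rhs_orth: "rhs (proj n) K \<bullet> m = 0" if "K \<in> cells M" for n K
    by (auto simp: rhs_def inner_add_left old(2)[OF that] inner_sum_left outer_val_def proj_orth
        intro!: sum.neutral)
  have rhs_norm: "norm (rhs n K) \<le> c K * B" if K: "K \<in> cells M" and n: "\<And>L. norm (n L) \<le> B" for n K
  proof -
    have "norm (rhs n K) \<le> measure lebesgue K / dt * B + (\<Sum>\<sigma>\<in>active K. w K \<sigma> * B)"
      unfolding rhs_def
    proof (intro norm_triangle_le add_mono order_trans[OF norm_sum] sum_mono)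
      show "norm ((measure lebesgue K / dt) *\<^sub>R old K) \<le> measure lebesgue K / dt * B"
        using old(1)[OF K] pos by (auto intro!: divide_right_mono mult_left_mono)
      fix \<sigma> assume "\<sigma> \<in> active K"
      then show "norm (w K \<sigma> *\<^sub>R outer_val M ED (\<lambda>_. 0) n K \<sigma>) \<le> w K \<sigma> * B"
        using w_pos[OF K, of \<sigma>] n pos by (auto simp: outer_val_def)
    qed
    also have "\<dots> \<le> c K * B"
      using mult_nonneg_nonneg[OF q[OF K] pos(3)] by (simp add: c_def sum_distrib_right distrib_right)
    finally show ?thesis .
  qed
  have "\<exists>n. \<forall>K\<in>cells M. norm (n K) \<le> B \<and> S K (rhs (proj n) K) = n K"
  proof (rule fixed_point_in_product_of_balls)
    fix K assume K: "K \<in> cells M"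
    have "continuous_on UNIV (\<lambda>n. rhs (proj n) K)"
      unfolding rhs_def proj_def
      by (intro continuous_intros continuous_on_outer_val) auto
    then show "continuous_on UNIV (\<lambda>n. S K (rhs (proj n) K))"
      using S[OF K] by (intro bounded_linear.continuous_on[of "S K"]) (simp_all add: linear_conv_bounded_linear)
    fix n :: "point set \<Rightarrow> real^3" assume "\<And>L. norm (n L) \<le> B"
    then have "norm (rhs (proj n) K) \<le> c K * B"
      using proj_norm by (intro rhs_norm[OF K]) (meson order_trans)
    then have "c K * norm (S K (rhs (proj n) K)) \<le> c K * B"
      using S_norm[OF K] order_trans by blast
    then show "norm (S K (rhs (proj n) K)) \<le> B" using c_pos[OF K] by simp
  qed (use finite_cells pos in auto)
  then obtain n where n: "\<And>K. K \<in> cells M \<Longrightarrow> norm (n K) \<le> B"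
    and fixed: "\<And>K. K \<in> cells M \<Longrightarrow> S K (rhs (proj n) K) = n K" by blast
  have orth: "n K \<bullet> m = 0" if "K \<in> cells M" for K
    using S_orth[OF that rhs_orth[OF that, of n]] fixed[OF that] by simp
  have "outer_val M ED (\<lambda>_. 0) (proj n) K \<sigma> = outer_val M ED (\<lambda>_. 0) n K \<sigma>"
    if "K \<in> cells M" "\<sigma> \<in> active K" for K \<sigma>
    using that neighbour_in_cells orth by (auto simp: outer_val_def proj_def active_def)
  then have "rhs (proj n) K = rhs n K" if "K \<in> cells M" for K
    using that by (simp add: rhs_def cong: sum.cong)
  then have eq: "c K *\<^sub>R n K - (2 * \<gamma> * measure lebesgue K) *\<^sub>R cross3 (n K) m = rhs n K" if "K \<in> cells M" for K
    using S_eq[OF that, of "rhs (proj n) K"] fixed[OF that] that by simp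
  show ?thesis
  proof (intro exI[of _ n] ballI conjI n orth)
    fix K assume K: "K \<in> cells M"
    show "(measure lebesgue K / dt) *\<^sub>R (n K - old K) + d *\<^sub>R upwind bV V (\<lambda>_. 0) n K
       - (2 * \<gamma> * measure lebesgue K) *\<^sub>R cross3 (n K) m + q K *\<^sub>R n K = 0"
      using eq[OF K] unfolding upwind_eq[OF K] rhs_def c_def by (simp add: algebra_simps)
  qed
qed

end

text \<open>In the variables \<open>J\<^sub>0/2 \<plusminus> J \<bullet> m\<close> the matrix of the longitudinal fluxes is diagonal, since
  \<open>\<eta>\<^sup>2 = (1 + p)(1 - p)\<close>.\<close>

lemma charge_flux_split:
  assumes p: "0 \<le> p" "p < 1" and J: "J \<bullet> m = (J\<^sub>1 - J\<^sub>2) / 2"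
  shows "charge_flux D p m (J\<^sub>1 + J\<^sub>2) J = D / (1 + p) * J\<^sub>1 + D / (1 - p) * J\<^sub>2"
proof -
  have "p\<^sup>2 < 1" using p by (simp add: power_less_one_iff)
  then have \<eta>: "(sqrt (1 - p\<^sup>2))\<^sup>2 = (1 + p) * (1 - p)"
    by (simp add: algebra_simps power2_eq_square)
  have "J\<^sub>1 + J\<^sub>2 - 2 * p * (J \<bullet> m) = (1 - p) * J\<^sub>1 + (1 + p) * J\<^sub>2"
    unfolding J by (simp add: field_simps)
  then show ?thesis
    using p by (simp add: charge_flux_def \<eta> field_simps)
qed

lemma spin_flux_split:
  assumes p: "0 \<le> p" "p < 1" and m: "norm m = 1" and T: "T \<bullet> m = 0"
  shows "spin_flux D p m (J\<^sub>1 + J\<^sub>2) (((J\<^sub>1 - J\<^sub>2) / 2) *\<^sub>R m + T) =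
    ((D / (1 + p) * J\<^sub>1 - D / (1 - p) * J\<^sub>2) / 2) *\<^sub>R m + (D / sqrt (1 - p\<^sup>2)) *\<^sub>R T"
proof -
  define \<eta> where "\<eta> = sqrt (1 - p\<^sup>2)"
  have "p\<^sup>2 < 1" using p by (simp add: power_less_one_iff)
  then have \<eta>: "\<eta>\<^sup>2 = (1 + p) * (1 - p)" "0 < \<eta>"
    by (simp_all add: \<eta>_def algebra_simps power2_eq_square)
  have mm: "m \<bullet> m = 1" using m by (simp add: dot_square_norm)
  have "spin_flux D p m (J\<^sub>1 + J\<^sub>2) (((J\<^sub>1 - J\<^sub>2) / 2) *\<^sub>R m + T) =
     (D / \<eta>\<^sup>2) *\<^sub>R ((((J\<^sub>1 - J\<^sub>2) - p * (J\<^sub>1 + J\<^sub>2)) / 2) *\<^sub>R m + \<eta> *\<^sub>R T)"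
    by (simp add: spin_flux_def Let_def flip: \<eta>_def) (simp add: inner_add_left mm T algebra_simps
      add_divide_distrib diff_divide_distrib flip: scaleR_add_left scaleR_diff_left)
  also have "\<dots> = (D / \<eta>\<^sup>2 * (((J\<^sub>1 - J\<^sub>2) - p * (J\<^sub>1 + J\<^sub>2)) / 2)) *\<^sub>R m + (D / \<eta>) *\<^sub>R T"
    using \<eta>(2) by (simp add: scaleR_add_right power2_eq_square)
  also have "D / \<eta>\<^sup>2 * (((J\<^sub>1 - J\<^sub>2) - p * (J\<^sub>1 + J\<^sub>2)) / 2) = (D / (1 + p) * J\<^sub>1 - D / (1 - p) * J\<^sub>2) / 2"
    using p by (simp add: \<eta> field_simps)
  finally show ?thesis by (simp add: \<eta>_def)
qed

context grounded_mesh
begin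

text \<open>Half of the Dirichlet value of \<open>n\<^sub>0\<close> is the Dirichlet value of both \<open>n\<^sub>+\<close> and \<open>n\<^sub>-\<close>. The
  hypothesis on \<open>\<tau>\<close> makes the zero-order coefficient \<open>q\<close> of the transverse equation nonnegative for
  every nonnegative density.\<close>

proposition scheme_step_exists:
  fixes m :: "real^3" and B :: real and C gD VD :: "point \<Rightarrow> real"
  assumes par: "0 < D" "0 \<le> p" "p < 1" "norm m = 1" "0 < \<tau>" "0 < lD" "0 < dt"
    and B: "0 \<le> B"
    and old: "\<And>K. K \<in> cells M \<Longrightarrow> 0 \<le> n0' K / 2 + n' K \<bullet> m \<and> n0' K / 2 + n' K \<bullet> m \<le> B"
      "\<And>K. K \<in> cells M \<Longrightarrow> 0 \<le> n0' K / 2 - n' K \<bullet> m \<and> n0' K / 2 - n' K \<bullet> m \<le> B"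
      "\<And>K. K \<in> cells M \<Longrightarrow> norm (n' K - (n' K \<bullet> m) *\<^sub>R m) \<le> B"
    and bd: "\<And>\<sigma>. \<sigma> \<in> ED \<Longrightarrow> 0 \<le> edge_avg \<sigma> gD / 2 \<and> edge_avg \<sigma> gD / 2 \<le> B"
    and C: "\<And>K. K \<in> cells M \<Longrightarrow> cell_avg K C \<le> B"
    and relax: "\<And>K. K \<in> cells M \<Longrightarrow> D / sqrt (1 - p\<^sup>2) * cell_avg K C / lD\<^sup>2 \<le> 1 / \<tau>"
  shows "\<exists>n0 n V. scheme_step M ED D p m \<gamma> \<tau> lD dt C gD VD n0' n' n0 n V \<and>
    (\<forall>K\<in>cells M. 0 \<le> n0 K / 2 + n K \<bullet> m \<and> n0 K / 2 + n K \<bullet> m \<le> B \<and>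
      0 \<le> n0 K / 2 - n K \<bullet> m \<and> n0 K / 2 - n K \<bullet> m \<le> B \<and>
      norm (n K - (n K \<bullet> m) *\<^sub>R m) \<le> B)"
proof -
  define \<eta> where "\<eta> = sqrt (1 - p\<^sup>2)"
  define b where "b \<sigma> = edge_avg \<sigma> gD / 2" for \<sigma>
  define bV where "bV \<sigma> = edge_avg \<sigma> VD" for \<sigma>
  define u' where "u' K = n0' K / 2 + n' K \<bullet> m" for K
  define v' where "v' K = n0' K / 2 - n' K \<bullet> m" for K
  define t' where "t' K = n' K - (n' K \<bullet> m) *\<^sub>R m" for K
  have "p\<^sup>2 < 1" using par by (simp add: power_less_one_iff)
  then have \<eta>: "0 < \<eta>" by (simp add: \<eta>_def)
  have mm: "m \<bullet> m = 1" using par by (simp add: dot_square_norm)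
  have bounds: "0 \<le> u' K \<and> u' K \<le> B" "0 \<le> v' K \<and> v' K \<le> B" if "K \<in> cells M" for K
    using old(1,2)[OF that] by (auto simp: u'_def v'_def)
  have b: "0 \<le> b \<sigma> \<and> b \<sigma> \<le> B" if "\<sigma> \<in> ED" for \<sigma>
    using bd[OF that] by (simp add: b_def)
  have coeffs: "0 < D / (1 + p)" "0 < D / (1 - p)" "0 \<le> 1 / (2 * \<tau>)" using par by auto
  have "\<exists>u v V. \<forall>K\<in>cells M. 0 \<le> u K \<and> u K \<le> B \<and> 0 \<le> v K \<and> v K \<le> B \<and>
       density_balance dt (D / (1 + p)) (1 / (2 * \<tau>)) bV V b u' u v K \<and>
       density_balance dt (D / (1 - p)) (1 / (2 * \<tau>)) bV V b v' v u K \<and>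
       poisson_balance lD bV V K (u K + v K - cell_avg K C)"
    by (rule densities_and_potential_exist) (use coeffs par B bounds b C in auto)
  then obtain u v V where uv: "\<And>K. K \<in> cells M \<Longrightarrow> 0 \<le> u K \<and> u K \<le> B \<and> 0 \<le> v K \<and> v K \<le> B"
    and equ: "\<And>K. K \<in> cells M \<Longrightarrow> density_balance dt (D / (1 + p)) (1 / (2 * \<tau>)) bV V b u' u v K"
    and eqv: "\<And>K. K \<in> cells M \<Longrightarrow> density_balance dt (D / (1 - p)) (1 / (2 * \<tau>)) bV V b v' v u K"
    and poisson: "\<And>K. K \<in> cells M \<Longrightarrow> poisson_balance lD bV V K (u K + v K - cell_avg K C)"
    by blast
  define q where "q K = measure lebesgue K / \<tau>
      + D / \<eta> * (measure lebesgue K * (u K + v K - cell_avg K C) / lD\<^sup>2)" for K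
  have q_nonneg: "0 \<le> q K" if K: "K \<in> cells M" for K
  proof -
    have "q K = measure lebesgue K * (1 / \<tau> - D / \<eta> * cell_avg K C / lD\<^sup>2 + D / \<eta> * (u K + v K) / lD\<^sup>2)"
      by (simp add: q_def algebra_simps add_divide_distrib diff_divide_distrib)
    also have "0 \<le> \<dots>"
      using relax[OF K] uv[OF K] par \<eta> by (intro mult_nonneg_nonneg add_nonneg_nonneg)
        (auto simp: \<eta>_def)
    finally show ?thesis .
  qed
  have t': "norm (t' K) \<le> B" "t' K \<bullet> m = 0" if "K \<in> cells M" for K
    using old(3)[OF that] by (simp_all add: t'_def inner_diff_left mm)
  have "\<exists>t. \<forall>K\<in>cells M. norm (t K) \<le> B \<and> t K \<bullet> m = 0 \<and> (measure lebesgue K / dt) *\<^sub>R (t K - t' K)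
       + (D / \<eta>) *\<^sub>R upwind bV V (\<lambda>_. 0) t K
       - (2 * \<gamma> * measure lebesgue K) *\<^sub>R cross3 (t K) m + q K *\<^sub>R t K = 0"
    by (rule transverse_spin_exists) (use t' par B \<eta> q_nonneg in auto)
  then obtain t where t: "\<And>K. K \<in> cells M \<Longrightarrow> norm (t K) \<le> B" "\<And>K. K \<in> cells M \<Longrightarrow> t K \<bullet> m = 0"
    and eqt: "\<And>K. K \<in> cells M \<Longrightarrow> (measure lebesgue K / dt) *\<^sub>R (t K - t' K)
       + (D / \<eta>) *\<^sub>R upwind bV V (\<lambda>_. 0) t K
       - (2 * \<gamma> * measure lebesgue K) *\<^sub>R cross3 (t K) m + q K *\<^sub>R t K = 0"
    by blast
  define n0 where "n0 K = u K + v K" for K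
  define n where "n K = ((u K - v K) / 2) *\<^sub>R m + t K" for K
  define Ju where "Ju = SG_flux M ED bV V b u"
  define Jv where "Jv = SG_flux M ED bV V b v"
  define T where "T = SG_flux M ED bV V (\<lambda>_. 0) t"
  have nm: "n K \<bullet> m = (u K - v K) / 2" if "K \<in> cells M" for K
    by (simp add: n_def inner_add_left mm t(2)[OF that])
  have J0: "SG_flux M ED bV V (\<lambda>\<sigma>. edge_avg \<sigma> gD) n0 = (\<lambda>K \<sigma>. Ju K \<sigma> + Jv K \<sigma>)"
    using SG_flux_add[of M ED bV V b b u v] by (auto simp: b_def n0_def[abs_def] Ju_def Jv_def fun_eq_iff)
  have J: "SG_flux M ED bV V (\<lambda>_. 0) n K \<sigma> = ((Ju K \<sigma> - Jv K \<sigma>) / 2) *\<^sub>R m + T K \<sigma>" for K \<sigma>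
    by (simp add: SG_flux_def outer_val_def n_def Ju_def Jv_def T_def algebra_simps
        diff_divide_distrib add_divide_distrib)
  have Tm: "T K \<sigma> \<bullet> m = 0" if "K \<in> cells M" "\<sigma> \<in> cell_edges M K" for K \<sigma>
    using that neighbour_in_cells[OF that] t(2)
    by (simp add: T_def SG_flux_def outer_val_def inner_diff_left)
  let ?Jcharge = "SG_flux M ED (\<lambda>\<sigma>. edge_avg \<sigma> VD) V (\<lambda>\<sigma>. edge_avg \<sigma> gD) n0"
    and ?Jspin = "SG_flux M ED (\<lambda>\<sigma>. edge_avg \<sigma> VD) V (\<lambda>_. 0) n"
  have "scheme_step M ED D p m \<gamma> \<tau> lD dt C gD VD n0' n' n0 n V"
    unfolding scheme_step_def Let_def
  proof (intro ballI conjI)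
    fix K assume K: "K \<in> cells M"
    have olds: "n0' K = u' K + v' K" "n' K = ((u' K - v' K) / 2) *\<^sub>R m + t' K"
      by (simp_all add: u'_def v'_def t'_def)
    have "(\<Sum>\<sigma>\<in>cell_edges M K. charge_flux D p m (?Jcharge K \<sigma>) (?Jspin K \<sigma>))
       = (\<Sum>\<sigma>\<in>cell_edges M K. D / (1 + p) * Ju K \<sigma> + D / (1 - p) * Jv K \<sigma>)"
      using K Tm par mm
      by (intro sum.cong refl)
         (simp add: J0[unfolded bV_def] J[unfolded bV_def] charge_flux_split inner_add_left)
    also have "\<dots> = D / (1 + p) * (\<Sum>\<sigma>\<in>cell_edges M K. Ju K \<sigma>) + D / (1 - p) * (\<Sum>\<sigma>\<in>cell_edges M K. Jv K \<sigma>)"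
      by (simp add: sum.distrib sum_distrib_left)
    finally show "measure lebesgue K * ((n0 K - n0' K) / dt)
          + (\<Sum>\<sigma>\<in>cell_edges M K. charge_flux D p m (?Jcharge K \<sigma>) (?Jspin K \<sigma>)) = 0"
      using equ[OF K] eqv[OF K] unfolding density_balance_def n0_def olds Ju_def[symmetric] Jv_def[symmetric]
      by (simp add: algebra_simps add_divide_distrib diff_divide_distrib)
    have "(\<Sum>\<sigma>\<in>cell_edges M K. spin_flux D p m (?Jcharge K \<sigma>) (?Jspin K \<sigma>))
       = (\<Sum>\<sigma>\<in>cell_edges M K. ((D / (1 + p) * Ju K \<sigma> - D / (1 - p) * Jv K \<sigma>) / 2) *\<^sub>R m + (D / \<eta>) *\<^sub>R T K \<sigma>)"
      using K Tm par
      by (intro sum.cong refl)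
         (simp add: J0[unfolded bV_def] J[unfolded bV_def] spin_flux_split \<eta>_def)
    also have "\<dots> = ((D / (1 + p) * (\<Sum>\<sigma>\<in>cell_edges M K. Ju K \<sigma>)
        - D / (1 - p) * (\<Sum>\<sigma>\<in>cell_edges M K. Jv K \<sigma>)) / 2) *\<^sub>R m + (D / \<eta>) *\<^sub>R (\<Sum>\<sigma>\<in>cell_edges M K. T K \<sigma>)"
      by (simp only: sum.distrib scaleR_sum_right[symmetric] scaleR_sum_left[symmetric]
          sum_divide_distrib[symmetric] sum_subtractf sum_distrib_left[symmetric])
    also have "(D / \<eta>) *\<^sub>R (\<Sum>\<sigma>\<in>cell_edges M K. T K \<sigma>) =
        - ((measure lebesgue K / dt) *\<^sub>R (t K - t' K)
           - (2 * \<gamma> * measure lebesgue K) *\<^sub>R cross3 (t K) m + (measure lebesgue K / \<tau>) *\<^sub>R t K)"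
    proof -
      have "(D / \<eta>) *\<^sub>R (\<Sum>\<sigma>\<in>cell_edges M K. T K \<sigma>) =
          (D / \<eta>) *\<^sub>R upwind bV V (\<lambda>_. 0) t K + (q K - measure lebesgue K / \<tau>) *\<^sub>R t K"
        unfolding T_def sum_SG_flux[OF K poisson[OF K] \<open>0 < lD\<close>]
        by (simp add: q_def scaleR_add_right)
      moreover have "X = R - a - r" if "a + X - R + r = 0" for X R a r :: "real^3"
      proof -
        have "X = (a + X - R + r) + (R - a - r)" by simp
        then show ?thesis unfolding that by simp
      qed
      note this[OF eqt[OF K]]
      ultimately show ?thesis by (simp add: algebra_simps)
    qed
    also have "(D / (1 + p) * (\<Sum>\<sigma>\<in>cell_edges M K. Ju K \<sigma>) - D / (1 - p) * (\<Sum>\<sigma>\<in>cell_edges M K. Jv K \<sigma>)) / 2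
        = - (measure lebesgue K / dt * ((u K - v K) / 2 - (u' K - v' K) / 2) + measure lebesgue K / \<tau> * ((u K - v K) / 2))"
    proof -
      have flux_sums: "D / (1 + p) * (\<Sum>\<sigma>\<in>cell_edges M K. Ju K \<sigma>)
          = - (measure lebesgue K * ((u K - u' K) / dt) + 1 / (2 * \<tau>) * measure lebesgue K * (u K - v K))"
        "D / (1 - p) * (\<Sum>\<sigma>\<in>cell_edges M K. Jv K \<sigma>)
          = - (measure lebesgue K * ((v K - v' K) / dt) + 1 / (2 * \<tau>) * measure lebesgue K * (v K - u K))"
        using equ[OF K] eqv[OF K] unfolding density_balance_def Ju_def Jv_def by linarith+
      show ?thesis unfolding flux_sums using par by (simp add: field_simps)
    qed
    finally show "(measure lebesgue K / dt) *\<^sub>R (n K - n' K)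
          + (\<Sum>\<sigma>\<in>cell_edges M K. spin_flux D p m (?Jcharge K \<sigma>) (?Jspin K \<sigma>))
          - (2 * \<gamma> * measure lebesgue K) *\<^sub>R cross3 (n K) m
          = - ((measure lebesgue K / \<tau>) *\<^sub>R n K)"
      unfolding n_def olds(2)
      by (simp add: cross_add_left cross_mult_left cross_refl algebra_simps)
    show "- lD\<^sup>2 * (\<Sum>\<sigma>\<in>cell_edges M K. transmissibility M K \<sigma> * jump M ED (\<lambda>\<sigma>. edge_avg \<sigma> VD) V K \<sigma>)
          = measure lebesgue K * (n0 K - cell_avg K C)"
      using poisson[OF K] by (simp add: poisson_balance_def bV_def[abs_def] n0_def)
  qed
  moreover have "n K - (n K \<bullet> m) *\<^sub>R m = t K" if "K \<in> cells M" for K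
    unfolding nm[OF that] by (simp add: n_def)
  moreover have "n0 K / 2 + n K \<bullet> m = u K" "n0 K / 2 - n K \<bullet> m = v K" if "K \<in> cells M" for K
    unfolding nm[OF that] n0_def by (simp_all add: field_simps)
  ultimately show ?thesis
    using uv t(1) by (rule_tac exI[of _ n0], rule_tac exI[of _ n], rule_tac exI[of _ V]) auto
qed

end

section \<open>Cells on the two sides of an edge\<close>

text \<open>Twice the signed area of the triangle \<open>a b x\<close>.\<close>

definition side :: "point \<Rightarrow> point \<Rightarrow> point \<Rightarrow> real" where
  "side a b x = (b $ 1 - a $ 1) * (x $ 2 - a $ 2) - (b $ 2 - a $ 2) * (x $ 1 - a $ 1)"

definition line_coord :: "point \<Rightarrow> point \<Rightarrow> point \<Rightarrow> real" where
  "line_coord a b x = ((x - a) \<bullet> (b - a)) / ((b - a) \<bullet> (b - a))"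

lemma line_coord_eq:
  assumes "a \<noteq> b" "side a b x = 0"
  shows "x = a + line_coord a b x *\<^sub>R (b - a)"
proof -
  define e1 where "e1 = b $ 1 - a $ 1"
  define e2 where "e2 = b $ 2 - a $ 2"
  define y1 where "y1 = x $ 1 - a $ 1"
  define y2 where "y2 = x $ 2 - a $ 2"
  have par: "e1 * y2 = e2 * y1"
    using assms(2) by (simp add: side_def e1_def e2_def y1_def y2_def)
  have nz: "e1 * e1 + e2 * e2 \<noteq> 0"
  proof -
    have "e1 \<noteq> 0 \<or> e2 \<noteq> 0" using assms(1) by (auto simp: e1_def e2_def vec_eq_iff forall_2)
    then show ?thesis by (simp add: sum_squares_eq_zero_iff)
  qed
  define s where "s = (y1 * e1 + y2 * e2) / (e1 * e1 + e2 * e2)"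
  have s: "line_coord a b x = s"
    by (simp add: line_coord_def s_def inner_vec_def sum_2 e1_def e2_def y1_def y2_def)
  have "(y1 * e1 + y2 * e2) * e1 = y1 * (e1 * e1 + e2 * e2)" "(y1 * e1 + y2 * e2) * e2 = y2 * (e1 * e1 + e2 * e2)"
    using par by algebra+
  then have "s * e1 = y1" "s * e2 = y2"
    using nz by (simp_all add: s_def)
  then show ?thesis
    by (simp add: s vec_eq_iff forall_2 e1_def e2_def y1_def y2_def)
qed

lemma line_coord_midpoint: "a \<noteq> b \<Longrightarrow> line_coord a b (midpoint a b) = 1 / 2"
proof -
  assume "a \<noteq> b"
  then have "(b - a) \<bullet> (b - a) \<noteq> 0" by simp
  moreover have "midpoint a b - a = (1 / 2) *\<^sub>R (b - a)"
    by (simp add: midpoint_def algebra_simps vec_eq_iff)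
  ultimately show ?thesis unfolding line_coord_def by simp
qed

lemma side_midpoint [simp]: "side a b (midpoint a b) = 0"
  by (simp add: side_def midpoint_def field_simps)

lemma side_convex_comb: "side a b ((1 - t) *\<^sub>R x + t *\<^sub>R y) = (1 - t) * side a b x + t * side a b y"
  by (simp add: side_def algebra_simps)

lemma tendsto_line_coord [tendsto_intros]:
  "(f \<longlongrightarrow> l) F \<Longrightarrow> ((\<lambda>x. line_coord a b (f x)) \<longlongrightarrow> line_coord a b l) F"
  unfolding line_coord_def divide_inverse by (intro tendsto_intros)

lemma tendsto_side [tendsto_intros]:
  "(f \<longlongrightarrow> l) F \<Longrightarrow> ((\<lambda>x. side a b (f x)) \<longlongrightarrow> side a b l) F"
  unfolding side_def by (intro tendsto_intros)

text \<open>Write \<open>z\<close> as a convex combination of \<open>x\<close> and a point \<open>y\<close> on the line through \<open>a\<close> and \<open>b\<close>. As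
  \<open>z\<close> tends to the midpoint, so does \<open>y\<close>, which therefore lies on the segment, hence in the closure
  of \<open>K\<close>; the interior of the segment from \<open>y\<close> to \<open>x\<close> then lies in \<open>K\<close>.\<close>

lemma convex_near_midpoint:
  fixes K :: "point set"
  assumes K: "convex K" "open K" and ab: "a \<in> closure K" "b \<in> closure K" "a \<noteq> b"
    and x: "x \<in> K" "side a b x \<noteq> 0"
  shows "\<forall>\<^sub>F z in nhds (midpoint a b).
    (0 < side a b z * side a b x \<longrightarrow> z \<in> K) \<and> (side a b z = 0 \<longrightarrow> z \<in> closure K)"
proof -
  define t where "t z = side a b z / side a b x" for z
  define y where "y z = (1 / (1 - t z)) *\<^sub>R (z - t z *\<^sub>R x)" for z
  have t: "(t \<longlongrightarrow> 0) (nhds (midpoint a b))"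
    unfolding t_def by (rule tendsto_eq_intros refl filterlim_ident x | simp)+
  have "(y \<longlongrightarrow> (1 / (1 - 0)) *\<^sub>R (midpoint a b - 0 *\<^sub>R x)) (nhds (midpoint a b))"
    unfolding y_def by (intro tendsto_intros t filterlim_ident) auto
  then have y: "((\<lambda>z. line_coord a b (y z)) \<longlongrightarrow> 1 / 2) (nhds (midpoint a b))"
    using tendsto_line_coord[of y "midpoint a b" _ a b] ab(3) by (simp add: line_coord_midpoint)
  have "\<forall>\<^sub>F z in nhds (midpoint a b). t z < 1" "\<forall>\<^sub>F z in nhds (midpoint a b). 0 < line_coord a b (y z)"
    "\<forall>\<^sub>F z in nhds (midpoint a b). line_coord a b (y z) < 1"
    using t y by (auto intro: order_tendstoD)
  then show ?thesis
  proof eventually_elim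
    case (elim z)
    have z: "z = (1 - t z) *\<^sub>R y z + t z *\<^sub>R x" using elim(1) by (simp add: y_def)
    have "side a b z = t z * side a b x" using x by (simp add: t_def)
    then have "side a b (y z) = 0"
      using elim(1) side_convex_comb[of a b "t z" "y z" x] z by simp
    then have "y z = (1 - line_coord a b (y z)) *\<^sub>R a + line_coord a b (y z) *\<^sub>R b"
      using line_coord_eq[OF ab(3)] by (simp add: algebra_simps)
    then have yK: "y z \<in> closure K"
      using convexD_alt[OF convex_closure[OF K(1)] ab(1,2), of "line_coord a b (y z)"] elim by simp
    have "z \<in> K" if "0 < side a b z * side a b x"
    proof -
      have "0 < t z" using that by (simp add: t_def zero_less_divide_iff zero_less_mult_iff)
      then have "y z - t z *\<^sub>R (y z - x) \<in> interior K"
        using K x yK elim(1)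
        by (intro mem_interior_closure_convex_shrink) (auto simp: interior_open)
      moreover have "y z - t z *\<^sub>R (y z - x) = z" using z by (simp add: algebra_simps)
      ultimately show ?thesis using K by (simp add: interior_open)
    qed
    moreover have "z \<in> closure K" if "side a b z = 0"
      using that yK z by (simp add: t_def)
    ultimately show ?case by blast
  qed
qed

text \<open>From a point of \<open>K\<close> on the line one could move towards the farther end point and meet the
  midpoint inside \<open>K\<close>.\<close>

lemma side_nonzero:
  fixes K :: "point set"
  assumes K: "convex K" "open K" and ab: "a \<in> closure K" "b \<in> closure K" "a \<noteq> b"
    and mid: "midpoint a b \<notin> K" and x: "x \<in> K"
  shows "side a b x \<noteq> 0"
proof
  assume "side a b x = 0"
  then obtain s where s: "x = a + s *\<^sub>R (b - a)" using line_coord_eq[OF ab(3)] by blast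
  have shrink: "e - r *\<^sub>R (e - x) \<in> K" if "e \<in> closure K" "0 < r" "r \<le> 1" for e r
    using mem_interior_closure_convex_shrink[OF K(1), of x e r] that x K by (simp add: interior_open)
  have mp: "midpoint a b = a + (1 / 2) *\<^sub>R (b - a)"
    by (simp add: midpoint_def algebra_simps vec_eq_iff)
  consider "s \<le> 1 / 2" | "1 / 2 \<le> s" by linarith
  then show False
  proof cases
    case 1
    have "b - x = (1 - s) *\<^sub>R (b - a)" by (simp add: s algebra_simps)
    then have "b - (1 / (2 * (1 - s))) *\<^sub>R (b - x) = b - (1 / 2) *\<^sub>R (b - a)" using 1 by simp
    also have "\<dots> = midpoint a b" by (simp add: midpoint_def algebra_simps vec_eq_iff)
    finally show False using shrink[OF ab(2), of "1 / (2 * (1 - s))"] 1 mid by simp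
  next
    case 2
    have "a - x = - (s *\<^sub>R (b - a))" by (simp add: s)
    then have "a - (1 / (2 * s)) *\<^sub>R (a - x) = midpoint a b" using 2 by (simp add: mp)
    then show False using shrink[OF ab(1), of "1 / (2 * s)"] 2 mid by simp
  qed
qed

text \<open>Two cells on the same side would both contain all points of that side close to the midpoint.\<close>

lemma disjoint_cells_on_opposite_sides:
  fixes K L :: "point set"
  assumes K: "convex K" "open K" and L: "convex L" "open L" and disj: "K \<inter> L = {}"
    and ab: "a \<noteq> b" "a \<in> closure K" "b \<in> closure K" "a \<in> closure L" "b \<in> closure L"
    and xy: "x \<in> K" "y \<in> L"
  shows "side a b x * side a b y < 0"
proof (rule ccontr)
  have midc: "midpoint a b \<in> closure A" if "convex A" "a \<in> closure A" "b \<in> closure A" for A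
    using convexD_alt[OF convex_closure[OF that(1)] that(2,3), of "1/2"]
    by (simp add: midpoint_def scaleR_add_right)
  have mid: "midpoint a b \<notin> K" "midpoint a b \<notin> L"
    using midc[OF L(1) ab(4,5)] midc[OF K(1) ab(2,3)] disj
      open_Int_closure_eq_empty[OF K(2), of L] open_Int_closure_eq_empty[OF L(2), of K] by auto
  have nz: "side a b x \<noteq> 0" "side a b y \<noteq> 0"
    using side_nonzero[OF K ab(2,3,1) mid(1) xy(1)] side_nonzero[OF L ab(4,5,1) mid(2) xy(2)] by auto
  assume "\<not> side a b x * side a b y < 0"
  with nz have same: "0 < side a b x * side a b y" by (metis linorder_neqE_linordered_idom mult_eq_0_iff)
  define z where "z \<epsilon> = (1 - \<epsilon>) *\<^sub>R midpoint a b + \<epsilon> *\<^sub>R x" for \<epsilon>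
  have "(z \<longlongrightarrow> (1 - 0) *\<^sub>R midpoint a b + 0 *\<^sub>R x) (at_right 0)"
    unfolding z_def by (intro tendsto_intros)
  then have lim: "filterlim z (nhds (midpoint a b)) (at_right 0)" by simp
  have side_z: "side a b (z \<epsilon>) = \<epsilon> * side a b x" for \<epsilon> by (simp add: z_def side_convex_comb)
  have "\<forall>\<^sub>F \<epsilon> in at_right (0::real). 0 < \<epsilon>" by (simp add: eventually_at_right_less)
  then have "\<forall>\<^sub>F \<epsilon> in at_right 0. z \<epsilon> \<in> K \<inter> L"
    using eventually_compose_filterlim[OF convex_near_midpoint[OF K ab(2,3,1) xy(1) nz(1)] lim]
      eventually_compose_filterlim[OF convex_near_midpoint[OF L ab(4,5,1) xy(2) nz(2)] lim]
  proof eventually_elim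
    case (elim \<epsilon>)
    have "0 < side a b (z \<epsilon>) * side a b x" "0 < side a b (z \<epsilon>) * side a b y"
      using elim(1) same nz by (auto simp: side_z zero_less_mult_iff mult.assoc)
    then show ?case using elim by auto
  qed
  then show False using disj eventually_happens'[OF trivial_limit_at_right_real] by fastforce
qed

lemma midpoint_interior_of_two_cells:
  fixes K L :: "point set"
  assumes K: "convex K" "open K" "K \<noteq> {}" and L: "convex L" "open L" "L \<noteq> {}" and disj: "K \<inter> L = {}"
    and ab: "a \<noteq> b" "a \<in> closure K" "b \<in> closure K" "a \<in> closure L" "b \<in> closure L"
  shows "midpoint a b \<in> interior (closure K \<union> closure L)"
proof -
  obtain x y where xy: "x \<in> K" "y \<in> L" using K L by auto
  have opp: "side a b x * side a b y < 0"
    by (rule disjoint_cells_on_opposite_sides[OF K(1,2) L(1,2) disj ab xy])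
  then have nz: "side a b x \<noteq> 0" "side a b y \<noteq> 0" by auto
  have "\<forall>\<^sub>F z in nhds (midpoint a b). z \<in> closure K \<union> closure L"
    using convex_near_midpoint[OF K(1,2) ab(2,3,1) xy(1) nz(1)]
      convex_near_midpoint[OF L(1,2) ab(4,5,1) xy(2) nz(2)]
  proof eventually_elim
    case (elim z)
    have "side a b z = 0 \<or> 0 < side a b z * side a b x \<or> 0 < side a b z * side a b y"
      using opp by (auto simp: zero_less_mult_iff mult_less_0_iff)
    then show ?case using elim closure_subset by blast
  qed
  then show ?thesis
    unfolding eventually_nhds by (meson interiorI subsetI)
qed

section \<open>Length of segments\<close>

lemma segment_ends_closure:
  assumes "segment_ends \<sigma> a b"
  shows "closure \<sigma> = closed_segment a b"
proof
  show "closure \<sigma> \<subseteq> closed_segment a b"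
    using assms by (intro closure_minimal) (auto simp: segment_ends_def)
  show "closed_segment a b \<subseteq> closure \<sigma>"
    using assms closure_mono[of "open_segment a b" \<sigma>] by (simp add: segment_ends_def)
qed

lemma segment_ends_borel: "segment_ends \<sigma> a b \<Longrightarrow> \<sigma> \<in> sets borel"
proof -
  assume \<sigma>: "segment_ends \<sigma> a b"
  then have "\<sigma> = open_segment a b \<union> (\<sigma> \<inter> {a, b})"
    by (auto simp: segment_ends_def open_segment_def)
  moreover have "open_segment a b = closed_segment a b - {a, b}" by (auto simp: open_segment_def)
  moreover have "finite (\<sigma> \<inter> {a, b})" by simp
  ultimately show ?thesis
    by (metis borel_closed closed_segment finite_imp_closed finite.emptyI finite.insertI sets.Diff sets.Un)
qed

text \<open>The end points chosen in the definition of the measure may be the given ones in the other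
  order, so they are obtained anew.\<close>

lemma segment_measure_parametrized:
  assumes "segment_ends \<sigma> a b"
  obtains a b where "segment_ends \<sigma> a b"
    "segment_measure \<sigma> = distr (restrict_space lborel {0..dist a b}) borel
               (\<lambda>t. a + (t / dist a b) *\<^sub>R (b - a))"
proof -
  obtain a b where ab: "(SOME (a, b). segment_ends \<sigma> a b) = (a, b)" by fastforce
  have "segment_ends \<sigma> a b"
    using someI_ex[of "\<lambda>(a, b). segment_ends \<sigma> a b"] assms ab by auto
  then show ?thesis using that ab by (simp add: segment_measure_def)
qed

lemma sets_segment_measure [simp, measurable_cong]: "sets (segment_measure \<sigma>) = sets borel"
  and space_segment_measure [simp]: "space (segment_measure \<sigma>) = UNIV"
  by (simp_all add: segment_measure_def split: prod.split)

lemma measurable_segment_param [measurable]: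
  "(\<lambda>t. a + (t / dist a b) *\<^sub>R (b - a :: point)) \<in> borel_measurable (restrict_space lborel S)"
proof -
  have "(\<lambda>t. a + (t * c) *\<^sub>R d) \<in> borel_measurable (restrict_space lborel S)" for c and d :: point
  proof -
    have "(\<lambda>t. a + (t * c) *\<^sub>R d) \<in> borel_measurable borel"
      by (intro borel_measurable_continuous_onI continuous_intros)
    then show ?thesis by (intro measurable_restrict_space1) simp
  qed
  then show ?thesis by (simp add: divide_inverse)
qed

lemma emeasure_segment_measure:
  assumes "segment_measure \<sigma> = distr (restrict_space lborel {0..dist a b}) borel
               (\<lambda>t. a + (t / dist a b) *\<^sub>R (b - a))" "A \<in> sets borel"
  shows "emeasure (segment_measure \<sigma>) A =
    emeasure lborel {t \<in> {0..dist a b}. a + (t / dist a b) *\<^sub>R (b - a) \<in> A}"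
proof -
  let ?f = "\<lambda>t. a + (t / dist a b) *\<^sub>R (b - a)"
  have "emeasure (segment_measure \<sigma>) A = emeasure (restrict_space lborel {0..dist a b}) (?f -` A \<inter> {0..dist a b})"
    using assms by (simp add: emeasure_distr space_restrict_space)
  also have "\<dots> = emeasure lborel (?f -` A \<inter> {0..dist a b})"
    by (rule emeasure_restrict_space) auto
  also have "?f -` A \<inter> {0..dist a b} = {t \<in> {0..dist a b}. ?f t \<in> A}" by auto
  finally show ?thesis .
qed

lemma segment_param_in:
  assumes "0 \<le> t" "t \<le> dist a b" "a \<noteq> b"
  shows "a + (t / dist a b) *\<^sub>R (b - a) \<in> closed_segment a b"
    and "0 < t \<Longrightarrow> t < dist a b \<Longrightarrow> a + (t / dist a b) *\<^sub>R (b - a) \<in> open_segment a b"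
proof -
  have eq: "a + (t / dist a b) *\<^sub>R (b - a) = (1 - t / dist a b) *\<^sub>R a + (t / dist a b) *\<^sub>R b"
    by (simp add: algebra_simps)
  show "a + (t / dist a b) *\<^sub>R (b - a) \<in> closed_segment a b"
    unfolding eq using assms by (auto simp: closed_segment_def divide_le_eq_1)
  show "a + (t / dist a b) *\<^sub>R (b - a) \<in> open_segment a b" if "0 < t" "t < dist a b"
    unfolding eq using assms that by (auto simp: in_segment divide_less_eq_1 intro!: exI[of _ "t / dist a b"])
qed

lemma segment_measure_finite: "segment_ends \<sigma> a b \<Longrightarrow> emeasure (segment_measure \<sigma>) A < \<infinity>"
proof -
  assume "segment_ends \<sigma> a b"
  then obtain a b where ab: "segment_measure \<sigma> = distr (restrict_space lborel {0..dist a b}) borel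
               (\<lambda>t. a + (t / dist a b) *\<^sub>R (b - a))"
    by (rule segment_measure_parametrized)
  have "emeasure (segment_measure \<sigma>) A \<le> emeasure (segment_measure \<sigma>) UNIV"
    using emeasure_space[of "segment_measure \<sigma>" A] by simp
  also have "\<dots> = ennreal (dist a b)"
  proof -
    have "{t \<in> {0..dist a b}. a + (t / dist a b) *\<^sub>R (b - a) \<in> UNIV} = {0..dist a b}" by auto
    then show ?thesis using emeasure_segment_measure[OF ab, of UNIV] by simp
  qed
  also have "\<dots> < \<infinity>" by simp
  finally show ?thesis .
qed

lemma AE_segment_measure_in:
  assumes "segment_ends \<sigma> a b"
  shows "AE x in segment_measure \<sigma>. x \<in> \<sigma>"
proof -
  obtain a b where ab: "segment_ends \<sigma> a b" "segment_measure \<sigma> = distr (restrict_space lborel {0..dist a b}) borel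
               (\<lambda>t. a + (t / dist a b) *\<^sub>R (b - a))"
    by (rule segment_measure_parametrized[OF assms])
  have ne: "a \<noteq> b" and op: "open_segment a b \<subseteq> \<sigma>" using ab(1) by (auto simp: segment_ends_def)
  have "AE t in lborel. t \<noteq> 0 \<and> t \<noteq> dist a b"
    using AE_lborel_singleton[of "0::real"] AE_lborel_singleton[of "dist a b"] by eventually_elim simp
  then have "AE t in lborel. t \<in> {0..dist a b} \<longrightarrow> a + (t / dist a b) *\<^sub>R (b - a) \<in> \<sigma>"
  proof eventually_elim
    case (elim t)
    then show ?case using segment_param_in(2)[of t a b] ne op by fastforce
  qed
  then have "AE t in restrict_space lborel {0..dist a b}. a + (t / dist a b) *\<^sub>R (b - a) \<in> \<sigma>"
    by (subst AE_restrict_space_iff) auto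
  then show ?thesis
    unfolding ab(2) by (subst AE_distr_iff) (use segment_ends_borel[OF assms] in \<open>auto\<close>)
qed

lemma emeasure_segment_measure_self:
  assumes "segment_ends \<sigma> a b"
  shows "emeasure (segment_measure \<sigma>) \<sigma> = emeasure (segment_measure \<sigma>) UNIV"
  by (rule emeasure_eq_AE) (use AE_segment_measure_in[OF assms] segment_ends_borel[OF assms] in auto)

lemma segment_measure_subsegment_pos:
  assumes \<sigma>: "segment_ends \<sigma> a b" and A: "A \<in> sets borel" "convex A"
    and pq: "p \<in> A \<inter> closure \<sigma>" "q \<in> A \<inter> closure \<sigma>" "p \<noteq> q"
  shows "0 < emeasure (segment_measure \<sigma>) A"
proof -
  obtain a b where ab: "segment_ends \<sigma> a b" "segment_measure \<sigma> = distr (restrict_space lborel {0..dist a b}) borel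
               (\<lambda>t. a + (t / dist a b) *\<^sub>R (b - a))"
    by (rule segment_measure_parametrized[OF \<sigma>])
  have ne: "a \<noteq> b" using ab(1) by (auto simp: segment_ends_def)
  define f where "f t = a + (t / dist a b) *\<^sub>R (b - a)" for t
  have par: "\<exists>t\<in>{0..dist a b}. x = f t" if "x \<in> closure \<sigma>" for x
  proof -
    have "x \<in> closed_segment a b" using that segment_ends_closure[OF ab(1)] by simp
    then obtain u where u: "0 \<le> u" "u \<le> 1" "x = (1 - u) *\<^sub>R a + u *\<^sub>R b"
      by (auto simp: in_segment)
    then have "x = f (u * dist a b)" using ne by (simp add: f_def algebra_simps)
    moreover have "u * dist a b \<in> {0..dist a b}" using u by (simp add: mult_left_le_one_le)
    ultimately show ?thesis by blast
  qed
  obtain s t where st: "s \<in> {0..dist a b}" "t \<in> {0..dist a b}" "p = f s" "q = f t"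
    using par[of p] par[of q] pq(1,2) by blast
  have f_comb: "f ((1 - u) * x + u * y) = (1 - u) *\<^sub>R f x + u *\<^sub>R f y" for u x y
    by (simp add: f_def algebra_simps add_divide_distrib diff_divide_distrib)
  have sub: "closed_segment s t \<subseteq> {r \<in> {0..dist a b}. f r \<in> A}"
  proof
    fix r assume r: "r \<in> closed_segment s t"
    then obtain u where u: "0 \<le> u" "u \<le> 1" "r = (1 - u) * s + u * t" by (auto simp: closed_segment_def)
    have "f r \<in> A" using f_comb[of u s t] u convexD_alt[OF A(2), of "f s" "f t" u] pq st by simp
    moreover have "r \<in> {0..dist a b}" using r st closed_segment_subset[of s "{0..dist a b}" t] by auto
    ultimately show "r \<in> {r \<in> {0..dist a b}. f r \<in> A}" by simp
  qed
  have "s \<noteq> t" using pq st by auto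
  then have "0 < emeasure lborel (closed_segment s t)"
    by (cases "s \<le> t") (auto simp: closed_segment_eq_real_ivl)
  also have "\<dots> \<le> emeasure lborel {r \<in> {0..dist a b}. f r \<in> A}"
    by (rule emeasure_mono[OF sub]) (use A in \<open>simp add: f_def; measurable\<close>)
  also have "\<dots> = emeasure (segment_measure \<sigma>) A"
    unfolding f_def by (rule emeasure_segment_measure[OF ab(2) A(1), symmetric])
  finally show ?thesis .
qed

lemma edge_length_pos:
  assumes "segment_ends \<sigma> a b"
  shows "0 < edge_length \<sigma>"
proof -
  have "0 < emeasure (segment_measure \<sigma>) UNIV"
    using assms segment_ends_closure[OF assms]
    by (intro segment_measure_subsegment_pos[OF assms, of UNIV a b]) (auto simp: segment_ends_def)
  then show ?thesis
    using segment_measure_finite[OF assms, of \<sigma>] emeasure_segment_measure_self[OF assms]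
    by (simp add: edge_length_def measure_def enn2real_positive_iff)
qed

lemma sets_length_measure [simp, measurable_cong]: "sets (length_measure S) = sets borel"
  and space_length_measure [simp]: "space (length_measure S) = UNIV"
  using sets.sigma_sets_eq[of "borel :: point measure"]
  by (simp_all add: length_measure_def sets_measure_of_conv space_measure_of_conv)

lemma emeasure_length_measure:
  assumes "A \<in> sets borel"
  shows "emeasure (length_measure S) A = (\<Sum>\<sigma>\<in>S. emeasure (segment_measure \<sigma>) A)"
  unfolding length_measure_def
proof (rule emeasure_measure_of_sigma)
  show "sigma_algebra UNIV (sets (borel :: point measure))"
    using sets.sigma_algebra_axioms[of "borel :: point measure"] by simp
  show "positive (sets borel) (\<lambda>A. \<Sum>\<sigma>\<in>S. emeasure (segment_measure \<sigma>) A)"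
    by (simp add: positive_def)
  show "countably_additive (sets borel) (\<lambda>A. \<Sum>\<sigma>\<in>S. emeasure (segment_measure \<sigma>) A)"
    unfolding countably_additive_def
  proof (intro allI impI)
    fix F :: "nat \<Rightarrow> point set" assume F: "range F \<subseteq> sets borel" "disjoint_family F"
    have "(\<Sum>i. \<Sum>\<sigma>\<in>S. emeasure (segment_measure \<sigma>) (F i)) = (\<Sum>\<sigma>\<in>S. \<Sum>i. emeasure (segment_measure \<sigma>) (F i))"
      by (rule suminf_sum) auto
    also have "\<dots> = (\<Sum>\<sigma>\<in>S. emeasure (segment_measure \<sigma>) (\<Union> (range F)))"
      by (intro sum.cong refl suminf_emeasure) (use F in auto)
    finally show "(\<Sum>i. \<Sum>\<sigma>\<in>S. emeasure (segment_measure \<sigma>) (F i)) = (\<Sum>\<sigma>\<in>S. emeasure (segment_measure \<sigma>) (\<Union> (range F)))" .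
  qed
qed fact

lemma AE_length_measure_iff:
  assumes "finite S" "{x. P x} \<in> sets borel"
  shows "(AE x in length_measure S. P x) \<longleftrightarrow> (\<forall>\<sigma>\<in>S. AE x in segment_measure \<sigma>. P x)"
proof -
  have "{x. \<not> P x} = - {x. P x}" by auto
  then have m: "{x. \<not> P x} \<in> sets borel" using assms(2) by (metis borel_comp)
  show ?thesis
    using assms m by (simp add: AE_iff_measurable[OF _ refl] emeasure_length_measure)
qed

lemma segment_measure_le_length_measure:
  assumes "finite S" "\<sigma> \<in> S"
  shows "segment_measure \<sigma> \<le> length_measure S"
proof -
  have "emeasure (segment_measure \<sigma>) A \<le> emeasure (length_measure S) A" for A
  proof (cases "A \<in> sets borel")
    case True
    then show ?thesis using assms
      using sum_mono2[of S "{\<sigma>}" "\<lambda>\<sigma>. emeasure (segment_measure \<sigma>) A"] by (simp add: emeasure_length_measure)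
  qed (simp add: emeasure_notin_sets)
  then show ?thesis by (simp add: le_measure le_fun_def)
qed

section \<open>Geometry of admissible meshes\<close>

lemma bounded_open_measure_pos:
  fixes K :: "'a::euclidean_space set"
  assumes "open K" "bounded K" "K \<noteq> {}"
  shows "0 < measure lebesgue K"
proof -
  have "measure lebesgue K \<noteq> 0"
    using assms negligible_iff_measure0[of K] open_not_negligible[of K] bounded_set_imp_lmeasurable[of K]
    by (simp add: negligible_iff_measure lmeasurable_open)
  then show ?thesis by (simp add: zero_less_measure_iff)
qed

locale domain_mesh =
  fixes \<Omega> \<Gamma>D \<Gamma>N :: "point set" and M :: mesh
  assumes dom: "polygonal_domain \<Omega>"
    and parts_disjoint: "\<Gamma>D \<inter> \<Gamma>N = {}"
    and adm: "admissible_mesh \<Omega> M"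
    and ext_split: "\<forall>\<sigma>\<in>ext_edges \<Omega> M. \<sigma> \<subseteq> \<Gamma>D \<or> \<sigma> \<subseteq> \<Gamma>N"
    and dirichlet_pos: "emeasure (boundary_measure \<Omega> M) \<Gamma>D > 0"
begin

lemma
  shows cells_finite: "finite (cells M)" and edges_finite: "finite (edges M)"
    and cells_disjoint: "\<And>K L. K \<in> cells M \<Longrightarrow> L \<in> cells M \<Longrightarrow> K \<noteq> L \<Longrightarrow> K \<inter> L = {}"
    and cell_shape: "\<And>K. K \<in> cells M \<Longrightarrow> open K \<and> convex K \<and> K \<noteq> {} \<and> K \<subseteq> \<Omega>"
    and cells_cover: "closure \<Omega> = (\<Union>K\<in>cells M. closure K)"
    and edges_disjoint: "\<And>\<sigma> \<sigma>'. \<sigma> \<in> edges M \<Longrightarrow> \<sigma>' \<in> edges M \<Longrightarrow> \<sigma> \<noteq> \<sigma>' \<Longrightarrow> \<sigma> \<inter> \<sigma>' = {}"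
    and edge_segment: "\<And>\<sigma>. \<sigma> \<in> edges M \<Longrightarrow> \<exists>a b. segment_ends \<sigma> a b"
    and cell_edges_subset: "\<And>K. K \<in> cells M \<Longrightarrow> cell_edges M K \<subseteq> edges M"
    and cell_frontier: "\<And>K. K \<in> cells M \<Longrightarrow> frontier K = (\<Union>\<sigma>\<in>cell_edges M K. closure \<sigma>)"
    and edges_eq: "edges M = (\<Union>K\<in>cells M. cell_edges M K)"
    and cells_meet: "\<And>K L. K \<in> cells M \<Longrightarrow> L \<in> cells M \<Longrightarrow> K \<noteq> L \<Longrightarrow>
        emeasure (length_measure (edges M)) (closure K \<inter> closure L) = 0 \<or>
        (\<exists>\<sigma>\<in>edges M. common_edge K L \<sigma>)"
    and centers_distinct: "\<And>K L \<sigma>. K \<in> cells M \<Longrightarrow> L \<in> cells M \<Longrightarrow> \<sigma> \<in> edges M \<Longrightarrow> common_edge K L \<sigma> \<Longrightarrow>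
        center M K \<noteq> center M L"
    and regularity: "\<exists>\<xi>>0. \<forall>K\<in>cells M. \<forall>\<sigma>\<in>cell_edges M K. \<xi> * diameter K \<le> infdist (center M K) \<sigma>"
proof -
  note mesh = adm[unfolded admissible_mesh_def]
  show "finite (cells M)" by (insert mesh, elim conjE, assumption)
  show "finite (edges M)" by (insert mesh, elim conjE, assumption)
  show "closure \<Omega> = (\<Union>K\<in>cells M. closure K)" by (insert mesh, elim conjE, assumption)
  show "edges M = (\<Union>K\<in>cells M. cell_edges M K)" by (insert mesh, elim conjE, assumption)
  show "\<exists>\<xi>>0. \<forall>K\<in>cells M. \<forall>\<sigma>\<in>cell_edges M K. \<xi> * diameter K \<le> infdist (center M K) \<sigma>"
    by (insert mesh, elim conjE, assumption)
  have "pairwise disjnt (cells M)" by (insert mesh, elim conjE, assumption)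
  then show "K \<inter> L = {}" if "K \<in> cells M" "L \<in> cells M" "K \<noteq> L" for K L
    using that by (simp add: pairwise_def disjnt_def)
  have "pairwise disjnt (edges M)" by (insert mesh, elim conjE, assumption)
  then show "\<sigma> \<inter> \<sigma>' = {}" if "\<sigma> \<in> edges M" "\<sigma>' \<in> edges M" "\<sigma> \<noteq> \<sigma>'" for \<sigma> \<sigma>'
    using that by (simp add: pairwise_def disjnt_def)
  have "\<forall>K\<in>cells M. convex_polygon K \<and> K \<subseteq> \<Omega>" by (insert mesh, elim conjE, assumption)
  then show "open K \<and> convex K \<and> K \<noteq> {} \<and> K \<subseteq> \<Omega>" if "K \<in> cells M" for K
    using that by (simp add: convex_polygon_def)
  have "\<forall>\<sigma>\<in>edges M. \<exists>a b. segment_ends \<sigma> a b" by (insert mesh, elim conjE, assumption)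
  then show "\<exists>a b. segment_ends \<sigma> a b" if "\<sigma> \<in> edges M" for \<sigma> using that by blast
  have "\<forall>K\<in>cells M. cell_edges M K \<subseteq> edges M \<and> frontier K = (\<Union>\<sigma>\<in>cell_edges M K. closure \<sigma>)"
    by (insert mesh, elim conjE, assumption)
  then show "cell_edges M K \<subseteq> edges M" "frontier K = (\<Union>\<sigma>\<in>cell_edges M K. closure \<sigma>)" if "K \<in> cells M" for K
    using that by blast+
  have "\<forall>K\<in>cells M. \<forall>L\<in>cells M. K \<noteq> L \<longrightarrow>
        emeasure (length_measure (edges M)) (closure K \<inter> closure L) = 0 \<or>
        (\<exists>\<sigma>\<in>edges M. closure K \<inter> closure L = closure \<sigma>)" by (insert mesh, elim conjE, assumption)
  then show "emeasure (length_measure (edges M)) (closure K \<inter> closure L) = 0 \<or> (\<exists>\<sigma>\<in>edges M. common_edge K L \<sigma>)"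
    if "K \<in> cells M" "L \<in> cells M" "K \<noteq> L" for K L
    using that unfolding common_edge_def by blast
  have "\<forall>K\<in>cells M. \<forall>L\<in>cells M. \<forall>\<sigma>\<in>edges M. common_edge K L \<sigma> \<longrightarrow>
        center M K \<noteq> center M L \<and>
        (\<forall>a\<in>\<sigma>. \<forall>b\<in>\<sigma>. (center M L - center M K) \<bullet> (b - a) = 0)" by (insert mesh, elim conjE, assumption)
  then show "center M K \<noteq> center M L"
    if "K \<in> cells M" "L \<in> cells M" "\<sigma> \<in> edges M" "common_edge K L \<sigma>" for K L \<sigma>
    using that by blast
qed

lemma cell_bounded: "K \<in> cells M \<Longrightarrow> bounded K"
  by (rule bounded_subset[of \<Omega>]) (use cell_shape dom in \<open>auto simp: polygonal_domain_def\<close>)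

lemma cell_finite_edges: "K \<in> cells M \<Longrightarrow> finite (cell_edges M K)"
  by (rule finite_subset[OF cell_edges_subset edges_finite])

lemma cell_edge_ends:
  assumes "K \<in> cells M" "\<sigma> \<in> cell_edges M K"
  obtains a b where "segment_ends \<sigma> a b" "a \<noteq> b" "a \<in> closure K" "b \<in> closure K" "midpoint a b \<in> \<sigma>"
proof -
  obtain a b where ab: "segment_ends \<sigma> a b" using edge_segment[of \<sigma>] cell_edges_subset[OF assms(1)] assms(2) by blast
  have ne: "a \<noteq> b" using ab by (simp add: segment_ends_def)
  have "closure \<sigma> \<subseteq> closure K"
    using cell_frontier[OF assms(1)] assms(2) by (auto simp: frontier_def)
  then have "a \<in> closure K" "b \<in> closure K" using segment_ends_closure[OF ab] by auto
  moreover have "midpoint a b \<in> \<sigma>"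
    using ab ne by (auto simp: segment_ends_def midpoint_in_open_segment)
  ultimately show ?thesis using that ab ne by blast
qed

text \<open>Infinitely many points of \<open>\<sigma>\<close> lie in the closure of one of the finitely many edges of the cell.
  Passing to the closure adds at most two points, so this edge meets \<open>\<sigma>\<close>; disjoint edges being
  distinct, it is \<open>\<sigma>\<close>.\<close>

lemma edge_in_frontier_imp_cell_edge:
  assumes K: "K \<in> cells M" and \<sigma>: "\<sigma> \<in> edges M" "closure \<sigma> \<subseteq> frontier K"
  shows "\<sigma> \<in> cell_edges M K"
proof -
  obtain a b where ab: "segment_ends \<sigma> a b" using edge_segment[OF \<sigma>(1)] by blast
  then have "uncountable \<sigma>"
    using uncountable_open_segment[of a b] countable_subset by (auto simp: segment_ends_def)
  then have "infinite \<sigma>" by (simp add: uncountable_infinite)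
  moreover have "\<sigma> \<subseteq> (\<Union>\<sigma>'\<in>cell_edges M K. closure \<sigma>' \<inter> \<sigma>)"
    using \<sigma>(2) cell_frontier[OF K] closure_subset[of \<sigma>] by auto
  ultimately have "infinite (\<Union>\<sigma>'\<in>cell_edges M K. closure \<sigma>' \<inter> \<sigma>)"
    by (metis finite_subset)
  then obtain \<sigma>' where \<sigma>': "\<sigma>' \<in> cell_edges M K" "infinite (closure \<sigma>' \<inter> \<sigma>)"
    using finite_UN[OF cell_finite_edges[OF K], of "\<lambda>\<sigma>'. closure \<sigma>' \<inter> \<sigma>"] by (metis (lifting))
  obtain c d where cd: "segment_ends \<sigma>' c d" using edge_segment[of \<sigma>'] cell_edges_subset[OF K] \<sigma>'(1) by blast
  have "closure \<sigma>' - \<sigma>' \<subseteq> {c, d}"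
    using segment_ends_closure[OF cd] cd by (auto simp: segment_ends_def open_segment_def)
  then have sub: "closure \<sigma>' \<inter> \<sigma> \<subseteq> (\<sigma>' \<inter> \<sigma>) \<union> {c, d}" by auto
  have "\<sigma>' \<inter> \<sigma> \<noteq> {}"
  proof
    assume "\<sigma>' \<inter> \<sigma> = {}"
    with sub have "closure \<sigma>' \<inter> \<sigma> \<subseteq> {c, d}" by simp
    then show False using \<sigma>'(2) finite_subset[of _ "{c, d}"] by simp
  qed
  then have "\<sigma>' = \<sigma>" using edges_disjoint[of \<sigma>' \<sigma>] \<sigma>' \<sigma> cell_edges_subset[OF K] by auto
  then show ?thesis using \<sigma>' by simp
qed

text \<open>Of three cells with a common edge two would lie on the same side of it.\<close>

lemma neighbour_eq:
  assumes K: "K \<in> cells M" and \<sigma>: "\<sigma> \<in> cell_edges M K" and L: "L \<in> cells M" "common_edge K L \<sigma>"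
  shows "neighbour M K \<sigma> = L"
  unfolding neighbour_def
proof (rule the_equality)
  show "L \<in> cells M \<and> common_edge K L \<sigma>" using L by simp
  fix L' assume L': "L' \<in> cells M \<and> common_edge K L' \<sigma>"
  obtain a b where ab: "segment_ends \<sigma> a b" "a \<noteq> b" "a \<in> closure K" "b \<in> closure K"
    using cell_edge_ends[OF K \<sigma>] by metis
  have in_\<sigma>: "a \<in> closure \<sigma>" "b \<in> closure \<sigma>" using segment_ends_closure[OF ab(1)] by auto
  have in_L: "a \<in> closure L" "b \<in> closure L" "a \<in> closure L'" "b \<in> closure L'"
    using in_\<sigma> L L' unfolding common_edge_def by blast+
  have ne: "K \<noteq> L" "K \<noteq> L'" using L L' by (auto simp: common_edge_def)
  show "L' = L"
  proof (rule ccontr)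
    assume "L' \<noteq> L"
    obtain x y z where xyz: "x \<in> K" "y \<in> L" "z \<in> L'"
      using cell_shape[OF K] cell_shape[OF L(1)] cell_shape[of L'] L' by auto
    have opposite: "side a b u * side a b v < 0"
      if "A \<in> cells M" "A' \<in> cells M" "A \<noteq> A'" "a \<in> closure A" "b \<in> closure A" "a \<in> closure A'" "b \<in> closure A'"
        "u \<in> A" "v \<in> A'" for A A' u v
      using that cells_disjoint[OF that(1-3)] cell_shape[OF that(1)] cell_shape[OF that(2)] ab(2)
      by (intro disjoint_cells_on_opposite_sides) auto
    have "side a b x * side a b y < 0" "side a b x * side a b z < 0" "side a b y * side a b z < 0"
      using opposite[of K L x y] opposite[of K L' x z] opposite[of L L' y z] xyz K L(1) L' ne ab(3,4) in_L
        \<open>L' \<noteq> L\<close> by auto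
    then show False by (auto simp: mult_less_0_iff)
  qed
qed

lemma neighbour_props:
  assumes "K \<in> cells M" "\<sigma> \<in> cell_edges M K" "has_neighbour M K \<sigma>"
  shows "neighbour M K \<sigma> \<in> cells M" "common_edge K (neighbour M K \<sigma>) \<sigma>"
  using assms neighbour_eq by (auto simp: has_neighbour_def)

text \<open>Between two cells the midpoint of the edge would be interior to the closure of \<open>\<Omega>\<close>, hence a
  point of \<open>\<Omega>\<close>: here slits are excluded.\<close>

lemma exterior_edge_no_neighbour:
  assumes K: "K \<in> cells M" and \<sigma>: "\<sigma> \<in> cell_edges M K" "\<sigma> \<subseteq> frontier \<Omega>"
  shows "\<not> has_neighbour M K \<sigma>"
proof
  assume "has_neighbour M K \<sigma>"
  then obtain L where L: "L \<in> cells M" "common_edge K L \<sigma>" by (auto simp: has_neighbour_def)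
  obtain a b where ab: "segment_ends \<sigma> a b" "a \<noteq> b" "a \<in> closure K" "b \<in> closure K" "midpoint a b \<in> \<sigma>"
    using cell_edge_ends[OF K \<sigma>(1)] by metis
  have "a \<in> closure \<sigma>" "b \<in> closure \<sigma>" using segment_ends_closure[OF ab(1)] by auto
  then have in_L: "a \<in> closure L" "b \<in> closure L"
    using L unfolding common_edge_def by blast+
  have "K \<noteq> L" using L by (simp add: common_edge_def)
  then have "midpoint a b \<in> interior (closure K \<union> closure L)"
    using cell_shape[OF K] cell_shape[OF L(1)] cells_disjoint[OF K L(1)] ab in_L
    by (intro midpoint_interior_of_two_cells) auto
  also have "\<dots> \<subseteq> interior (closure \<Omega>)"
    using cells_cover K L by (intro interior_mono) auto
  also have "\<dots> = \<Omega>" using dom by (simp add: polygonal_domain_def)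
  finally have "midpoint a b \<in> \<Omega>" .
  moreover have "midpoint a b \<notin> \<Omega>"
    using ab(5) \<sigma>(2) dom by (auto simp: frontier_def polygonal_domain_def interior_open)
  ultimately show False by simp
qed

lemma transmissibility_positive:
  assumes K: "K \<in> cells M" and \<sigma>: "\<sigma> \<in> cell_edges M K"
  shows "0 < transmissibility M K \<sigma>"
proof -
  have "\<sigma> \<in> edges M" using cell_edges_subset[OF K] \<sigma> by blast
  have "0 < edge_dist M K \<sigma>"
  proof (cases "has_neighbour M K \<sigma>")
    case True
    then show ?thesis
      using neighbour_props[OF K \<sigma> True] centers_distinct[OF K _ \<open>\<sigma> \<in> edges M\<close>] by (simp add: edge_dist_def)
  next
    case False
    obtain \<xi> where \<xi>: "\<xi> > 0" "\<xi> * diameter K \<le> infdist (center M K) \<sigma>" using regularity K \<sigma> by blast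
    have "0 < diameter K"
    proof -
      obtain x where x: "x \<in> K" using cell_shape[OF K] by blast
      then obtain e where e: "e > 0" "cball x e \<subseteq> K"
        using cell_shape[OF K] open_contains_cball by blast
      define y where "y = x + e *\<^sub>R axis 1 1"
      have y: "dist x y = e" using e by (simp add: y_def dist_norm norm_axis_1)
      then have "y \<in> K" using e by auto
      then show ?thesis
        using diameter_bounded_bound[OF cell_bounded[OF K] x, of y] y e by linarith
    qed
    then have "0 < \<xi> * diameter K" using \<xi> by simp
    then show ?thesis using \<xi> False by (simp add: edge_dist_def)
  qed
  then show ?thesis
    using edge_length_pos edge_segment[OF \<open>\<sigma> \<in> edges M\<close>] by (auto simp: transmissibility_def)
qed

text \<open>The intersection is convex and covered by the edges of \<open>K\<close>. If it were uncountable, it would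
  contain two points of one edge, hence a segment of positive length.\<close>

lemma closures_meet_countably:
  assumes K: "K \<in> cells M" and L: "L \<in> cells M" "K \<noteq> L" and no: "\<And>\<sigma>. \<sigma> \<in> edges M \<Longrightarrow> \<not> common_edge K L \<sigma>"
  shows "countable (closure K \<inter> closure L)"
proof (rule ccontr)
  let ?S = "closure K \<inter> closure L"
  assume unc: "uncountable ?S"
  have zero: "emeasure (length_measure (edges M)) ?S = 0" using cells_meet[OF K L] no by blast
  have S: "?S \<in> sets borel" "convex ?S" using cell_shape K L by (auto intro!: convex_Int convex_closure)
  have "K \<inter> closure L = {}"
    using cells_disjoint[OF K L] cell_shape[OF K] open_Int_closure_eq_empty by blast
  then have "?S \<subseteq> frontier K" using cell_shape[OF K] by (auto simp: frontier_def interior_open)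
  then have "?S \<subseteq> (\<Union>\<sigma>\<in>cell_edges M K. ?S \<inter> closure \<sigma>)" using cell_frontier[OF K] by auto
  then obtain \<sigma> where \<sigma>: "\<sigma> \<in> cell_edges M K" "uncountable (?S \<inter> closure \<sigma>)"
    using unc by (meson cell_finite_edges[OF K] countable_UN countable_finite countable_subset)
  obtain a b where ab: "segment_ends \<sigma> a b" using cell_edge_ends[OF K \<sigma>(1)] by metis
  obtain p where p: "p \<in> ?S \<inter> closure \<sigma>" using \<sigma>(2) by (metis countable_empty ex_in_conv)
  have "\<not> ?S \<inter> closure \<sigma> \<subseteq> {p}" using \<sigma>(2) by (meson countable_empty countable_insert countable_subset)
  then obtain q where "q \<in> ?S \<inter> closure \<sigma>" "q \<noteq> p" by auto
  then have "0 < emeasure (segment_measure \<sigma>) ?S"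
    using p S by (intro segment_measure_subsegment_pos[OF ab]) auto
  also have "\<dots> \<le> emeasure (length_measure (edges M)) ?S"
    using segment_measure_le_length_measure[OF edges_finite, of \<sigma>] cell_edges_subset[OF K] \<sigma>(1)
    by (auto simp: le_measure le_fun_def)
  finally show False using zero by simp
qed

text \<open>An edge in \<open>\<Gamma>\<^sub>N\<close> does not contribute to the length of \<open>\<Gamma>\<^sub>D\<close>; its end points may belong to
  \<open>\<Gamma>\<^sub>D\<close>, but they have length zero.\<close>

lemma dirichlet_edge_exists: "\<exists>\<sigma>. \<sigma> \<in> dirichlet_edges \<Omega> \<Gamma>D M"
proof -
  have fin: "finite (ext_edges \<Omega> M)" using edges_finite by (simp add: ext_edges_def)
  have meas: "\<Gamma>D \<in> sets borel"
    using dirichlet_pos emeasure_notin_sets[of \<Gamma>D "boundary_measure \<Omega> M"]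
    by (fastforce simp: boundary_measure_def)
  have "(\<Sum>\<sigma>\<in>ext_edges \<Omega> M. emeasure (segment_measure \<sigma>) \<Gamma>D) \<noteq> 0"
    using dirichlet_pos emeasure_length_measure[OF meas] by (simp add: boundary_measure_def)
  then obtain \<sigma> where \<sigma>: "\<sigma> \<in> ext_edges \<Omega> M" "emeasure (segment_measure \<sigma>) \<Gamma>D \<noteq> 0"
    by (meson sum.neutral)
  have "\<not> \<sigma> \<subseteq> \<Gamma>N"
  proof
    assume N: "\<sigma> \<subseteq> \<Gamma>N"
    obtain a b where ab: "segment_ends \<sigma> a b" using edge_segment[of \<sigma>] \<sigma>(1) unfolding ext_edges_def by blast
    have "AE x in segment_measure \<sigma>. x \<notin> \<Gamma>D"
      using AE_segment_measure_in[OF ab] by eventually_elim (use N parts_disjoint in auto)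
    then have "emeasure (segment_measure \<sigma>) \<Gamma>D = 0"
      using meas by (subst (asm) AE_iff_measurable[of \<Gamma>D]) auto
    with \<sigma> show False by simp
  qed
  then show ?thesis using ext_split \<sigma> by (auto simp: dirichlet_edges_def)
qed

definition steps :: "(point set \<times> point set) set" where
  "steps = {(K, L). K \<in> cells M \<and> (\<exists>\<sigma>\<in>cell_edges M K. has_neighbour M K \<sigma> \<and> neighbour M K \<sigma> = L)}"

definition dirichlet_cells :: "point set set" where
  "dirichlet_cells = {K\<in>cells M. \<exists>\<sigma>\<in>cell_edges M K. \<sigma> \<in> dirichlet_edges \<Omega> \<Gamma>D M}"

lemma common_edge_step:
  assumes K: "K \<in> cells M" and L: "L \<in> cells M" and \<sigma>: "\<sigma> \<in> edges M" "common_edge K L \<sigma>"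
  shows "(K, L) \<in> steps"
proof -
  have "K \<inter> closure L = {}"
    using cells_disjoint[OF K L] cell_shape[OF K] \<sigma>(2) open_Int_closure_eq_empty
    unfolding common_edge_def by blast
  then have "closure \<sigma> \<subseteq> frontier K"
    using \<sigma>(2) cell_shape[OF K] by (auto simp: frontier_def interior_open common_edge_def)
  then have "\<sigma> \<in> cell_edges M K" by (rule edge_in_frontier_imp_cell_edge[OF K \<sigma>(1)])
  then show ?thesis
    using neighbour_eq[OF K _ L \<sigma>(2)] K L \<sigma>(2) by (auto simp: steps_def has_neighbour_def)
qed

text \<open>If some cells had no connection to the Dirichlet boundary, their closures would meet those of
  the other cells in countably many points only. Without these points \<open>\<Omega>\<close> is still connected, but
  it would be split by the two closed unions.\<close>

lemma cells_connected_to_dirichlet: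
  assumes "K \<in> cells M"
  shows "\<exists>L\<in>dirichlet_cells. (K, L) \<in> steps\<^sup>*"
proof (rule ccontr)
  define A where "A = {K\<in>cells M. \<exists>L\<in>dirichlet_cells. (K, L) \<in> steps\<^sup>*}"
  define B where "B = cells M - A"
  assume "\<not> (\<exists>L\<in>dirichlet_cells. (K, L) \<in> steps\<^sup>*)"
  then have K: "K \<in> B" using assms by (simp add: A_def B_def)
  obtain K\<^sub>0 where "K\<^sub>0 \<in> dirichlet_cells"
    using dirichlet_edge_exists edges_eq by (fastforce simp: dirichlet_cells_def dirichlet_edges_def ext_edges_def)
  then have K0: "K\<^sub>0 \<in> A" by (auto simp: A_def dirichlet_cells_def)
  define T where "T = (\<Union>L\<in>B. \<Union>K\<in>A. closure L \<inter> closure K)"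
  have fin: "finite A" "finite B" using cells_finite by (auto simp: A_def B_def)
  have no_edge: "\<not> common_edge L K \<sigma>" if "L \<in> B" "K \<in> A" "\<sigma> \<in> edges M" for L K \<sigma>
  proof
    assume "common_edge L K \<sigma>"
    then have "(L, K) \<in> steps" using that by (intro common_edge_step[OF _ _ that(3)]) (auto simp: A_def B_def)
    then have "L \<in> A" using that by (auto simp: A_def B_def intro: converse_rtrancl_into_rtrancl)
    then show False using that by (simp add: B_def)
  qed
  have "countable T"
  proof -
    have "countable (closure L \<inter> closure K)" if "L \<in> B" "K \<in> A" for L K
      using no_edge[OF that] that by (intro closures_meet_countably) (auto simp: A_def B_def)
    then show ?thesis unfolding T_def
      by (intro countable_UN countable_finite[OF fin(1)] countable_finite[OF fin(2)])
  qed
  have "connected (\<Omega> - T)"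
    using dom \<open>countable T\<close> by (intro connected_open_diff_countable) (auto simp: polygonal_domain_def)
  moreover have "closed (\<Union>K\<in>A. closure K)" "closed (\<Union>K\<in>B. closure K)"
    using fin by (auto intro: closed_UN)
  moreover have "\<Omega> - T \<subseteq> (\<Union>K\<in>A. closure K) \<union> (\<Union>K\<in>B. closure K)"
  proof -
    have "cells M = A \<union> B" by (auto simp: A_def B_def)
    then show ?thesis using cells_cover closure_subset[of \<Omega>] by auto
  qed
  moreover have "(\<Union>K\<in>A. closure K) \<inter> (\<Union>K\<in>B. closure K) \<inter> (\<Omega> - T) = {}"
    by (auto simp: T_def)
  moreover have meets: "closure L \<inter> (\<Omega> - T) \<noteq> {}" if L: "L \<in> cells M" for L
  proof -
    obtain x e where "x \<in> L" "e > 0" "ball x e \<subseteq> L"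
      using cell_shape[OF L] open_contains_ball by blast
    then have "uncountable L" using uncountable_ball countable_subset by blast
    then have "\<not> L \<subseteq> T" using \<open>countable T\<close> countable_subset by blast
    then show ?thesis using cell_shape[OF L] closure_subset[of L] by blast
  qed
  have "K \<in> cells M" "K\<^sub>0 \<in> cells M" using K K0 by (simp_all add: A_def B_def)
  then have "(\<Union>K\<in>A. closure K) \<inter> (\<Omega> - T) \<noteq> {}" "(\<Union>K\<in>B. closure K) \<inter> (\<Omega> - T) \<noteq> {}"
    using meets[of K] meets[of K\<^sub>0] K K0 by blast+
  ultimately show False
    unfolding connected_closed by (metis (no_types, lifting))
qed

lemma rank_exists:
  "\<exists>rank :: point set \<Rightarrow> nat. \<forall>K\<in>cells M. \<exists>\<sigma>\<in>cell_edges M K.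
     (has_neighbour M K \<sigma> \<and> rank (neighbour M K \<sigma>) < rank K) \<or>
     (\<not> has_neighbour M K \<sigma> \<and> \<sigma> \<in> dirichlet_edges \<Omega> \<Gamma>D M)"
proof (intro exI ballI)
  define rank where "rank K = (LEAST n. \<exists>L\<in>dirichlet_cells. (K, L) \<in> steps ^^ n)" for K
  fix K assume K: "K \<in> cells M"
  have "\<exists>n. \<exists>L\<in>dirichlet_cells. (K, L) \<in> steps ^^ n"
    using cells_connected_to_dirichlet[OF K] rtrancl_power by blast
  then have "\<exists>L\<in>dirichlet_cells. (K, L) \<in> steps ^^ rank K"
    unfolding rank_def by (rule LeastI_ex)
  then obtain L where L: "L \<in> dirichlet_cells" "(K, L) \<in> steps ^^ rank K" by blast
  show "\<exists>\<sigma>\<in>cell_edges M K. (has_neighbour M K \<sigma> \<and> rank (neighbour M K \<sigma>) < rank K) \<or>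
     (\<not> has_neighbour M K \<sigma> \<and> \<sigma> \<in> dirichlet_edges \<Omega> \<Gamma>D M)"
  proof (cases "rank K")
    case 0
    then obtain \<sigma> where \<sigma>: "\<sigma> \<in> cell_edges M K" "\<sigma> \<in> dirichlet_edges \<Omega> \<Gamma>D M"
      using L by (auto simp: dirichlet_cells_def)
    then show ?thesis
      using exterior_edge_no_neighbour[OF K \<sigma>(1)] by (auto simp: dirichlet_edges_def ext_edges_def)
  next
    case (Suc n)
    then obtain K' where K': "(K, K') \<in> steps" "(K', L) \<in> steps ^^ n"
      using L(2) relpow_Suc_D2 by metis
    have "rank K' \<le> n" unfolding rank_def by (rule Least_le) (use L K' in blast)
    moreover obtain \<sigma> where "\<sigma> \<in> cell_edges M K" "has_neighbour M K \<sigma>" "neighbour M K \<sigma> = K'"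
      using K'(1) by (auto simp: steps_def)
    ultimately show ?thesis using Suc by (intro bexI[of _ \<sigma>]) auto
  qed
qed

end

section \<open>Traces of bounded functions\<close>

lemma lborel_point_eq_pair:
  "(lborel :: point measure) = distr (lborel \<Otimes>\<^sub>M lborel) borel (\<lambda>(x, y). x *\<^sub>R axis 1 1 + y *\<^sub>R axis 2 1)"
proof (rule lborel_eqI)
  fix l u :: point assume le: "\<And>b. b \<in> Basis \<Longrightarrow> l \<bullet> b \<le> u \<bullet> b"
  let ?T = "\<lambda>(x, y). x *\<^sub>R axis 1 1 + y *\<^sub>R axis 2 (1::real) :: point"
  have basis: "Basis = {axis 1 1, axis 2 1 :: point}"
    by (auto simp: Basis_vec_def UNIV_2)
  have ne: "axis 1 1 \<noteq> (axis 2 1 :: point)" by (simp add: axis_eq_axis)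
  have le': "l $ 1 \<le> u $ 1" "l $ 2 \<le> u $ 2"
    using le[of "axis 1 1"] le[of "axis 2 1"] by (simp_all add: basis inner_axis)
  have T [measurable]: "?T \<in> borel_measurable (lborel \<Otimes>\<^sub>M lborel)" by measurable
  have comp: "axis 1 (1::real) $ (1::2) = 1" "axis 1 (1::real) $ (2::2) = 0"
    "axis 2 (1::real) $ (1::2) = 0" "axis 2 (1::real) $ (2::2) = 1" by (simp_all add: axis_def)
  have "?T -` box l u = {l $ 1<..<u $ 1} \<times> {l $ 2<..<u $ 2}"
    by (auto simp: box_def basis inner_axis comp)
  then have "emeasure (distr (lborel \<Otimes>\<^sub>M lborel) borel ?T) (box l u) =
      emeasure (lborel \<Otimes>\<^sub>M lborel) ({l $ 1<..<u $ 1} \<times> {l $ 2<..<u $ 2})"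
    by (subst emeasure_distr) (auto simp: space_pair_measure)
  also have "\<dots> = emeasure lborel {l $ 1<..<u $ 1} * emeasure lborel {l $ 2<..<u $ 2}"
    by (rule lborel.emeasure_pair_measure_Times) auto
  also have "\<dots> = ennreal (\<Prod>b\<in>Basis. (u - l) \<bullet> b)"
    using le' ne by (simp add: basis inner_axis ennreal_mult)
  finally show "emeasure (distr (lborel \<Otimes>\<^sub>M lborel) borel ?T) (box l u) = ennreal (\<Prod>b\<in>Basis. (u - l) \<bullet> b)" .
qed simp

lemma nn_integral_point:
  fixes f :: "point \<Rightarrow> ennreal"
  assumes [measurable]: "f \<in> borel_measurable borel"
  shows "(\<integral>\<^sup>+x. f x \<partial>lborel) = (\<integral>\<^sup>+x. \<integral>\<^sup>+y. f (x *\<^sub>R axis 1 1 + y *\<^sub>R axis 2 1) \<partial>lborel \<partial>lborel)"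
  by (subst lborel_point_eq_pair, subst nn_integral_distr)
     (simp_all add: lborel.nn_integral_fst[symmetric])

lemma nn_integral_swap:
  assumes "(\<lambda>(x, y). f x y) \<in> borel_measurable (lborel \<Otimes>\<^sub>M lborel)"
  shows "(\<integral>\<^sup>+x. \<integral>\<^sup>+y. f x y \<partial>lborel \<partial>lborel) = (\<integral>\<^sup>+y. \<integral>\<^sup>+x. (f x y :: ennreal) \<partial>(lborel :: real measure) \<partial>(lborel :: real measure))"
  using lborel_pair.Fubini[OF assms] by simp

text \<open>The substitution is carried out one variable at a time, the ordinate against \<open>t\<close> with the abscissa
  fixed and the abscissa against \<open>s\<close> with \<open>t\<close> fixed. The second step needs \<open>e $ 1 \<noteq> 0\<close>; if this
  fails, \<open>e\<close> and \<open>v\<close> exchange their roles.\<close>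

lemma nn_integral_oblique_aux:
  fixes f :: "point \<Rightarrow> ennreal" and a e v :: point
  assumes [measurable]: "f \<in> borel_measurable borel"
    and det: "e $ 1 * v $ 2 - e $ 2 * v $ 1 \<noteq> 0" and e1: "e $ 1 \<noteq> 0"
  shows "ennreal \<bar>e $ 1 * v $ 2 - e $ 2 * v $ 1\<bar> *
    (\<integral>\<^sup>+s. \<integral>\<^sup>+t. f (a + s *\<^sub>R e + t *\<^sub>R v) \<partial>lborel \<partial>lborel) = (\<integral>\<^sup>+x. f x \<partial>lborel)"
proof -
  define c where "c = v $ 2 - v $ 1 * e $ 2 / e $ 1"
  have c: "c \<noteq> 0" "\<bar>c\<bar> * \<bar>e $ 1\<bar> = \<bar>e $ 1 * v $ 2 - e $ 2 * v $ 1\<bar>"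
    using det e1 by (auto simp: c_def field_simps simp flip: abs_mult)
  define g where "g t x = f (x *\<^sub>R axis 1 1 + ((a $ 2 + (x - a $ 1) * e $ 2 / e $ 1) + c * t) *\<^sub>R axis 2 1)" for t x
  have [measurable]: "(\<lambda>(t, x). g t x) \<in> borel_measurable (lborel \<Otimes>\<^sub>M lborel)"
    "(\<lambda>x. g t x) \<in> borel_measurable borel" "(\<lambda>t. g t x) \<in> borel_measurable borel" for t x
    unfolding g_def by measurable
  have pt: "f (a + s *\<^sub>R e + t *\<^sub>R v) = g t ((a $ 1 + t * v $ 1) + e $ 1 * s)" for s t
  proof -
    have "a + s *\<^sub>R e + t *\<^sub>R v = (let x = (a $ 1 + t * v $ 1) + e $ 1 * s in
        x *\<^sub>R axis 1 1 + ((a $ 2 + (x - a $ 1) * e $ 2 / e $ 1) + c * t) *\<^sub>R axis 2 1)"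
      using e1 by (simp add: vec_eq_iff forall_2 axis_def Let_def c_def field_simps)
    then show ?thesis by (simp add: g_def Let_def)
  qed
  have "(\<integral>\<^sup>+x. f x \<partial>lborel) = (\<integral>\<^sup>+x. \<integral>\<^sup>+y. f (x *\<^sub>R axis 1 1 + y *\<^sub>R axis 2 1) \<partial>lborel \<partial>lborel)"
    by (rule nn_integral_point) measurable
  also have "\<dots> = (\<integral>\<^sup>+x. ennreal \<bar>c\<bar> * (\<integral>\<^sup>+t. g t x \<partial>lborel) \<partial>lborel)"
    unfolding g_def by (intro nn_integral_cong nn_integral_real_affine c) measurable
  also have "\<dots> = ennreal \<bar>c\<bar> * (\<integral>\<^sup>+x. \<integral>\<^sup>+t. g t x \<partial>lborel \<partial>lborel)"
    by (rule nn_integral_cmult) measurable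
  also have "(\<integral>\<^sup>+x. \<integral>\<^sup>+t. g t x \<partial>lborel \<partial>lborel) = (\<integral>\<^sup>+t. \<integral>\<^sup>+x. g t x \<partial>lborel \<partial>lborel)"
    by (rule nn_integral_swap) measurable
  also have "\<dots> = (\<integral>\<^sup>+t. ennreal \<bar>e $ 1\<bar> * (\<integral>\<^sup>+s. f (a + s *\<^sub>R e + t *\<^sub>R v) \<partial>lborel) \<partial>lborel)"
    unfolding pt by (intro nn_integral_cong nn_integral_real_affine e1) measurable
  also have "\<dots> = ennreal \<bar>e $ 1\<bar> * (\<integral>\<^sup>+t. \<integral>\<^sup>+s. f (a + s *\<^sub>R e + t *\<^sub>R v) \<partial>lborel \<partial>lborel)"
    by (rule nn_integral_cmult) measurable
  also have "(\<integral>\<^sup>+t. \<integral>\<^sup>+s. f (a + s *\<^sub>R e + t *\<^sub>R v) \<partial>lborel \<partial>lborel) =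
      (\<integral>\<^sup>+s. \<integral>\<^sup>+t. f (a + s *\<^sub>R e + t *\<^sub>R v) \<partial>lborel \<partial>lborel)"
    by (rule nn_integral_swap) measurable
  finally show ?thesis by (simp add: mult.assoc[symmetric] ennreal_mult[symmetric] c(2))
qed

lemma nn_integral_oblique:
  fixes f :: "point \<Rightarrow> ennreal" and a e v :: point
  assumes [measurable]: "f \<in> borel_measurable borel"
    and det: "e $ 1 * v $ 2 - e $ 2 * v $ 1 \<noteq> 0"
  shows "ennreal \<bar>e $ 1 * v $ 2 - e $ 2 * v $ 1\<bar> *
    (\<integral>\<^sup>+s. \<integral>\<^sup>+t. f (a + s *\<^sub>R e + t *\<^sub>R v) \<partial>lborel \<partial>lborel) = (\<integral>\<^sup>+x. f x \<partial>lborel)"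
proof (cases "e $ 1 = 0")
  case False
  then show ?thesis using nn_integral_oblique_aux[OF assms] by simp
next
  case True
  then have v: "v $ 1 \<noteq> 0" "v $ 1 * e $ 2 - v $ 2 * e $ 1 \<noteq> 0" using det by auto
  have "(\<integral>\<^sup>+s. \<integral>\<^sup>+t. f (a + s *\<^sub>R e + t *\<^sub>R v) \<partial>lborel \<partial>lborel) =
      (\<integral>\<^sup>+t. \<integral>\<^sup>+s. f (a + s *\<^sub>R e + t *\<^sub>R v) \<partial>lborel \<partial>lborel)"
    by (rule nn_integral_swap) measurable
  also have "\<dots> = (\<integral>\<^sup>+t. \<integral>\<^sup>+s. f (a + t *\<^sub>R v + s *\<^sub>R e) \<partial>lborel \<partial>lborel)"
    by (simp add: add.assoc add.left_commute add.commute)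
  finally have eq: "(\<integral>\<^sup>+s. \<integral>\<^sup>+t. f (a + s *\<^sub>R e + t *\<^sub>R v) \<partial>lborel \<partial>lborel) =
     (\<integral>\<^sup>+t. \<integral>\<^sup>+s. f (a + t *\<^sub>R v + s *\<^sub>R e) \<partial>lborel \<partial>lborel)" .
  have "\<bar>e $ 1 * v $ 2 - e $ 2 * v $ 1\<bar> = \<bar>v $ 1 * e $ 2 - v $ 2 * e $ 1\<bar>" by (simp add: abs_minus_commute mult.commute)
  then show ?thesis using nn_integral_oblique_aux[OF assms(1) v(2,1), of a] by (simp add: eq)
qed

lemma smooth_fun_grad:
  assumes "smooth_fun \<phi>"
  shows smooth_fun_has_derivative: "(\<phi> has_derivative (\<lambda>v. grad \<phi> x \<bullet> v)) (at x)"
    and smooth_fun_continuous: "continuous_on UNIV \<phi>"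
    and smooth_fun_continuous_grad: "continuous_on UNIV (grad \<phi>)"
proof -
  have "foldr partial_deriv [] \<phi> differentiable_on UNIV"
    using assms unfolding smooth_fun_def by blast
  then have d: "\<phi> differentiable_on UNIV" by simp
  then have "(\<phi> has_derivative frechet_derivative \<phi> (at x)) (at x)"
    by (simp add: differentiable_on_def frechet_derivative_works)
  moreover have "frechet_derivative \<phi> (at x) v = grad \<phi> x \<bullet> v" for v
  proof -
    have lin: "linear (frechet_derivative \<phi> (at x))"
      using calculation has_derivative_linear by blast
    have "v = v $ 1 *\<^sub>R axis 1 1 + v $ 2 *\<^sub>R axis 2 1"
      by (simp add: vec_eq_iff forall_2 axis_def)
    then have "frechet_derivative \<phi> (at x) v = frechet_derivative \<phi> (at x) (v $ 1 *\<^sub>R axis 1 1 + v $ 2 *\<^sub>R axis 2 1)"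
      by simp
    also have "\<dots> = grad \<phi> x \<bullet> v"
      by (simp add: linear_add[OF lin] linear_scale[OF lin] grad_def partial_deriv_def inner_vec_def sum_2 mult.commute)
    finally show ?thesis .
  qed
  ultimately show "(\<phi> has_derivative (\<lambda>v. grad \<phi> x \<bullet> v)) (at x)" by (metis (no_types, lifting) ext)
  show "continuous_on UNIV \<phi>" using d by (rule differentiable_imp_continuous_on)
  have "foldr partial_deriv [i] \<phi> differentiable_on UNIV" for i
    using assms unfolding smooth_fun_def by blast
  then have "continuous_on UNIV (partial_deriv i \<phi>)" for i
    using differentiable_imp_continuous_on by fastforce
  then show "continuous_on UNIV (grad \<phi>)"
    unfolding grad_def by (intro continuous_on_vec_lambda)
qed

text \<open>The integral extends over the fixed interval up to \<open>h\<close>, so that the bound is the same for all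
  \<open>t\<close> and can be averaged over \<open>t\<close>. The interval is open, because the end point \<open>y\<close> will be
  a boundary point.\<close>

lemma smooth_fun_increment:
  assumes \<phi>: "smooth_fun \<phi>" and t: "0 \<le> t" "t \<le> h"
  shows "ennreal \<bar>\<phi> (y + t *\<^sub>R v) - \<phi> y\<bar> \<le>
    ennreal (norm v) * (\<integral>\<^sup>+r. indicator {0<..<h} r * ennreal (norm (grad \<phi> (y + r *\<^sub>R v))) \<partial>lborel)"
proof -
  let ?g = "\<lambda>r. grad \<phi> (y + r *\<^sub>R v) \<bullet> v"
  have cont: "continuous_on S (\<lambda>r. grad \<phi> (y + r *\<^sub>R v))" for S
    by (rule continuous_on_compose2[OF smooth_fun_continuous_grad[OF \<phi>]]) (auto intro!: continuous_intros)
  then have [measurable]: "(\<lambda>r. grad \<phi> (y + r *\<^sub>R v)) \<in> borel_measurable borel"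
    using borel_measurable_continuous_onI by blast
  have "((\<lambda>r. \<phi> (y + r *\<^sub>R v)) has_real_derivative ?g r) (at r)" for r
  proof -
    have "((\<lambda>r. y + r *\<^sub>R v) has_derivative (\<lambda>d. d *\<^sub>R v)) (at r)"
      by (auto intro!: derivative_eq_intros)
    from has_derivative_compose[OF this smooth_fun_has_derivative[OF \<phi>]]
    show ?thesis by (simp add: has_field_derivative_def mult_commute_abs)
  qed
  then have "has_bochner_integral lborel (\<lambda>r. ?g r * indicator {0..t} r) (\<phi> (y + t *\<^sub>R v) - \<phi> (y + 0 *\<^sub>R v))"
    using t cont by (intro has_bochner_integral_FTC_Icc_real)
      (auto simp: continuous_on_eq_continuous_within[symmetric] intro!: continuous_intros DERIV_subset
        continuous_on_interior[of UNIV])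
  then have "ennreal (norm (\<phi> (y + t *\<^sub>R v) - \<phi> y)) \<le> (\<integral>\<^sup>+r. ennreal (norm (?g r * indicator {0..t} r)) \<partial>lborel)"
    using integral_norm_bound_ennreal[of lborel "\<lambda>r. ?g r * indicator {0..t} r"]
    by (simp add: has_bochner_integral_iff)
  also have "\<dots> \<le> (\<integral>\<^sup>+r. ennreal (norm v) * (indicator {0<..<h} r * ennreal (norm (grad \<phi> (y + r *\<^sub>R v)))) \<partial>lborel)"
  proof (rule nn_integral_mono_AE)
    have "AE r in lborel. r \<noteq> 0 \<and> r \<noteq> (h::real)"
      using AE_lborel_singleton[of "0::real"] AE_lborel_singleton[of h] by eventually_elim simp
    then show "AE r in lborel. ennreal (norm (?g r * indicator {0..t} r)) \<le>
       ennreal (norm v) * (indicator {0<..<h} r * ennreal (norm (grad \<phi> (y + r *\<^sub>R v))))"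
    proof eventually_elim
      case (elim r)
      have "norm (?g r) \<le> norm v * norm (grad \<phi> (y + r *\<^sub>R v))"
        using Cauchy_Schwarz_ineq2[of "grad \<phi> (y + r *\<^sub>R v)" v] by (simp add: mult.commute)
      then show ?case
        using elim t by (auto simp: indicator_def ennreal_mult[symmetric])
    qed
  qed
  also have "\<dots> = ennreal (norm v) * (\<integral>\<^sup>+r. indicator {0<..<h} r * ennreal (norm (grad \<phi> (y + r *\<^sub>R v))) \<partial>lborel)"
    by (rule nn_integral_cmult) measurable
  finally show ?thesis by simp
qed

text \<open>This replaces the Cauchy-Schwarz inequality in passing from \<open>L\<^sup>2\<close> to \<open>L\<^sup>1\<close> bounds on small sets.\<close>

lemma real_le_split: "0 < \<epsilon> \<Longrightarrow> x \<le> \<epsilon> + x\<^sup>2 / \<epsilon>" for x :: real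
proof -
  assume \<epsilon>: "0 < \<epsilon>"
  have "0 \<le> (x - \<epsilon>)\<^sup>2 + x * x + \<epsilon> * \<epsilon>" by simp
  then have "x * \<epsilon> \<le> \<epsilon> * \<epsilon> + x\<^sup>2" by (simp add: power2_eq_square algebra_simps)
  then show ?thesis using \<epsilon> by (simp add: field_simps power2_eq_square)
qed

lemma nn_integral_lebesgue_on:
  assumes "\<Omega> \<in> sets lebesgue"
  shows "(\<integral>\<^sup>+x. f x \<partial>lebesgue_on \<Omega>) = (\<integral>\<^sup>+x. indicator \<Omega> x * f x \<partial>lborel)"
  using assms by (simp add: nn_integral_restrict_space nn_integral_completion mult.commute)

text \<open>The length of the strip enters with the small factor \<open>\<epsilon>\<close> and the square integral of \<open>F\<close> with the
  large factor \<open>1 / \<epsilon>\<close>; the determinant is the Jacobian of the oblique coordinates.\<close>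

lemma strip_integral_le:
  fixes F :: "point \<Rightarrow> real"
  assumes [measurable]: "F \<in> borel_measurable borel" "K \<in> sets borel" and F: "\<And>x. 0 \<le> F x"
    and d: "e $ 1 * v $ 2 - e $ 2 * v $ 1 \<noteq> 0" and "0 < \<epsilon>" "0 \<le> h" "l \<le> l'"
    and strip: "\<And>s t. s \<in> {l..l'} \<Longrightarrow> t \<in> {0<..<h} \<Longrightarrow> a + s *\<^sub>R e + t *\<^sub>R v \<in> K"
    and N: "(\<integral>\<^sup>+x. indicator K x * ennreal ((F x)\<^sup>2) \<partial>lborel) \<le> ennreal N" "0 \<le> N"
  shows "(\<integral>\<^sup>+s. \<integral>\<^sup>+t. indicator {l..l'} s * indicator {0<..<h} t * ennreal (F (a + s *\<^sub>R e + t *\<^sub>R v)) \<partial>lborel \<partial>lborel)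
    \<le> ennreal (\<epsilon> * ((l' - l) * h) + N / (\<epsilon> * \<bar>e $ 1 * v $ 2 - e $ 2 * v $ 1\<bar>))"
proof -
  let ?d = "\<bar>e $ 1 * v $ 2 - e $ 2 * v $ 1\<bar>"
  define f where "f x = indicator K x * ennreal ((F x)\<^sup>2)" for x
  have [measurable]: "f \<in> borel_measurable borel" unfolding f_def by measurable
  have pos: "0 < ?d" using d by simp
  have "(\<integral>\<^sup>+s. \<integral>\<^sup>+t. indicator {l..l'} s * indicator {0<..<h} t * ennreal (F (a + s *\<^sub>R e + t *\<^sub>R v)) \<partial>lborel \<partial>lborel)
    \<le> (\<integral>\<^sup>+s. \<integral>\<^sup>+t. ennreal \<epsilon> * (indicator {l..l'} s * indicator {0<..<h} t)
        + ennreal (1 / \<epsilon>) * f (a + s *\<^sub>R e + t *\<^sub>R v) \<partial>lborel \<partial>lborel)"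
  proof (intro nn_integral_mono)
    fix s t :: real
    show "indicator {l..l'} s * indicator {0<..<h} t * ennreal (F (a + s *\<^sub>R e + t *\<^sub>R v))
      \<le> ennreal \<epsilon> * (indicator {l..l'} s * indicator {0<..<h} t) + ennreal (1 / \<epsilon>) * f (a + s *\<^sub>R e + t *\<^sub>R v)"
    proof (cases "s \<in> {l..l'} \<and> t \<in> {0<..<h}")
      case True
      then show ?thesis
        using strip[of s t] real_le_split[OF \<open>0 < \<epsilon>\<close>, of "F (a + s *\<^sub>R e + t *\<^sub>R v)"] \<open>0 < \<epsilon>\<close>
        by (simp add: f_def ennreal_mult[symmetric] ennreal_plus[symmetric] del: ennreal_plus)
    qed (auto simp: indicator_def)
  qed
  also have "\<dots> = ennreal \<epsilon> * (\<integral>\<^sup>+s. \<integral>\<^sup>+t. indicator {l..l'} s * indicator {0<..<h} t \<partial>lborel \<partial>lborel)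
      + ennreal (1 / \<epsilon>) * (\<integral>\<^sup>+s. \<integral>\<^sup>+t. f (a + s *\<^sub>R e + t *\<^sub>R v) \<partial>lborel \<partial>lborel)"
    by (simp add: nn_integral_add nn_integral_cmult)
  also have "(\<integral>\<^sup>+s. \<integral>\<^sup>+t. indicator {l..l'} s * indicator {0<..<h} t \<partial>lborel \<partial>lborel) = ennreal ((l' - l) * h)"
    using assms by (simp add: nn_integral_cmult nn_integral_multc ennreal_mult)
  also have "(\<integral>\<^sup>+s. \<integral>\<^sup>+t. f (a + s *\<^sub>R e + t *\<^sub>R v) \<partial>lborel \<partial>lborel) \<le> ennreal (N / ?d)"
  proof -
    let ?I = "\<integral>\<^sup>+s. \<integral>\<^sup>+t. f (a + s *\<^sub>R e + t *\<^sub>R v) \<partial>lborel \<partial>lborel"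
    have "?I = ennreal (1 / ?d) * (ennreal ?d * ?I)"
      using pos by (simp add: mult.assoc[symmetric] ennreal_mult[symmetric])
    also have "ennreal ?d * ?I = (\<integral>\<^sup>+x. f x \<partial>lborel)" by (rule nn_integral_oblique[OF _ d]) measurable
    also have "ennreal (1 / ?d) * (\<integral>\<^sup>+x. f x \<partial>lborel) \<le> ennreal (1 / ?d) * ennreal N"
      using N by (intro mult_left_mono) (auto simp: f_def)
    also have "\<dots> = ennreal (N / ?d)" using pos N by (simp add: ennreal_mult[symmetric])
    finally show ?thesis .
  qed
  finally show ?thesis
    using assms pos by (auto simp: ennreal_mult[symmetric] ennreal_plus[symmetric] mult_left_mono simp del: ennreal_plus
        elim!: order_trans intro!: add_left_mono)
qed

text \<open>With \<open>\<kappa> = 1\<close> and \<open>\<kappa> = -1\<close> this bounds the trace from above and from below. Let \<open>\<phi>\<close> be a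
  smooth function close to \<open>u\<close>, and \<open>w\<close> the positive part of \<open>\<kappa> \<phi> - c\<close>. On lines that enter \<open>K\<close>
  through the edge, \<open>w\<close> at the boundary point exceeds \<open>w\<close> at a point inside by at most the integral
  of \<open>|\<nabla>\<phi>|\<close>. Averaging over a parallelogram of width \<open>h\<close> above a part of the edge, which avoids
  the end points by \<open>\<delta>\<close>, bounds the integral of \<open>w\<close> along the edge by \<open>1/h\<close> times its integral
  over the parallelogram plus the integral of \<open>|\<nabla>\<phi>|\<close> over it. The first is small, for fixed \<open>h\<close>,
  as \<open>\<phi>\<close> approaches \<open>u\<close>, because \<open>\<kappa> u \<le> c\<close>; the second tends to 0 with \<open>h\<close>, because the
  gradients stay bounded in \<open>L\<^sup>2\<close>. Hence the positive part of \<open>\<kappa> g - c\<close> vanishes.\<close>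

lemma trace_le:
  fixes \<kappa> c :: real
  assumes \<sigma>: "segment_ends \<sigma> a\<^sub>0 b\<^sub>0" and K: "open K" "convex K" "K \<noteq> {}" "K \<subseteq> \<Omega>" and \<Omega>: "open \<Omega>"
    and \<sigma>K: "closure \<sigma> \<subseteq> closure K" "\<sigma> \<inter> K = {}"
    and \<mu>: "sets \<mu> = sets borel" "segment_measure \<sigma> \<le> \<mu>"
    and u: "u \<in> borel_measurable (lebesgue_on \<Omega>)" "AE x in lebesgue_on \<Omega>. \<kappa> * u x \<le> c" and \<kappa>: "\<bar>\<kappa>\<bar> = 1"
    and trace: "is_trace \<Omega> \<mu> u g"
  shows "AE x in segment_measure \<sigma>. \<kappa> * g x \<le> c"
proof -
  obtain a b where ab: "segment_ends \<sigma> a b" "segment_measure \<sigma> = distr (restrict_space lborel {0..dist a b}) borel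
               (\<lambda>t. a + (t / dist a b) *\<^sub>R (b - a))"
    by (rule segment_measure_parametrized[OF \<sigma>])
  define l where "l = dist a b"
  define e where "e = (1 / l) *\<^sub>R (b - a)"
  obtain x\<^sub>0 where x0: "x\<^sub>0 \<in> K" using K by blast
  define v where "v = x\<^sub>0 - midpoint a b"
  have ne: "a \<noteq> b" using ab(1) by (simp add: segment_ends_def)
  then have l: "0 < l" by (simp add: l_def)
  have ab_K: "a \<in> closure K" "b \<in> closure K" and mid: "midpoint a b \<notin> K"
    using \<sigma>K ab(1) segment_ends_closure[OF ab(1)] ne
    by (auto simp: segment_ends_def dest: subsetD[OF _ midpoint_in_open_segment[THEN iffD2]])
  have y_eq: "a + (s / dist a b) *\<^sub>R (b - a) = a + s *\<^sub>R e" for s by (simp add: e_def l_def)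
  have "l * (e $ 1 * v $ 2 - e $ 2 * v $ 1) = side a b x\<^sub>0"
    using l by (simp add: e_def v_def side_def midpoint_def field_simps)
  then have d: "e $ 1 * v $ 2 - e $ 2 * v $ 1 \<noteq> 0"
    using side_nonzero[OF K(2,1) ab_K ne mid x0] by auto
  define d where "d = \<bar>e $ 1 * v $ 2 - e $ 2 * v $ 1\<bar>"
  have d_pos: "0 < d" using d by (simp add: d_def)
  \<comment> \<open>In the triangle with vertices \<open>a\<close>, \<open>b\<close> and \<open>x\<^sub>0\<close> one may move from the point at \<open>s\<close> in the
    direction \<open>v\<close> as far as \<open>s\<close> is from the ends, up to a factor.\<close>
  have strip: "a + s *\<^sub>R e + t *\<^sub>R v \<in> K" if t: "0 < t" "t < 1" "t * l / 2 \<le> s" "s \<le> l - t * l / 2" for s t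
  proof -
    define r where "r = (s - t * l / 2) / (1 - t)"
    have "s - t * l / 2 \<le> l * (1 - t)" using t by (simp add: algebra_simps)
    then have "0 \<le> r" "r \<le> l" using t by (auto simp: r_def pos_divide_le_eq)
    then have "a + r *\<^sub>R e \<in> closed_segment a b"
      using segment_param_in(1)[of r a b] ne unfolding y_eq by (simp add: l_def)
    then have "a + r *\<^sub>R e \<in> closure K" using \<sigma>K(1) segment_ends_closure[OF ab(1)] by auto
    then have "(a + r *\<^sub>R e) - t *\<^sub>R ((a + r *\<^sub>R e) - x\<^sub>0) \<in> interior K"
      using K x0 t by (intro mem_interior_closure_convex_shrink) (auto simp: interior_open)
    moreover have "(a + r *\<^sub>R e) - t *\<^sub>R ((a + r *\<^sub>R e) - x\<^sub>0) = a + s *\<^sub>R e + t *\<^sub>R v"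
    proof -
      have "midpoint a b = a + (l / 2) *\<^sub>R e"
        using l by (simp add: midpoint_def e_def algebra_simps vec_eq_iff)
      moreover have "(1 - t) * r = s - t * l / 2" using t by (simp add: r_def)
      then have "r *\<^sub>R e - t *\<^sub>R (r *\<^sub>R e) = (s - t * l / 2) *\<^sub>R e"
        by (metis scaleR_left_diff_distrib scaleR_one scaleR_scaleR)
      ultimately show ?thesis by (simp add: v_def algebra_simps)
    qed
    ultimately show ?thesis using K by (simp add: interior_open)
  qed
  obtain G \<phi> where g2: "L2 \<mu> g" and G: "L2 (lebesgue_on \<Omega>) G" and \<phi>: "\<And>j. smooth_fun (\<phi> j)"
    and conv: "L2_tendsto (lebesgue_on \<Omega>) \<phi> u" "L2_tendsto (lebesgue_on \<Omega>) (\<lambda>j. grad (\<phi> j)) G" "L2_tendsto \<mu> \<phi> g"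
    using trace unfolding is_trace_def by blast
  have \<Omega>_sets: "\<Omega> \<in> sets lebesgue" using \<Omega> by (simp add: borel_open sets_completionI_sets)
  have \<phi>_borel [measurable]: "\<phi> j \<in> borel_measurable borel" for j
    using smooth_fun_continuous[OF \<phi>] by (rule borel_measurable_continuous_onI)
  have grad_borel [measurable]: "grad (\<phi> j) \<in> borel_measurable borel" for j
    using smooth_fun_continuous_grad[OF \<phi>] by (rule borel_measurable_continuous_onI)
  have g_borel [measurable]: "g \<in> borel_measurable borel"
    using g2 measurable_cong_sets[OF \<mu>(1) refl] by (auto simp: L2_def)
  have [measurable]: "K \<in> sets borel" using K by simp
  have lebesgue_on_borel: "f \<in> borel_measurable (lebesgue_on \<Omega>)" if "f \<in> borel_measurable borel"
    for f :: "point \<Rightarrow> 'b::topological_space"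
    using that by (intro measurable_restrict_space1 measurable_completion) simp
  have G_meas [measurable]: "G \<in> borel_measurable (lebesgue_on \<Omega>)" using G by (simp add: L2_def)
  define \<Gamma> where "\<Gamma> = (LINT x|lebesgue_on \<Omega>. (norm (G x))\<^sup>2)"
  have \<Gamma>: "(\<integral>\<^sup>+x. ennreal ((norm (G x))\<^sup>2) \<partial>lebesgue_on \<Omega>) = ennreal \<Gamma>" "0 \<le> \<Gamma>"
    using G unfolding L2_def \<Gamma>_def by (auto intro!: nn_integral_eq_integral)
  define w where "w j x = max (\<kappa> * \<phi> j x - c) 0" for j x
  have w_borel [measurable]: "w j \<in> borel_measurable borel" for j unfolding w_def by measurable
  have K_le: "(\<integral>\<^sup>+x. indicator K x * f x \<partial>lborel) \<le> (\<integral>\<^sup>+x. f x \<partial>lebesgue_on \<Omega>)" for f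
    unfolding nn_integral_lebesgue_on[OF \<Omega>_sets] using K(4)
    by (intro nn_integral_mono) (auto simp: indicator_def)
  define T where "T \<delta> = (\<integral>\<^sup>+s. indicator {\<delta>..l - \<delta>} s * ennreal (max (\<kappa> * g (a + s *\<^sub>R e) - c) 0) \<partial>lborel)" for \<delta>
  define Cst where "Cst = (l + 1) + norm v * (l + (2 + 2 * \<Gamma>) / d) + (l + 1)"
  define errU where "errU j = (\<integral>\<^sup>+x. ennreal ((norm (\<phi> j x - u x))\<^sup>2) \<partial>lebesgue_on \<Omega>)" for j
  define errG where "errG j = (\<integral>\<^sup>+x. ennreal ((norm (grad (\<phi> j) x - G x))\<^sup>2) \<partial>lebesgue_on \<Omega>)" for j
  define errT where "errT j = (\<integral>\<^sup>+x. ennreal ((norm (\<phi> j x - g x))\<^sup>2) \<partial>\<mu>)" for j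
  have bound: "T \<delta> \<le> ennreal (\<epsilon> * Cst)" if \<delta>: "0 < \<delta>" "2 * \<delta> \<le> l" and \<epsilon>: "0 < \<epsilon>" for \<delta> \<epsilon>
  proof -
    \<comment> \<open>The first two bounds keep the parallelogram in \<open>K\<close>; the third makes the gradient term, of order
      \<open>sqrt h\<close>, as small as \<open>\<epsilon>\<close>.\<close>
    define h where "h = Min {1 / 2, 2 * \<delta> / l, \<epsilon>\<^sup>2}"
    have h: "0 < h" "h \<le> 1 / 2" "h \<le> 2 * \<delta> / l" "h \<le> \<epsilon>\<^sup>2" using \<delta> \<epsilon> l by (auto simp: h_def)
    have h_eps: "h / \<epsilon> \<le> \<epsilon>" using h(4) \<epsilon> by (simp add: field_simps power2_eq_square)
    have "\<forall>\<^sub>F j in sequentially. errU j < ennreal (\<epsilon>\<^sup>2 * d * h) \<and>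
       errG j < ennreal 1 \<and>
       errT j < ennreal (\<epsilon>\<^sup>2)"
      using conv \<epsilon> d_pos h unfolding L2_tendsto_def errU_def errG_def errT_def
      by (intro eventually_conj order_tendstoD) auto
    then obtain j where A: "errU j < ennreal (\<epsilon>\<^sup>2 * d * h)"
      and B: "errG j < ennreal 1"
      and D: "errT j < ennreal (\<epsilon>\<^sup>2)"
      using eventually_happens'[OF sequentially_bot] by blast
    let ?z = "\<lambda>s t. a + s *\<^sub>R e + t *\<^sub>R v"
    have in_strip: "?z s t \<in> K" if "s \<in> {\<delta>..l - \<delta>}" "t \<in> {0<..<h}" for s t
    proof (rule strip)
      have "t * l \<le> 2 * \<delta>" using that h(3) l by (simp add: field_simps) (metis less_imp_le mult.commute order_trans mult_le_cancel_left_pos)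
      then show "t * l / 2 \<le> s" "s \<le> l - t * l / 2" using that by auto
    qed (use that h in auto)
    let ?S = "\<lambda>s t. indicator {\<delta>..l - \<delta>} s * indicator {0<..<h} t :: ennreal"
    let ?strip = "\<lambda>F. \<integral>\<^sup>+s. \<integral>\<^sup>+t. ?S s t * ennreal (F (?z s t)) \<partial>lborel \<partial>lborel"
    have X1: "?strip (w j) \<le> ennreal (h * (\<epsilon> * (l + 1)))"
    proof -
      have "(\<integral>\<^sup>+x. indicator K x * ennreal ((w j x)\<^sup>2) \<partial>lborel) \<le> (\<integral>\<^sup>+x. ennreal ((w j x)\<^sup>2) \<partial>lebesgue_on \<Omega>)"
        by (rule K_le)
      also have "\<dots> \<le> errU j"
        unfolding errU_def
      proof (rule nn_integral_mono_AE)
        show "AE x in lebesgue_on \<Omega>. ennreal ((w j x)\<^sup>2) \<le> ennreal ((norm (\<phi> j x - u x))\<^sup>2)"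
          using u(2)
        proof eventually_elim
          case (elim x)
          have "\<bar>\<kappa> * \<phi> j x - \<kappa> * u x\<bar> = \<bar>\<phi> j x - u x\<bar>"
            using \<kappa> by (simp add: abs_mult flip: right_diff_distrib)
          then have "w j x \<le> \<bar>\<phi> j x - u x\<bar>" using elim by (auto simp: w_def)
          moreover have "0 \<le> w j x" by (simp add: w_def)
          ultimately have "(w j x)\<^sup>2 \<le> \<bar>\<phi> j x - u x\<bar>\<^sup>2" by (rule power_mono)
          then show ?case by (intro ennreal_leI) simp
        qed
      qed
      also have "\<dots> \<le> ennreal (\<epsilon>\<^sup>2 * d * h)" using A by simp
      finally have "?strip (w j)
          \<le> ennreal (\<epsilon> * ((l - \<delta> - \<delta>) * h) + \<epsilon>\<^sup>2 * d * h / (\<epsilon> * \<bar>e $ 1 * v $ 2 - e $ 2 * v $ 1\<bar>))"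
        using \<epsilon> h \<delta> d_pos in_strip
        by (intro strip_integral_le[where K = K]) (auto simp: w_def d d_def)
      also have "\<dots> \<le> ennreal (h * (\<epsilon> * (l + 1)))"
      proof (rule ennreal_leI)
        have "\<epsilon>\<^sup>2 * d * h / (\<epsilon> * d) = h * \<epsilon>" using d_pos \<epsilon> by (simp add: power2_eq_square)
        moreover have "\<epsilon> * ((l - \<delta> - \<delta>) * h) \<le> \<epsilon> * (l * h)"
          using \<epsilon> \<delta> h by (intro mult_left_mono mult_right_mono) auto
        ultimately show "\<epsilon> * ((l - \<delta> - \<delta>) * h) + \<epsilon>\<^sup>2 * d * h / (\<epsilon> * \<bar>e $ 1 * v $ 2 - e $ 2 * v $ 1\<bar>) \<le> h * (\<epsilon> * (l + 1))"
          unfolding d_def[symmetric] by (simp add: algebra_simps)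
      qed
      finally show ?thesis .
    qed
    have X2: "?strip (\<lambda>x. norm (grad (\<phi> j) x))
        \<le> ennreal (\<epsilon> * (l + (2 + 2 * \<Gamma>) / d))"
    proof -
      have "(\<integral>\<^sup>+x. indicator K x * ennreal ((norm (grad (\<phi> j) x))\<^sup>2) \<partial>lborel) \<le> (\<integral>\<^sup>+x. ennreal ((norm (grad (\<phi> j) x))\<^sup>2) \<partial>lebesgue_on \<Omega>)"
        by (rule K_le)
      also have "\<dots> \<le> (\<integral>\<^sup>+x. ennreal 2 * ennreal ((norm (grad (\<phi> j) x - G x))\<^sup>2) + ennreal 2 * ennreal ((norm (G x))\<^sup>2) \<partial>lebesgue_on \<Omega>)"
      proof (rule nn_integral_mono)
        fix x
        have "norm (grad (\<phi> j) x) \<le> norm (grad (\<phi> j) x - G x) + norm (G x)"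
          using norm_triangle_ineq[of "grad (\<phi> j) x - G x" "G x"] by simp
        then have "(norm (grad (\<phi> j) x))\<^sup>2 \<le> (norm (grad (\<phi> j) x - G x) + norm (G x))\<^sup>2" by (rule power_mono) simp
        also have "\<dots> \<le> 2 * (norm (grad (\<phi> j) x - G x))\<^sup>2 + 2 * (norm (G x))\<^sup>2"
          using sum_squares_bound[of "norm (grad (\<phi> j) x - G x)" "norm (G x)"] by (simp add: power2_sum)
        finally have "ennreal ((norm (grad (\<phi> j) x))\<^sup>2) \<le>
            ennreal (2 * (norm (grad (\<phi> j) x - G x))\<^sup>2 + 2 * (norm (G x))\<^sup>2)" by (rule ennreal_leI)
        then show "ennreal ((norm (grad (\<phi> j) x))\<^sup>2) \<le> ennreal 2 * ennreal ((norm (grad (\<phi> j) x - G x))\<^sup>2) + ennreal 2 * ennreal ((norm (G x))\<^sup>2)"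
          by (simp add: ennreal_mult)
      qed
      also have "\<dots> = ennreal 2 * errG j + ennreal 2 * ennreal \<Gamma>"
        using lebesgue_on_borel[OF grad_borel[of j]] \<Gamma>(1)
        unfolding errG_def by (subst nn_integral_add) (auto simp: nn_integral_cmult)
      also have "\<dots> \<le> ennreal 2 * ennreal 1 + ennreal 2 * ennreal \<Gamma>"
        using B by (intro add_right_mono mult_left_mono) auto
      also have "\<dots> = ennreal (2 + 2 * \<Gamma>)"
        using \<Gamma>(2) by (simp add: ennreal_mult)
      finally have "?strip (\<lambda>x. norm (grad (\<phi> j) x))
          \<le> ennreal (1 / \<epsilon> * ((l - \<delta> - \<delta>) * h) + (2 + 2 * \<Gamma>) / (1 / \<epsilon> * \<bar>e $ 1 * v $ 2 - e $ 2 * v $ 1\<bar>))"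
        using \<epsilon> h \<delta> d in_strip \<Gamma>(2)
        by (intro strip_integral_le[where K = K]) auto
      also have "\<dots> \<le> ennreal (\<epsilon> * (l + (2 + 2 * \<Gamma>) / d))"
      proof (rule ennreal_leI)
        have "1 / \<epsilon> * ((l - \<delta> - \<delta>) * h) = (l - \<delta> - \<delta>) * (h / \<epsilon>)" by simp
        also have "\<dots> \<le> l * \<epsilon>" using h_eps \<delta> l h \<epsilon> by (intro mult_mono) auto
        finally show "1 / \<epsilon> * ((l - \<delta> - \<delta>) * h) + (2 + 2 * \<Gamma>) / (1 / \<epsilon> * \<bar>e $ 1 * v $ 2 - e $ 2 * v $ 1\<bar>) \<le> \<epsilon> * (l + (2 + 2 * \<Gamma>) / d)"
          unfolding d_def[symmetric] by (simp add: algebra_simps)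
      qed
      finally show ?thesis .
    qed
    define Tj where "Tj = (\<integral>\<^sup>+s. indicator {\<delta>..l - \<delta>} s * ennreal (w j (a + s *\<^sub>R e)) \<partial>lborel)"
    define Q where "Q s = (\<integral>\<^sup>+t. indicator {0<..<h} t * ennreal (norm (grad (\<phi> j) (?z s t))) \<partial>lborel)" for s
    have [measurable]: "Q \<in> borel_measurable borel" unfolding Q_def by measurable
    have inner: "(\<integral>\<^sup>+t. ?S s t * X \<partial>lborel) = ennreal h * (indicator {\<delta>..l - \<delta>} s * X)" for s X
    proof -
      have "(\<integral>\<^sup>+t. ?S s t * X \<partial>lborel) = (\<integral>\<^sup>+t. (indicator {\<delta>..l - \<delta>} s * X) * indicator {0<..<h} t \<partial>lborel)"
        by (simp add: mult_ac)
      also have "\<dots> = (indicator {\<delta>..l - \<delta>} s * X) * (\<integral>\<^sup>+t. indicator {0<..<h} t \<partial>lborel)"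
        by (rule nn_integral_cmult) measurable
      finally show ?thesis using h by (simp add: mult.commute)
    qed
    have "ennreal h * Tj = (\<integral>\<^sup>+s. \<integral>\<^sup>+t. ?S s t * ennreal (w j (a + s *\<^sub>R e)) \<partial>lborel \<partial>lborel)"
      unfolding Tj_def inner by (rule nn_integral_cmult[symmetric]) measurable
    also have "\<dots> \<le> (\<integral>\<^sup>+s. \<integral>\<^sup>+t. ?S s t * ennreal (w j (?z s t)) + ?S s t * (ennreal (norm v) * Q s) \<partial>lborel \<partial>lborel)"
    proof (intro nn_integral_mono)
      fix s t :: real
      show "?S s t * ennreal (w j (a + s *\<^sub>R e)) \<le> ?S s t * ennreal (w j (?z s t)) + ?S s t * (ennreal (norm v) * Q s)"
      proof (cases "t \<in> {0<..<h}")
        case True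
        let ?y = "a + s *\<^sub>R e"
        have "\<bar>\<kappa> * \<phi> j (?y + t *\<^sub>R v) - \<kappa> * \<phi> j ?y\<bar> = \<bar>\<phi> j (?y + t *\<^sub>R v) - \<phi> j ?y\<bar>"
          using \<kappa> by (simp add: abs_mult flip: right_diff_distrib)
        then have "w j ?y \<le> w j (?y + t *\<^sub>R v) + \<bar>\<phi> j (?y + t *\<^sub>R v) - \<phi> j ?y\<bar>" by (auto simp: w_def)
        then have "ennreal (w j ?y) \<le> ennreal (w j (?y + t *\<^sub>R v)) + ennreal \<bar>\<phi> j (?y + t *\<^sub>R v) - \<phi> j ?y\<bar>"
          by (simp add: w_def ennreal_plus[symmetric] del: ennreal_plus)
        also have "\<dots> \<le> ennreal (w j (?y + t *\<^sub>R v)) + ennreal (norm v) * Q s"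
          unfolding Q_def using True by (intro add_left_mono smooth_fun_increment[OF \<phi>]) auto
        finally show ?thesis by (simp add: distrib_left[symmetric] mult_left_mono)
      qed simp
    qed
    also have "\<dots> = (\<integral>\<^sup>+s. (\<integral>\<^sup>+t. ?S s t * ennreal (w j (?z s t)) \<partial>lborel)
        + ennreal h * (ennreal (norm v) * (indicator {\<delta>..l - \<delta>} s * Q s)) \<partial>lborel)"
    proof (rule nn_integral_cong)
      fix s
      have "(\<integral>\<^sup>+t. ?S s t * ennreal (w j (?z s t)) + ?S s t * (ennreal (norm v) * Q s) \<partial>lborel) =
         (\<integral>\<^sup>+t. ?S s t * ennreal (w j (?z s t)) \<partial>lborel) + (\<integral>\<^sup>+t. ?S s t * (ennreal (norm v) * Q s) \<partial>lborel)"
        by (rule nn_integral_add) measurable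
      then show "(\<integral>\<^sup>+t. ?S s t * ennreal (w j (?z s t)) + ?S s t * (ennreal (norm v) * Q s) \<partial>lborel) =
         (\<integral>\<^sup>+t. ?S s t * ennreal (w j (?z s t)) \<partial>lborel)
           + ennreal h * (ennreal (norm v) * (indicator {\<delta>..l - \<delta>} s * Q s))"
        unfolding inner by (simp only: mult.left_commute)
    qed
    also have "\<dots> = ?strip (w j)
        + ennreal h * (ennreal (norm v) * (\<integral>\<^sup>+s. indicator {\<delta>..l - \<delta>} s * Q s \<partial>lborel))"
      by (simp add: nn_integral_add nn_integral_cmult)
    also have "(\<integral>\<^sup>+s. indicator {\<delta>..l - \<delta>} s * Q s \<partial>lborel) =
        ?strip (\<lambda>x. norm (grad (\<phi> j) x))"
      unfolding Q_def mult.assoc by (intro nn_integral_cong nn_integral_cmult[symmetric]) measurable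
    also have "?strip (w j)
        + ennreal h * (ennreal (norm v) * ?strip (\<lambda>x. norm (grad (\<phi> j) x)))
        \<le> ennreal (h * (\<epsilon> * (l + 1))) + ennreal h * (ennreal (norm v) * ennreal (\<epsilon> * (l + (2 + 2 * \<Gamma>) / d)))"
      by (intro add_mono mult_left_mono X1 X2) auto
    also have "\<dots> = ennreal h * ennreal (\<epsilon> * (l + 1) + norm v * (\<epsilon> * (l + (2 + 2 * \<Gamma>) / d)))"
      using h \<epsilon> l \<Gamma>(2) d_pos
      by (simp add: ennreal_mult[symmetric] ennreal_plus[symmetric] distrib_left del: ennreal_plus)
    finally have Tj: "Tj \<le> ennreal (\<epsilon> * (l + 1) + norm v * (\<epsilon> * (l + (2 + 2 * \<Gamma>) / d)))"
      using h by (simp add: ennreal_mult_le_mult_iff)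
    have "T \<delta> \<le> (\<integral>\<^sup>+s. indicator {\<delta>..l - \<delta>} s * ennreal (w j (a + s *\<^sub>R e)) +
         (ennreal \<epsilon> * indicator {\<delta>..l - \<delta>} s + ennreal (1 / \<epsilon>) * (indicator {0..l} s * ennreal ((norm (\<phi> j (a + s *\<^sub>R e) - g (a + s *\<^sub>R e)))\<^sup>2))) \<partial>lborel)"
      unfolding T_def
    proof (rule nn_integral_mono)
      fix s
      let ?y = "a + s *\<^sub>R e"
      show "indicator {\<delta>..l - \<delta>} s * ennreal (max (\<kappa> * g ?y - c) 0) \<le> indicator {\<delta>..l - \<delta>} s * ennreal (w j ?y) +
         (ennreal \<epsilon> * indicator {\<delta>..l - \<delta>} s + ennreal (1 / \<epsilon>) * (indicator {0..l} s * ennreal ((norm (\<phi> j ?y - g ?y))\<^sup>2)))"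
      proof (cases "s \<in> {\<delta>..l - \<delta>}")
        case True
        have "\<bar>\<kappa> * \<phi> j ?y - \<kappa> * g ?y\<bar> = \<bar>\<phi> j ?y - g ?y\<bar>"
          using \<kappa> by (simp add: abs_mult flip: right_diff_distrib)
        then have "max (\<kappa> * g ?y - c) 0 \<le> w j ?y + \<bar>\<phi> j ?y - g ?y\<bar>" by (auto simp: w_def)
        also have "\<dots> \<le> w j ?y + (\<epsilon> + 1 / \<epsilon> * (\<bar>\<phi> j ?y - g ?y\<bar>)\<^sup>2)"
          using real_le_split[OF \<epsilon>, of "\<bar>\<phi> j ?y - g ?y\<bar>"] by simp
        finally show ?thesis using True \<delta> \<epsilon>
          by (simp add: w_def ennreal_mult[symmetric] ennreal_plus[symmetric] del: ennreal_plus)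
      qed simp
    qed
    also have "\<dots> = Tj + (ennreal \<epsilon> * ennreal (l - \<delta> - \<delta>) + ennreal (1 / \<epsilon>) *
         (\<integral>\<^sup>+s. indicator {0..l} s * ennreal ((norm (\<phi> j (a + s *\<^sub>R e) - g (a + s *\<^sub>R e)))\<^sup>2) \<partial>lborel))"
      using \<delta> by (simp add: Tj_def nn_integral_add nn_integral_cmult)
    also have "(\<integral>\<^sup>+s. indicator {0..l} s * ennreal ((norm (\<phi> j (a + s *\<^sub>R e) - g (a + s *\<^sub>R e)))\<^sup>2) \<partial>lborel) =
       (\<integral>\<^sup>+x. ennreal ((norm (\<phi> j x - g x))\<^sup>2) \<partial>segment_measure \<sigma>)"
      unfolding ab(2) by (subst nn_integral_distr)
        (simp_all add: y_eq measurable_segment_param[of a b, unfolded y_eq] nn_integral_restrict_space l_def mult.commute)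
    also have "Tj + (ennreal \<epsilon> * ennreal (l - \<delta> - \<delta>) + ennreal (1 / \<epsilon>) *
         (\<integral>\<^sup>+x. ennreal ((norm (\<phi> j x - g x))\<^sup>2) \<partial>segment_measure \<sigma>)) \<le>
       ennreal (\<epsilon> * (l + 1) + norm v * (\<epsilon> * (l + (2 + 2 * \<Gamma>) / d))) + (ennreal \<epsilon> * ennreal l + ennreal (1 / \<epsilon>) * ennreal (\<epsilon>\<^sup>2))"
    proof (intro add_mono mult_left_mono Tj)
      have "(\<integral>\<^sup>+x. ennreal ((norm (\<phi> j x - g x))\<^sup>2) \<partial>segment_measure \<sigma>) \<le> errT j"
        unfolding errT_def by (rule nn_integral_mono_measure) (use \<mu> in auto)
      then show "(\<integral>\<^sup>+x. ennreal ((norm (\<phi> j x - g x))\<^sup>2) \<partial>segment_measure \<sigma>) \<le> ennreal (\<epsilon>\<^sup>2)"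
        using D by auto
    qed (use \<delta> in \<open>auto intro: ennreal_leI\<close>)
    also have "\<dots> = ennreal (\<epsilon> * Cst)"
      using \<epsilon> l \<Gamma>(2) d_pos
      by (simp add: Cst_def ennreal_mult[symmetric] ennreal_plus[symmetric] power2_eq_square algebra_simps del: ennreal_plus)
    finally show ?thesis .
  qed
  have T0: "T \<delta> = 0" if \<delta>: "0 < \<delta>" "2 * \<delta> \<le> l" for \<delta>
  proof (rule ccontr)
    assume "T \<delta> \<noteq> 0"
    moreover have "T \<delta> < \<infinity>" using bound[OF \<delta>, of 1] by (simp add: le_less_trans)
    ultimately obtain r where r: "T \<delta> = ennreal r" "0 < r" by (cases "T \<delta>") (auto simp: less_le)
    have Cst: "0 \<le> Cst" using l \<Gamma>(2) d_pos by (simp add: Cst_def)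
    have "ennreal r \<le> ennreal (r / (2 * (Cst + 1)) * Cst)"
      using bound[OF \<delta>, of "r / (2 * (Cst + 1))"] r Cst by simp
    then have "r \<le> r / (2 * (Cst + 1)) * Cst" using r Cst by (simp add: ennreal_le_iff2)
    then have "r * (Cst + 2) \<le> 0" using Cst by (simp add: field_simps)
    moreover have "0 < r * (Cst + 2)" using r Cst by (intro mult_pos_pos) auto
    ultimately show False by simp
  qed
  have AE\<delta>: "AE s in lborel. s \<in> {\<delta>..l - \<delta>} \<longrightarrow> \<kappa> * g (a + s *\<^sub>R e) \<le> c" if \<delta>: "0 < \<delta>" "2 * \<delta> \<le> l" for \<delta>
  proof -
    have "AE s in lborel. indicator {\<delta>..l - \<delta>} s * ennreal (max (\<kappa> * g (a + s *\<^sub>R e) - c) 0) = 0"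
      using T0[OF \<delta>] unfolding T_def by (subst (asm) nn_integral_0_iff_AE) auto
    then show ?thesis by eventually_elim (auto simp: indicator_def split: if_splits)
  qed
  have "AE s in lborel. \<forall>n::nat. s \<in> {l / (2 + n)..l - l / (2 + n)} \<longrightarrow> \<kappa> * g (a + s *\<^sub>R e) \<le> c"
    unfolding AE_all_countable using l by (intro allI AE\<delta>) (auto simp: field_simps)
  moreover have "AE s in lborel. s \<noteq> 0 \<and> s \<noteq> l"
    using AE_lborel_singleton[of "0::real"] AE_lborel_singleton[of l] by eventually_elim simp
  ultimately have "AE s in lborel. s \<in> {0..l} \<longrightarrow> \<kappa> * g (a + s *\<^sub>R e) \<le> c"
  proof eventually_elim
    case (elim s)
    show ?case
    proof
      assume "s \<in> {0..l}"
      define \<rho> where "\<rho> = min s (l - s)"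
      with elim \<open>s \<in> {0..l}\<close> have \<rho>: "0 < \<rho>" "\<rho> \<le> s" "\<rho> \<le> l - s" by auto
      then obtain n :: nat where "l / \<rho> < real n" using reals_Archimedean2 by blast
      then have "l < real n * \<rho>" using \<rho> by (simp add: pos_divide_less_eq)
      also have "\<dots> \<le> (2 + real n) * \<rho>" using \<rho> by (intro mult_right_mono) auto
      finally have "l / (2 + n) \<le> \<rho>" by (simp add: pos_divide_le_eq mult.commute)
      then have "s \<in> {l / (2 + n)..l - l / (2 + n)}" using \<rho> by simp
      then show "\<kappa> * g (a + s *\<^sub>R e) \<le> c" using elim by auto
    qed
  qed
  then have "AE s in restrict_space lborel {0..l}. \<kappa> * g (a + s *\<^sub>R e) \<le> c"
    by (subst AE_restrict_space_iff) auto
  then have AE: "AE s in restrict_space lborel {0..dist a b}. \<kappa> * g (a + (s / dist a b) *\<^sub>R (b - a)) \<le> c"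
    unfolding y_eq unfolding l_def[symmetric] .
  have "{x \<in> space borel. \<kappa> * g x \<le> c} \<in> sets borel" by measurable
  with AE show ?thesis
    unfolding ab(2) by (subst AE_distr_iff[OF measurable_segment_param])
qed

section \<open>Essential suprema and averages of the data\<close>

text \<open>The bound on \<open>f\<close> and the positive total measure make the extended real supremum finite; otherwise
  its conversion to a real number would yield 0.\<close>

lemma ess_sup_AE:
  assumes f: "f \<in> borel_measurable \<mu>" "AE x in \<mu>. \<bar>f x\<bar> \<le> c" and \<mu>: "emeasure \<mu> (space \<mu>) \<noteq> 0"
  shows "AE x in \<mu>. f x \<le> ess_sup \<mu> f"
proof -
  let ?E = "esssup \<mu> (\<lambda>x. ereal (f x))"
  have upper: "?E \<le> ereal c"
    by (rule esssup_I) (use f in auto)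
  have "ereal (- c) = esssup \<mu> (\<lambda>x. ereal (- c))" by (rule esssup_const[symmetric]) fact
  also have "\<dots> \<le> ?E" by (rule esssup_AE_mono) (use f in auto)
  finally obtain r where r: "?E = ereal r" using upper by (cases ?E) auto
  have "AE x in \<mu>. ereal (f x) \<le> ?E" by (rule esssup_AE)
  then show ?thesis unfolding ess_sup_def r by simp
qed

lemma AE_lower_bound_nonneg:
  fixes c :: real
  assumes "AE x in \<mu>. 0 \<le> f x" "AE x in \<mu>. f x \<le> c" "emeasure \<mu> (space \<mu>) \<noteq> 0"
  shows "0 \<le> c"
proof (rule ccontr)
  assume "\<not> 0 \<le> c"
  moreover have "AE x in \<mu>. 0 \<le> c" using assms(1,2) by eventually_elim (rule order_trans)
  ultimately have "AE x in \<mu>. False" by simp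
  then show False using assms(3) by (simp add: eventually_False ae_filter_eq_bot_iff)
qed

locale cell_of_domain =
  fixes \<Omega> K :: "point set"
  assumes \<Omega>: "open \<Omega>" and K: "open K" "bounded K" "K \<noteq> {}" "K \<subseteq> \<Omega>"
begin

lemma cell_sets: "K \<in> sets lebesgue" "\<Omega> \<in> sets lebesgue" "K \<in> lmeasurable"
proof -
  show "K \<in> lmeasurable" by (rule lmeasurable_open[OF K(2,1)])
  then show "K \<in> sets lebesgue" by (rule fmeasurableD)
  show "\<Omega> \<in> sets lebesgue" by (intro sets_completionI_sets) (simp add: borel_open[OF \<Omega>])
qed

lemma cell_measurable:
  "f \<in> borel_measurable (lebesgue_on \<Omega>) \<Longrightarrow> f \<in> borel_measurable (lebesgue_on K)"
  by (rule measurable_restrict_mono[OF _ K(4)])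

lemma cell_AE: "AE x in lebesgue_on \<Omega>. P x \<Longrightarrow> AE x in lebesgue_on K. P x"
  using cell_sets K by (auto simp: AE_restrict_space_iff elim: eventually_mono)

lemma cell_integrable:
  fixes f :: "point \<Rightarrow> 'a::{banach, second_countable_topology}"
  assumes "Linf \<Omega> f"
  shows "integrable (lebesgue_on K) f"
proof -
  obtain c where c: "AE x in lebesgue_on \<Omega>. norm (f x) \<le> c" and f: "f \<in> borel_measurable (lebesgue_on \<Omega>)"
    using assms by (auto simp: Linf_def)
  interpret finite_measure "lebesgue_on K" using cell_sets by (intro finite_measure_lebesgue_on)
  show ?thesis by (rule integrable_const_bound[OF cell_AE[OF c] cell_measurable[OF f]])
qed

lemma cell_avg_linear:
  fixes f :: "point \<Rightarrow> 'a::{banach, second_countable_topology}" and T :: "'a \<Rightarrow> 'b::{banach, second_countable_topology}"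
  assumes "bounded_linear T" "Linf \<Omega> f"
  shows "cell_avg K (\<lambda>x. T (f x)) = T (cell_avg K f)"
  unfolding cell_avg_def integral_bounded_linear[OF assms(1) cell_integrable[OF assms(2)]]
  by (simp add: linear_scale[OF bounded_linear.linear[OF assms(1)]])

lemma cell_avg_add:
  fixes f g :: "point \<Rightarrow> 'a::{banach, second_countable_topology}"
  assumes "Linf \<Omega> f" "Linf \<Omega> g"
  shows "cell_avg K (\<lambda>x. f x + g x) = cell_avg K f + cell_avg K g"
  using cell_integrable[OF assms(1)] cell_integrable[OF assms(2)]
  by (simp add: cell_avg_def scaleR_add_right)

lemma cell_avg_le:
  fixes f :: "point \<Rightarrow> real"
  assumes f: "integrable (lebesgue_on K) f" "AE x in lebesgue_on \<Omega>. f x \<le> c"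
  shows "cell_avg K f \<le> c"
proof -
  interpret finite_measure "lebesgue_on K" using cell_sets by (intro finite_measure_lebesgue_on)
  have pos: "0 < measure lebesgue K" using K by (intro bounded_open_measure_pos)
  have "(LINT x|lebesgue_on K. f x) \<le> (LINT x|lebesgue_on K. c)"
    by (rule integral_mono_AE[OF f(1) _ cell_AE[OF f(2)]]) simp
  also have "\<dots> = c * measure lebesgue K"
    using cell_sets by (simp add: measure_restrict_space)
  finally show ?thesis using pos by (simp add: cell_avg_def pos_divide_le_eq mult.commute)
qed

lemma cell_avg_nonneg:
  fixes f :: "point \<Rightarrow> real"
  assumes f: "integrable (lebesgue_on K) f" "AE x in lebesgue_on \<Omega>. 0 \<le> f x"
  shows "0 \<le> cell_avg K f"
proof -
  have "AE x in lebesgue_on \<Omega>. - f x \<le> 0" using f(2) by eventually_elim simp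
  then have "cell_avg K (\<lambda>x. - f x) \<le> 0" using f(1) by (intro cell_avg_le) auto
  then show ?thesis by (simp add: cell_avg_def)
qed

lemma norm_cell_avg_le:
  fixes f :: "point \<Rightarrow> 'a::{banach, second_countable_topology}"
  assumes f: "Linf \<Omega> f" "AE x in lebesgue_on \<Omega>. norm (f x) \<le> c"
  shows "norm (cell_avg K f) \<le> c"
proof -
  have "norm (cell_avg K f) \<le> cell_avg K (\<lambda>x. norm (f x))"
    by (simp add: cell_avg_def divide_right_mono)
  also have "\<dots> \<le> c" using cell_integrable[OF f(1)] f(2) by (intro cell_avg_le) auto
  finally show ?thesis .
qed

end

lemma edge_avg_bounds:
  assumes \<sigma>: "segment_ends \<sigma> a b" and g: "g \<in> borel_measurable borel"
    and bd: "AE x in segment_measure \<sigma>. 0 \<le> g x" "AE x in segment_measure \<sigma>. g x \<le> c"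
  shows "0 \<le> edge_avg \<sigma> g" "edge_avg \<sigma> g \<le> c"
proof -
  interpret finite_measure "segment_measure \<sigma>"
    using segment_measure_finite[OF \<sigma>, of UNIV] by (intro finite_measureI) auto
  have len: "0 < edge_length \<sigma>" by (rule edge_length_pos[OF \<sigma>])
  have total: "measure (segment_measure \<sigma>) UNIV = edge_length \<sigma>"
    using emeasure_segment_measure_self[OF \<sigma>] by (simp add: edge_length_def measure_def)
  have "AE x in segment_measure \<sigma>. norm (g x) \<le> c"
    using bd by eventually_elim auto
  then have int: "integrable (segment_measure \<sigma>) g"
    using g by (intro integrable_const_bound[where B = c]) auto
  have "0 \<le> (LINT x|segment_measure \<sigma>. g x)" using bd by (intro integral_nonneg_AE)
  then show "0 \<le> edge_avg \<sigma> g" using len by (simp add: edge_avg_def)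
  have "(LINT x|segment_measure \<sigma>. g x) \<le> (LINT x|segment_measure \<sigma>. c)"
    using int bd by (intro integral_mono_AE) auto
  also have "\<dots> = c * edge_length \<sigma>" using total by simp
  finally show "edge_avg \<sigma> g \<le> c" using len by (simp add: edge_avg_def pos_divide_le_eq mult.commute)
qed

context domain_mesh
begin

lemma grounded: "grounded_mesh M (dirichlet_edges \<Omega> \<Gamma>D M)"
proof
  fix K assume K: "K \<in> cells M"
  show "0 < measure lebesgue K" using cell_shape[OF K] cell_bounded[OF K] by (intro bounded_open_measure_pos) auto
qed (use cells_finite cell_finite_edges neighbour_props transmissibility_positive rank_exists in auto)

lemma ext_edge_cell:
  assumes "\<sigma> \<in> ext_edges \<Omega> M"
  obtains K a b where "K \<in> cells M" "\<sigma> \<in> cell_edges M K" "segment_ends \<sigma> a b"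
    "closure \<sigma> \<subseteq> closure K" "\<sigma> \<inter> K = {}"
proof -
  have "\<sigma> \<in> edges M" using assms by (simp add: ext_edges_def)
  then obtain K where K: "K \<in> cells M" "\<sigma> \<in> cell_edges M K" using edges_eq by auto
  obtain a b where ab: "segment_ends \<sigma> a b" using cell_edge_ends[OF K] by metis
  have "closure \<sigma> \<subseteq> frontier K" using cell_frontier[OF K(1)] K(2) by auto
  then have "closure \<sigma> \<subseteq> closure K" "\<sigma> \<inter> K = {}"
    using closure_subset[of \<sigma>] cell_shape[OF K(1)] by (auto simp: frontier_def interior_open)
  then show ?thesis using that K ab by blast
qed

lemma trace_AE_le:
  fixes \<kappa> c :: real
  assumes trace: "is_trace \<Omega> (boundary_measure \<Omega> M) u g"
    and u: "u \<in> borel_measurable (lebesgue_on \<Omega>)" "AE x in lebesgue_on \<Omega>. \<kappa> * u x \<le> c" and \<kappa>: "\<bar>\<kappa>\<bar> = 1"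
  shows "AE x in boundary_measure \<Omega> M. \<kappa> * g x \<le> c"
proof -
  have fin: "finite (ext_edges \<Omega> M)" using edges_finite by (simp add: ext_edges_def)
  have "g \<in> borel_measurable (boundary_measure \<Omega> M)" using trace by (simp add: is_trace_def L2_def)
  then have [measurable]: "g \<in> borel_measurable borel"
    by (simp add: boundary_measure_def cong: measurable_cong_sets)
  have "AE x in segment_measure \<sigma>. \<kappa> * g x \<le> c" if \<sigma>: "\<sigma> \<in> ext_edges \<Omega> M" for \<sigma>
  proof -
    obtain K a b where K: "K \<in> cells M" and ab: "segment_ends \<sigma> a b"
      and in_K: "closure \<sigma> \<subseteq> closure K" "\<sigma> \<inter> K = {}"
      by (rule ext_edge_cell[OF \<sigma>])
    show ?thesis
      by (rule trace_le[OF ab _ _ _ _ _ in_K _ _ u \<kappa> trace])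
        (use cell_shape[OF K] dom segment_measure_le_length_measure[OF fin \<sigma>] in
          \<open>auto simp: polygonal_domain_def boundary_measure_def\<close>)
  qed
  then show ?thesis
    unfolding boundary_measure_def by (subst AE_length_measure_iff[OF fin]) auto
qed

lemma boundary_AE_edge:
  assumes "\<sigma> \<in> ext_edges \<Omega> M" "AE x in boundary_measure \<Omega> M. P x" "{x. P x} \<in> sets borel"
  shows "AE x in segment_measure \<sigma>. P x"
proof -
  have fin: "finite (ext_edges \<Omega> M)" using edges_finite by (simp add: ext_edges_def)
  show ?thesis
    using assms(2) unfolding boundary_measure_def AE_length_measure_iff[OF fin assms(3)]
    by (rule bspec[OF _ assms(1)])
qed

end

lemma Linf_bounded_linear:
  assumes "bounded_linear T" "Linf \<Omega> f"
  shows "Linf \<Omega> (\<lambda>x. T (f x))"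
proof -
  obtain c where f: "f \<in> borel_measurable (lebesgue_on \<Omega>)" and c: "AE x in lebesgue_on \<Omega>. norm (f x) \<le> c"
    using assms(2) by (auto simp: Linf_def)
  obtain B where B: "0 \<le> B" "\<And>x. norm (T x) \<le> norm x * B"
    using bounded_linear.nonneg_bounded[OF assms(1)] by blast
  have "AE x in lebesgue_on \<Omega>. norm (T (f x)) \<le> c * B"
    using c
  proof eventually_elim
    case (elim x)
    then show ?case using B(2)[of "f x"] mult_right_mono[OF elim B(1)] by linarith
  qed
  moreover have "(\<lambda>x. T (f x)) \<in> borel_measurable (lebesgue_on \<Omega>)"
    using f borel_measurable_continuous_onI[OF linear_continuous_on[OF assms(1)]] by (rule measurable_compose)
  ultimately show ?thesis by (auto simp: Linf_def)
qed

section \<open>Existence and bounds for all time steps\<close>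

theorem theorem1:
  fixes \<Omega> \<Gamma>D \<Gamma>N :: "point set" and M :: mesh
    and D p \<eta> \<gamma> \<tau> lD dt \<alpha> M0 :: real and m :: "real^3"
    and C n00 nD VD nD_trace VD_trace :: "point \<Rightarrow> real" and nvec0 nperp0 :: "point \<Rightarrow> real^3"
  assumes "polygonal_domain \<Omega>"
    and "frontier \<Omega> = \<Gamma>D \<union> \<Gamma>N" and "\<Gamma>D \<inter> \<Gamma>N = {}"
    and "openin (top_of_set (frontier \<Omega>)) \<Gamma>N"
    and "admissible_mesh \<Omega> M"
    and "\<forall>\<sigma>\<in>ext_edges \<Omega> M. \<sigma> \<subseteq> \<Gamma>D \<or> \<sigma> \<subseteq> \<Gamma>N"
    and "emeasure (boundary_measure \<Omega> M) \<Gamma>D > 0"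
    and "D > 0" and "0 \<le> p" and "p < 1" and "norm m = 1" and "\<eta> = sqrt (1 - p\<^sup>2)"
    and "\<gamma> > 0" and "\<tau> > 0" and "lD > 0" and "dt > 0"
    and "Linf \<Omega> C" and "Linf \<Omega> n00" and "Linf \<Omega> nvec0" and "Linf \<Omega> nD"
    and "AE x in lebesgue_on \<Omega>. 0 \<le> n00 x / 2 + nvec0 x \<bullet> m \<and> 0 \<le> n00 x / 2 - nvec0 x \<bullet> m"
    and "AE x in lebesgue_on \<Omega>. 0 \<le> nD x"
    and "H1 \<Omega> nD" and "H1 \<Omega> VD"
    and "is_trace \<Omega> (boundary_measure \<Omega> M) nD nD_trace"
    and "is_trace \<Omega> (boundary_measure \<Omega> M) VD VD_trace"
    and "\<alpha> = D * (1 + p) * Linf_norm \<Omega> C / lD\<^sup>2"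
    and "Linf_norm \<Omega> C \<noteq> 0 \<Longrightarrow> dt < 1 / \<alpha>"
    and "Linf_norm \<Omega> C \<noteq> 0 \<Longrightarrow> \<tau> \<le> \<eta> * lD\<^sup>2 / (D * Linf_norm \<Omega> C)"
    and "nperp0 = (\<lambda>x. nvec0 x - (nvec0 x \<bullet> m) *\<^sub>R m)"
    and "M0 = Max {ess_sup (boundary_measure \<Omega> M) nD_trace / 2,
                   ess_sup (lebesgue_on \<Omega>) (\<lambda>x. n00 x / 2 + \<bar>nvec0 x \<bullet> m\<bar>),
                   ess_sup (lebesgue_on \<Omega>) (\<lambda>x. norm (nperp0 x)),
                   ess_sup (lebesgue_on \<Omega>) C}"
  shows "\<exists>(n0 :: nat \<Rightarrow> point set \<Rightarrow> real) (n :: nat \<Rightarrow> point set \<Rightarrow> real^3) (V :: nat \<Rightarrow> point set \<Rightarrow> real).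
           (\<forall>K\<in>cells M. n0 0 K = cell_avg K n00 \<and> n 0 K = cell_avg K nvec0) \<and>
           (\<forall>k\<ge>1.
              scheme_step M (dirichlet_edges \<Omega> \<Gamma>D M) D p m \<gamma> \<tau> lD dt C nD_trace VD_trace
                (n0 (k - 1)) (n (k - 1)) (n0 k) (n k) (V k) \<and>
              (\<forall>K\<in>cells M.
                 0 \<le> n0 k K \<and> n0 k K \<le> 2 * M0 \<and>
                 0 \<le> n0 k K / 2 + n k K \<bullet> m \<and> n0 k K / 2 + n k K \<bullet> m \<le> M0 \<and>
                 0 \<le> n0 k K / 2 - n k K \<bullet> m \<and> n0 k K / 2 - n k K \<bullet> m \<le> M0 \<and>
                 norm (n k K) \<le> 2 * (M0 * (1 - \<alpha> * dt) powi (- int k))))"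
proof -
  note [simp] = assms(12)
  interpret domain_mesh \<Omega> \<Gamma>D \<Gamma>N M by unfold_locales fact+
  let ?ED = "dirichlet_edges \<Omega> \<Gamma>D M" and ?\<mu> = "boundary_measure \<Omega> M"
  interpret grounded_mesh M ?ED by (rule grounded)
  have \<Omega>: "open \<Omega>" "bounded \<Omega>" "\<Omega> \<noteq> {}" using assms(1) by (auto simp: polygonal_domain_def)
  have \<Omega>_sets: "\<Omega> \<in> sets lebesgue" using \<Omega> by (simp add: borel_open sets_completionI_sets)
  have \<Omega>_pos: "emeasure (lebesgue_on \<Omega>) (space (lebesgue_on \<Omega>)) \<noteq> 0"
    using bounded_open_measure_pos[OF \<Omega>] \<Omega>_sets by (auto simp: emeasure_restrict_space measure_def space_restrict_space)
  have \<mu>_pos: "emeasure ?\<mu> (space ?\<mu>) \<noteq> 0"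
    using assms(7) emeasure_space[of ?\<mu> \<Gamma>D] by auto
  have cell: "cell_of_domain \<Omega> K" if "K \<in> cells M" for K
    using cell_shape[OF that] cell_bounded[OF that] \<Omega> by unfold_locales auto
  have max_ge: "ess_sup ?\<mu> nD_trace / 2 \<le> M0"
      "ess_sup (lebesgue_on \<Omega>) (\<lambda>x. n00 x / 2 + \<bar>nvec0 x \<bullet> m\<bar>) \<le> M0"
      "ess_sup (lebesgue_on \<Omega>) (\<lambda>x. norm (nperp0 x)) \<le> M0" "ess_sup (lebesgue_on \<Omega>) C \<le> M0"
    unfolding assms(31) by (rule Max_ge; simp)+
  have AE_Linf: "AE x in lebesgue_on \<Omega>. f x \<le> ess_sup (lebesgue_on \<Omega>) f" if "Linf \<Omega> f" for f
  proof -
    obtain c where f: "f \<in> borel_measurable (lebesgue_on \<Omega>)" "AE x in lebesgue_on \<Omega>. \<bar>f x\<bar> \<le> c"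
      using \<open>Linf \<Omega> f\<close> unfolding Linf_def real_norm_def by blast
    then show ?thesis by (rule ess_sup_AE[OF _ _ \<Omega>_pos])
  qed
  have lin_m: "bounded_linear (\<lambda>x. x \<bullet> m)" "bounded_linear (\<lambda>x. - (x \<bullet> m))"
    "bounded_linear (\<lambda>x. x - (x \<bullet> m) *\<^sub>R m)" "bounded_linear (\<lambda>x::real. x / 2)"
    by (intro linear_conv_bounded_linear[THEN iffD1] linearI;
        simp add: inner_add_left algebra_simps add_divide_distrib)+
  have Linf_m: "Linf \<Omega> (\<lambda>x. n00 x / 2)" "Linf \<Omega> (\<lambda>x. nvec0 x \<bullet> m)" "Linf \<Omega> (\<lambda>x. - (nvec0 x \<bullet> m))"
    "Linf \<Omega> nperp0"
    unfolding assms(30) using assms(18,19) lin_m by (auto intro: Linf_bounded_linear)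
  have Linf_add: "Linf \<Omega> (\<lambda>x. f x + g x)" if "Linf \<Omega> f" "Linf \<Omega> g" for f g :: "point \<Rightarrow> real"
  proof -
    obtain c c' where "AE x in lebesgue_on \<Omega>. norm (f x) \<le> c" "AE x in lebesgue_on \<Omega>. norm (g x) \<le> c'"
      using \<open>Linf \<Omega> f\<close> \<open>Linf \<Omega> g\<close> by (auto simp: Linf_def)
    then have "AE x in lebesgue_on \<Omega>. norm (f x + g x) \<le> c + c'" by eventually_elim (use norm_triangle_mono in auto)
    then show ?thesis using \<open>Linf \<Omega> f\<close> \<open>Linf \<Omega> g\<close> by (auto simp: Linf_def)
  qed
  have Linf_norm': "Linf \<Omega> (\<lambda>x. norm (f x))" if "Linf \<Omega> f" for f :: "point \<Rightarrow> 'b::{real_normed_vector, second_countable_topology}"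
    using that by (auto simp: Linf_def)

  define c\<^sub>0 where "c\<^sub>0 = Linf_norm \<Omega> C"
  have AE_absC: "AE x in lebesgue_on \<Omega>. \<bar>C x\<bar> \<le> c\<^sub>0"
    using AE_Linf[OF Linf_norm'[OF assms(17)]] by (simp add: c\<^sub>0_def Linf_norm_def)
  have c0: "0 \<le> c\<^sub>0" by (rule AE_lower_bound_nonneg[OF _ AE_absC \<Omega>_pos]) simp
  have C_avg: "cell_avg K C \<le> M0" "cell_avg K C \<le> c\<^sub>0" if K: "K \<in> cells M" for K
  proof -
    interpret cell_of_domain \<Omega> K by (rule cell[OF K])
    have "AE x in lebesgue_on \<Omega>. C x \<le> M0"
      using AE_Linf[OF assms(17)] by eventually_elim (use max_ge(4) in auto)
    moreover have "AE x in lebesgue_on \<Omega>. C x \<le> c\<^sub>0" using AE_absC by eventually_elim auto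
    ultimately show "cell_avg K C \<le> M0" "cell_avg K C \<le> c\<^sub>0"
      using cell_avg_le[OF cell_integrable[OF assms(17)]] by auto
  qed
  have \<eta>: "0 < \<eta>" using assms(9,10) by (simp add: power_less_one_iff)
  \<comment> \<open>If \<open>C = 0\<close> almost everywhere, there is no bound on \<open>\<tau>\<close>, but the left-hand side is at most 0.\<close>
  have relax: "D / sqrt (1 - p\<^sup>2) * cell_avg K C / lD\<^sup>2 \<le> 1 / \<tau>" if K: "K \<in> cells M" for K
  proof -
    have "D / \<eta> * cell_avg K C / lD\<^sup>2 \<le> D / \<eta> * c\<^sub>0 / lD\<^sup>2"
      using C_avg(2)[OF K] assms(8) \<eta> by (intro divide_right_mono mult_left_mono) auto
    also have "\<dots> \<le> 1 / \<tau>"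
    proof (cases "c\<^sub>0 = 0")
      case False
      then have "\<tau> \<le> \<eta> * lD\<^sup>2 / (D * c\<^sub>0)" using assms(29) by (simp add: c\<^sub>0_def)
      then have "\<tau> * (D * c\<^sub>0) \<le> \<eta> * lD\<^sup>2" using False c0 assms(8) by (simp add: pos_le_divide_eq)
      then show ?thesis using \<eta> assms(14,15) by (simp add: field_simps)
    qed (use assms(14) in simp)
    finally show ?thesis by simp
  qed

  \<comment> \<open>The trace has to be bounded before its essential supremum says anything about it.\<close>
  have trace_meas: "nD_trace \<in> borel_measurable ?\<mu>" using assms(25) by (simp add: is_trace_def L2_def)
  then have trace_borel [measurable]: "nD_trace \<in> borel_measurable borel"
    by (simp add: boundary_measure_def cong: measurable_cong_sets)
  obtain c\<^sub>D where cD: "AE x in lebesgue_on \<Omega>. norm (nD x) \<le> c\<^sub>D" and nD: "nD \<in> borel_measurable (lebesgue_on \<Omega>)"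
    using assms(20) by (auto simp: Linf_def)
  have "AE x in lebesgue_on \<Omega>. 1 * nD x \<le> c\<^sub>D" using cD by eventually_elim auto
  then have tr_le: "AE x in ?\<mu>. 1 * nD_trace x \<le> c\<^sub>D" by (intro trace_AE_le[OF assms(25) nD]) auto
  have "AE x in lebesgue_on \<Omega>. - 1 * nD x \<le> 0" using assms(22) by eventually_elim auto
  then have "AE x in ?\<mu>. - 1 * nD_trace x \<le> 0" by (intro trace_AE_le[OF assms(25) nD]) auto
  then have tr_nonneg: "AE x in ?\<mu>. 0 \<le> nD_trace x" by eventually_elim auto
  have "AE x in ?\<mu>. \<bar>nD_trace x\<bar> \<le> c\<^sub>D" using tr_le tr_nonneg by eventually_elim auto
  then have "AE x in ?\<mu>. nD_trace x \<le> ess_sup ?\<mu> nD_trace" by (rule ess_sup_AE[OF trace_meas _ \<mu>_pos])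
  then have tr_M0: "AE x in ?\<mu>. nD_trace x \<le> 2 * M0" by eventually_elim (use max_ge(1) in linarith)
  have bd: "0 \<le> edge_avg \<sigma> nD_trace / 2 \<and> edge_avg \<sigma> nD_trace / 2 \<le> M0" if "\<sigma> \<in> ?ED" for \<sigma>
  proof -
    have \<sigma>: "\<sigma> \<in> ext_edges \<Omega> M" using that by (simp add: dirichlet_edges_def)
    obtain a b where ab: "segment_ends \<sigma> a b" using ext_edge_cell[OF \<sigma>] by metis
    have "AE x in segment_measure \<sigma>. 0 \<le> nD_trace x" "AE x in segment_measure \<sigma>. nD_trace x \<le> 2 * M0"
      by (rule boundary_AE_edge[OF \<sigma>]; use tr_nonneg tr_M0 in simp)+
    then show ?thesis using edge_avg_bounds[OF ab trace_borel] by fastforce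
  qed

  have AE_perp: "AE x in lebesgue_on \<Omega>. norm (nperp0 x) \<le> M0"
    using AE_Linf[OF Linf_norm'[OF Linf_m(4)]] by eventually_elim (use max_ge(3) in auto)
  have M0: "0 \<le> M0" by (rule AE_lower_bound_nonneg[OF _ AE_perp \<Omega>_pos]) simp
  have AE_long: "AE x in lebesgue_on \<Omega>. n00 x / 2 + \<bar>nvec0 x \<bullet> m\<bar> \<le> M0"
    using AE_Linf[OF Linf_add[OF Linf_m(1) Linf_norm'[OF Linf_m(2)]]] by eventually_elim (use max_ge(2) in auto)
  \<comment> \<open>States are triples of charge density, spin density and potential; the invariant does not mention
    the potential, whose initial value is a dummy.\<close>
  define Inv where "Inv s \<longleftrightarrow> (\<forall>K\<in>cells M. 0 \<le> fst s K / 2 + fst (snd s) K \<bullet> m \<and> fst s K / 2 + fst (snd s) K \<bullet> m \<le> M0 \<and>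
      0 \<le> fst s K / 2 - fst (snd s) K \<bullet> m \<and> fst s K / 2 - fst (snd s) K \<bullet> m \<le> M0 \<and>
      norm (fst (snd s) K - (fst (snd s) K \<bullet> m) *\<^sub>R m) \<le> M0)"
    for s :: "(point set \<Rightarrow> real) \<times> (point set \<Rightarrow> real^3) \<times> (point set \<Rightarrow> real)"
  define Step where "Step s s' \<longleftrightarrow> scheme_step M ?ED D p m \<gamma> \<tau> lD dt C nD_trace VD_trace
      (fst s) (fst (snd s)) (fst s') (fst (snd s')) (snd (snd s'))"
    for s s' :: "(point set \<Rightarrow> real) \<times> (point set \<Rightarrow> real^3) \<times> (point set \<Rightarrow> real)"
  define s\<^sub>0 :: "(point set \<Rightarrow> real) \<times> (point set \<Rightarrow> real^3) \<times> (point set \<Rightarrow> real)"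
    where "s\<^sub>0 = (\<lambda>K. cell_avg K n00, \<lambda>K. cell_avg K nvec0, \<lambda>_. 0)"
  have init: "Inv s\<^sub>0"
    unfolding Inv_def
  proof
    fix K assume K: "K \<in> cells M"
    interpret cell_of_domain \<Omega> K by (rule cell[OF K])
    have avg: "cell_avg K (\<lambda>x. n00 x / 2 + nvec0 x \<bullet> m) = cell_avg K n00 / 2 + cell_avg K nvec0 \<bullet> m"
      "cell_avg K (\<lambda>x. n00 x / 2 + - (nvec0 x \<bullet> m)) = cell_avg K n00 / 2 - cell_avg K nvec0 \<bullet> m"
      unfolding cell_avg_add[OF Linf_m(1,2)] cell_avg_add[OF Linf_m(1,3)] cell_avg_linear[OF lin_m(1) assms(19)]
        cell_avg_linear[OF lin_m(2) assms(19)] cell_avg_linear[OF lin_m(4) assms(18)] by simp_all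
    have perp: "cell_avg K nperp0 = cell_avg K nvec0 - (cell_avg K nvec0 \<bullet> m) *\<^sub>R m"
      unfolding assms(30) by (rule cell_avg_linear[OF lin_m(3) assms(19)])
    have int: "integrable (lebesgue_on K) (\<lambda>x. n00 x / 2 + nvec0 x \<bullet> m)"
      "integrable (lebesgue_on K) (\<lambda>x. n00 x / 2 + - (nvec0 x \<bullet> m))"
      using Linf_add Linf_m by (auto intro!: cell_integrable simp del: add_uminus_conv_diff)
    have "0 \<le> cell_avg K n00 / 2 + cell_avg K nvec0 \<bullet> m" "0 \<le> cell_avg K n00 / 2 - cell_avg K nvec0 \<bullet> m"
      unfolding avg[symmetric]
      by (rule cell_avg_nonneg[OF int(1)], use assms(21) in eventually_elim, simp)
         (rule cell_avg_nonneg[OF int(2)], use assms(21) in eventually_elim, simp)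
    moreover have "cell_avg K n00 / 2 + cell_avg K nvec0 \<bullet> m \<le> M0" "cell_avg K n00 / 2 - cell_avg K nvec0 \<bullet> m \<le> M0"
      unfolding avg[symmetric]
      by (rule cell_avg_le[OF int(1)], use AE_long in eventually_elim, linarith)
         (rule cell_avg_le[OF int(2)], use AE_long in eventually_elim, linarith)
    moreover have "norm (cell_avg K nvec0 - (cell_avg K nvec0 \<bullet> m) *\<^sub>R m) \<le> M0"
      unfolding perp[symmetric] by (rule norm_cell_avg_le[OF Linf_m(4) AE_perp])
    ultimately show "0 \<le> fst s\<^sub>0 K / 2 + fst (snd s\<^sub>0) K \<bullet> m \<and> fst s\<^sub>0 K / 2 + fst (snd s\<^sub>0) K \<bullet> m \<le> M0 \<and>
      0 \<le> fst s\<^sub>0 K / 2 - fst (snd s\<^sub>0) K \<bullet> m \<and> fst s\<^sub>0 K / 2 - fst (snd s\<^sub>0) K \<bullet> m \<le> M0 \<and>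
      norm (fst (snd s\<^sub>0) K - (fst (snd s\<^sub>0) K \<bullet> m) *\<^sub>R m) \<le> M0"
      by (simp add: s\<^sub>0_def)
  qed
  have step: "\<exists>s'. Inv s' \<and> Step s s'" if "Inv s" for s
  proof -
    have "\<exists>n0 n V. scheme_step M ?ED D p m \<gamma> \<tau> lD dt C nD_trace VD_trace (fst s) (fst (snd s)) n0 n V \<and>
      (\<forall>K\<in>cells M. 0 \<le> n0 K / 2 + n K \<bullet> m \<and> n0 K / 2 + n K \<bullet> m \<le> M0 \<and>
        0 \<le> n0 K / 2 - n K \<bullet> m \<and> n0 K / 2 - n K \<bullet> m \<le> M0 \<and> norm (n K - (n K \<bullet> m) *\<^sub>R m) \<le> M0)"
      by (rule scheme_step_exists)
         (use assms(8-11,14-16) M0 bd C_avg(1) relax that in \<open>auto simp: Inv_def\<close>)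
    then obtain n0 n V where "Inv (n0, n, V)" "Step s (n0, n, V)" by (auto simp: Inv_def Step_def)
    then show ?thesis by blast
  qed
  have "\<exists>f. \<forall>k. (Inv (f k) \<and> (k = 0 \<longrightarrow> f k = s\<^sub>0)) \<and> Step (f k) (f (Suc k))"
  proof (rule dependent_nat_choice)
    show "\<exists>s. Inv s \<and> (0 = 0 \<longrightarrow> s = s\<^sub>0)" using init by blast
    show "\<exists>s'. (Inv s' \<and> (Suc k = 0 \<longrightarrow> s' = s\<^sub>0)) \<and> Step s s'" if "Inv s \<and> (k = 0 \<longrightarrow> s = s\<^sub>0)" for s k
      using step that by simp
  qed
  then obtain f where f: "\<And>k. Inv (f k)" "f 0 = s\<^sub>0" "\<And>k. Step (f k) (f (Suc k))" by blast

  have growth: "1 \<le> (1 - \<alpha> * dt) powi (- int k)" for k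
  proof -
    have "0 \<le> \<alpha>" using assms(8,9,15) c0 by (simp add: assms(27) c\<^sub>0_def)
    moreover have "\<alpha> * dt < 1"
    proof (cases "c\<^sub>0 = 0")
      case True
      then show ?thesis by (simp add: assms(27) c\<^sub>0_def)
    next
      case False
      then have "0 < \<alpha>" using c0 assms(8,9,15) by (simp add: assms(27) c\<^sub>0_def)
      then show ?thesis using assms(28) False by (simp add: c\<^sub>0_def pos_less_divide_eq mult.commute)
    qed
    ultimately have "0 < 1 - \<alpha> * dt" "1 - \<alpha> * dt \<le> 1" using assms(16) by auto
    then have "1 \<le> inverse ((1 - \<alpha> * dt) ^ k)" by (intro one_le_inverse) (auto simp: power_le_one)
    then show ?thesis by (simp add: power_int_minus)
  qed
  show ?thesis
  proof (rule exI[of _ "\<lambda>k. fst (f k)"], rule exI[of _ "\<lambda>k. fst (snd (f k))"], rule exI[of _ "\<lambda>k. snd (snd (f k))"],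
      intro conjI allI impI ballI)
    show "fst (f 0) K = cell_avg K n00" "fst (snd (f 0)) K = cell_avg K nvec0" for K
      by (simp_all add: f(2) s\<^sub>0_def)
  next
    fix k :: nat assume "1 \<le> k"
    then show "scheme_step M ?ED D p m \<gamma> \<tau> lD dt C nD_trace VD_trace (fst (f (k - 1))) (fst (snd (f (k - 1))))
        (fst (f k)) (fst (snd (f k))) (snd (snd (f k)))"
      using f(3)[of "k - 1"] by (simp add: Step_def)
  next
    fix k K assume K: "K \<in> cells M"
    let ?charge = "fst (f k) K" and ?spin = "fst (snd (f k)) K"
    have b: "0 \<le> ?charge / 2 + ?spin \<bullet> m" "?charge / 2 + ?spin \<bullet> m \<le> M0" "0 \<le> ?charge / 2 - ?spin \<bullet> m" "?charge / 2 - ?spin \<bullet> m \<le> M0"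
      "norm (?spin - (?spin \<bullet> m) *\<^sub>R m) \<le> M0"
      using f(1)[of k] K by (auto simp: Inv_def)
    then show "0 \<le> ?charge / 2 + ?spin \<bullet> m" "?charge / 2 + ?spin \<bullet> m \<le> M0" "0 \<le> ?charge / 2 - ?spin \<bullet> m" "?charge / 2 - ?spin \<bullet> m \<le> M0"
      "0 \<le> ?charge" "?charge \<le> 2 * M0" by linarith+
    have "norm ?spin \<le> norm (?spin - (?spin \<bullet> m) *\<^sub>R m) + norm ((?spin \<bullet> m) *\<^sub>R m)"
      using norm_triangle_ineq[of "?spin - (?spin \<bullet> m) *\<^sub>R m" "(?spin \<bullet> m) *\<^sub>R m"] by simp
    also have "\<dots> \<le> 2 * M0" using b assms(11) by auto
    also have "\<dots> \<le> 2 * (M0 * (1 - \<alpha> * dt) powi (- int k))"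
      using mult_left_mono[OF growth[of k] M0] by simp
    finally show "norm ?spin \<le> 2 * (M0 * (1 - \<alpha> * dt) powi (- int k))" .
  qed
qed

end
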